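(* Let $F\in K[X,Y,Z,U,V]$ be a Perazzo form of degree $d\ge5$ such that $A_F$ has the minimal Hilbert function $(1,5,6,6,\dots,6,5,1)$. Then the nonzero graded Betti numbers $\beta_{i,j}=\beta^R_{ij}(A_F)=\dim_K[\operatorname{Tor}^R_i(A_F,K)]_j$ of $A_F$ over $R=K[x,y,z,u,v]$ are exactly: $\beta_{0,0}=1$; $\beta_{1,2}=9,\ \beta_{2,3}=17,\ \beta_{3,4}=12,\ \beta_{4,5}=3$; $\beta_{1,3}=1,\ \beta_{2,4}=3,\ \beta_{3,5}=3,\ \beta_{4,6}=1$; $\beta_{1,d-1}=1,\ \beta_{2,d}=3,\ \beta_{3,d+1}=3,\ \beta_{4,d+2}=1$; $\beta_{1,d}=3,\ \beta_{2,d+1}=12,\ \beta_{3,d+2}=17,\ \beta_{4,d+3}=9$; $\beta_{5,d+5}=1$. In particular the total Betti numbers are $1,14,35,35,14,1$.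
   Context: $K$ algebraically closed of characteristic zero. A Perazzo form here is $F=Xp_0+Yp_1+Zp_2+G$ with $p_0,p_1,p_2\in K[U,V]_{d-1}$ linearly independent and $G\in K[U,V]_d$; $R=K[x,y,z,u,v]$ acts on $K[X,Y,Z,U,V]$ by differentiation and $A_F=R/\operatorname{Ann}_RF$ is the associated Artinian Gorenstein algebra, with Hilbert function $\dim_K(A_F)_i$. *)

theory Defs
  imports Main "HOL-Computational_Algebra.Polynomial" "HOL-Library.Function_Algebras"
begin

text \<open>The five variables. The same index type is used for the variables
X,Y,Z,U,V of the polynomial ring S = K[X,Y,Z,U,V] (where F lives) and for
the variables x,y,z,u,v of R = K[x,y,z,u,v] (which acts on S by
differentiation, x_v acting as the partial derivative in X_v).\<close>

datatype var = X | Y | Z | U | V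

lemma UNIV_var: "(UNIV :: var set) = {X, Y, Z, U, V}"
  using var.exhaust by blast

instance var :: finite
  by standard (simp add: UNIV_var)

fun var_idx :: "var \<Rightarrow> nat" where
  "var_idx X = 0" | "var_idx Y = 1" | "var_idx Z = 2" | "var_idx U = 3" | "var_idx V = 4"

text \<open>Monomials are exponent vectors; a polynomial is its coefficient function.
Since we only ever use homogeneous polynomials (whose support is automatically
finite, there being finitely many monomials of a given degree), no separate
finite-support condition is needed.\<close>

type_synonym monom = "var \<Rightarrow> nat"
type_synonym 'k pol = "monom \<Rightarrow> 'k"

definition mdeg :: "monom \<Rightarrow> nat" where
  "mdeg m = (\<Sum>v\<in>UNIV. m v)"

definition homog :: "nat \<Rightarrow> ('k::zero) pol \<Rightarrow> bool" where
  "homog k p \<longleftrightarrow> (\<forall>m. p m \<noteq> 0 \<longrightarrow> mdeg m = k)"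

definition in_KUV :: "nat \<Rightarrow> ('k::zero) pol \<Rightarrow> bool" where
  "in_KUV k p \<longleftrightarrow> homog k p \<and> (\<forall>m. p m \<noteq> 0 \<longrightarrow> m X = 0 \<and> m Y = 0 \<and> m Z = 0)"

definition mulvar :: "var \<Rightarrow> ('k::zero) pol \<Rightarrow> 'k pol" where
  "mulvar v p = (\<lambda>m. if 0 < m v then p (m(v := m v - 1)) else 0)"

definition monom_var :: "var \<Rightarrow> monom" where
  "monom_var v = (\<lambda>w. if w = v then 1 else 0)"

definition pscale :: "'k::times \<Rightarrow> 'k pol \<Rightarrow> 'k pol" where
  "pscale a p = (\<lambda>m. a * p m)"

text \<open>Apolarity / contraction action of R on S: for r in R and F in S,
r \<circ> F = sum over monomials x^a of r_a * d^a F / dX^a, where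
d^a X^b / dX^a = (prod_v b_v!/(b_v - a_v)!) X^(b-a).  Thus the coefficient of
X^m in r \<circ> F is sum_a r_a F_(m+a) prod_v (m_v+a_v)!/m_v!.\<close>
definition contract :: "('k::field_char_0) pol \<Rightarrow> 'k pol \<Rightarrow> 'k pol" where
  "contract r F = (\<lambda>m. \<Sum>a\<in>{a. r a \<noteq> 0}.
      r a * F (\<lambda>v. m v + a v) *
      of_nat (\<Prod>v\<in>UNIV. fact (m v + a v) div fact (m v)))"

text \<open>Graded pieces R_k and (Ann_R F)_k = {r in R_k. r \<circ> F = 0}.
(For F homogeneous, Ann_R F is a homogeneous ideal, so A_F = R / Ann_R F is
graded with (A_F)_k = R_k / (Ann_R F)_k.)\<close>
definition Rdeg :: "nat \<Rightarrow> ('k::zero) pol set" where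
  "Rdeg k = {r. homog k r}"

definition Ann_deg :: "('k::field_char_0) pol \<Rightarrow> nat \<Rightarrow> 'k pol set" where
  "Ann_deg F k = {r. homog k r \<and> contract r F = (\<lambda>m. 0)}"

definition pol_dim :: "('k::field) pol set \<Rightarrow> nat" where
  "pol_dim S = vector_space.dim pscale S"

definition hilb :: "('k::field_char_0) pol \<Rightarrow> nat \<Rightarrow> nat" where
  "hilb F k = pol_dim (Rdeg k :: 'k pol set) - pol_dim (Ann_deg F k)"

definition perazzo_form :: "nat \<Rightarrow> ('k::field_char_0) pol \<Rightarrow> bool" where
  "perazzo_form d F \<longleftrightarrow>
     (\<exists>p0 p1 p2 G. in_KUV (d - 1) p0 \<and> in_KUV (d - 1) p1 \<and> in_KUV (d - 1) p2 \<and>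
        (\<forall>a b c. (\<lambda>m. a * p0 m + b * p1 m + c * p2 m) = (\<lambda>m. 0) \<longrightarrow> a = 0 \<and> b = 0 \<and> c = 0) \<and>
        in_KUV d G \<and>
        F = (\<lambda>m. mulvar X p0 m + mulvar Y p1 m + mulvar Z p2 m + G m))"

definition minimal_hilb :: "nat \<Rightarrow> nat \<Rightarrow> nat" where
  "minimal_hilb d k =
     (if k = 0 then 1 else if k = 1 then 5 else if k \<le> d - 2 then 6
      else if k = d - 1 then 5 else if k = d then 1 else 0)"

text \<open>beta_{i,j}(A_F) = dim_K Tor_i^R(A_F,K)_j, computed as the homology in
homological degree i and internal degree j of the Koszul complex
K(x,y,z,u,v) \<otimes>_R A_F, whose (i,j)-chains are A_F-valued functions on
i-element subsets S of the variables with values in (A_F)_{j-i}.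
We realise this with R-valued chains: C_{i,j} consists of functions
c :: var set => R with c S in R_{j-i} for |S| = i and c S = 0 otherwise;
N_{i,j} \<subseteq> C_{i,j} are those chains with values in Ann_R F, so that
C_{i,j}/N_{i,j} is the chain group of K(x) \<otimes> A_F.\<close>

type_synonym 'k chain = "var set \<Rightarrow> 'k pol"

definition chains :: "nat \<Rightarrow> nat \<Rightarrow> ('k::zero) chain set" where
  "chains i j = {c. \<forall>S. (card S = i \<and> i \<le> j \<longrightarrow> homog (j - i) (c S)) \<and>
                        (\<not> (card S = i \<and> i \<le> j) \<longrightarrow> c S = (\<lambda>m. 0))}"

definition ann_chains :: "('k::field_char_0) pol \<Rightarrow> nat \<Rightarrow> nat \<Rightarrow> 'k chain set" where
  "ann_chains F i j = {c \<in> chains i j. \<forall>S. c S \<in> Ann_deg F (j - i) \<or> c S = (\<lambda>m. 0)}"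

definition koszul_d :: "('k::comm_ring_1) chain \<Rightarrow> 'k chain" where
  "koszul_d c = (\<lambda>T m. \<Sum>v\<in>UNIV - T.
      (-1) ^ card {w\<in>T. var_idx w < var_idx v} * mulvar v (c (insert v T)) m)"

definition chain_scale :: "'k::times \<Rightarrow> 'k chain \<Rightarrow> 'k chain" where
  "chain_scale a c = (\<lambda>S m. a * c S m)"

definition chain_dim :: "('k::field) chain set \<Rightarrow> nat" where
  "chain_dim A = vector_space.dim chain_scale A"

text \<open>beta_{i,j} = dim (Z_{i,j} / (B_{i,j} + N_{i,j})) = dim Z - dim (B + N), where
Z = chains whose boundary lies in N_{i-1,j}, B = d(C_{i+1,j}).\<close>
definition betti :: "('k::field_char_0) pol \<Rightarrow> nat \<Rightarrow> nat \<Rightarrow> nat" where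
  "betti F i j =
     (let Zc = {c \<in> chains i j. i = 0 \<or> koszul_d c \<in> ann_chains F (i - 1) j};
          Bc = koszul_d ` chains (i + 1) j;
          BN = {(\<lambda>S m. b S m + n S m) | b n. b \<in> Bc \<and> n \<in> ann_chains F i j}
      in chain_dim Zc - chain_dim BN)"

definition perazzo_betti :: "nat \<Rightarrow> nat \<Rightarrow> nat \<Rightarrow> nat" where
  "perazzo_betti d i j =
     (if (i, j) = (0, 0) then 1
      else if (i, j) = (1, 2) then 9 else if (i, j) = (2, 3) then 17
      else if (i, j) = (3, 4) then 12 else if (i, j) = (4, 5) then 3
      else if (i, j) = (1, 3) then 1 else if (i, j) = (2, 4) then 3
      else if (i, j) = (3, 5) then 3 else if (i, j) = (4, 6) then 1
      else if (i, j) = (1, d - 1) then 1 else if (i, j) = (2, d) then 3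
      else if (i, j) = (3, d + 1) then 3 else if (i, j) = (4, d + 2) then 1
      else if (i, j) = (1, d) then 3 else if (i, j) = (2, d + 1) then 12
      else if (i, j) = (3, d + 2) then 17 else if (i, j) = (4, d + 3) then 9
      else if (i, j) = (5, d + 5) then 1 else 0)"

end

theory Submission
  imports Defs
begin

text \<open>After passing to divided powers, differentiation becomes a shift of coefficients, and \<open>(A_F)_k\<close>
  becomes the space \<open>N_k\<close> of \<open>k\<close>-th derivatives of the rescaled form \<open>f\<close>. Rank--nullity expresses each
  Betti number by the dimensions of the spaces of Koszul cycles with values in \<open>N_k\<close>.

  Products of two of \<open>x, y, z\<close> kill \<open>f\<close>, so \<open>W = \<langle>x f, y f, z f\<rangle>\<close> consists of binary forms. For a suitable
  \<open>v' = v + t u\<close> multiplication by \<open>v'\<close> is injective on \<open>W\<close>; since \<open>dim N_2 = 6\<close>, this forces \<open>u W \<subseteq> v' W\<close>,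
  and it follows that \<open>v'\<close> is injective on \<open>N_k\<close> for \<open>k \<le> d - 3\<close>, hence bijective \<open>N_k \<rightarrow> N_{k+1}\<close> for
  \<open>2 \<le> k \<le> d - 3\<close>, while on \<open>N_{d-2}\<close> its kernel is a line killed by \<open>x, y, z\<close>. A Koszul cycle is
  therefore determined, up to this line, by its components at the sets not containing \<open>V\<close>, and these
  components are arbitrary except for one condition in degree one coming from \<open>u^2 f \<notin> v' N_1\<close>. In the two top
  degrees \<open>N_k\<close> consists of all forms, and exactness of the Koszul complex of the polynomial ring counts the cycles.\<close>

text \<open>By rank-nullity the boundaries in degree k are counted by the cycles in degree k - 1, so
  each Betti number is a combination of Hilbert function values and cycle counts. If the count is 6
  (4 choose i) in both degrees, Pascal's rule makes everything cancel; this empties the middle rows.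
  In row k = 2 the extra generator u^2 f of N_2 would give 4 choose i, and the loss of one dimension
  for each index set of size i + 1 that contains U and avoids V leaves 3 choose (i - 1). In row k =
  d - 2 the kernel line adds one dimension for each index set of size i that contains V and avoids
  U, again 3 choose (i - 1). These are the two groups 1, 3, 3, 1. The symmetry of the table is not
  an input: the upper rows are counted separately. The obstacle is that v itself may kill an element
  of W. This forces the general v' and a change of basis of the Koszul complex that keeps the
  dimensions of the cycle spaces.\<close>

section \<open>Dimensions of finitely spanned sets\<close>

locale fd_space = V: vector_space scale for scale :: "'a::field \<Rightarrow> 'b::ab_group_add \<Rightarrow> 'b"
begin

text \<open>Coefficient functions form an infinite-dimensional space, and \<open>dim\<close> is
  informative only for finitely spanned sets; this predicate marks the sets whose dimensions may be
  compared.\<close>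

definition fin_dim :: "'b set \<Rightarrow> bool" where
  "fin_dim S \<longleftrightarrow> (\<exists>B. finite B \<and> S \<subseteq> V.span B)"

lemma fin_dim_subset: "fin_dim T \<Longrightarrow> S \<subseteq> T \<Longrightarrow> fin_dim S"
  unfolding fin_dim_def by blast

lemma fin_dim_basis:
  assumes "fin_dim S"
  obtains B where "B \<subseteq> S" "finite B" "V.independent B" "S \<subseteq> V.span B" "card B = V.dim S"
proof -
  obtain B where B: "B \<subseteq> S" "V.independent B" "S \<subseteq> V.span B" "card B = V.dim S"
    using V.basis_exists by blast
  obtain C where "finite C" "S \<subseteq> V.span C" using assms unfolding fin_dim_def by blast
  then have "finite B" using B V.independent_span_bound[of C B] by blast
  then show thesis using B that by blast
qed

lemma dim_le_of_subset:
  assumes "fin_dim T" "S \<subseteq> T"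
  shows "V.dim S \<le> V.dim T"
proof -
  obtain B where "B \<subseteq> T" "finite B" "V.independent B" "T \<subseteq> V.span B" "card B = V.dim T"
    using fin_dim_basis[OF assms(1)] by blast
  then show ?thesis using V.dim_le_card[of S B] assms(2) by auto
qed

text \<open>Indexing the family makes two equal members count as a relation, so that a list of
  vectors need not be shown distinct before it is used.\<close>

lemma family_dependent:
  assumes "fin_dim T" "finite I" "\<And>i. i \<in> I \<Longrightarrow> g i \<in> T" "V.dim T < card I"
  shows "\<exists>c. (\<exists>i\<in>I. c i \<noteq> 0) \<and> (\<Sum>i\<in>I. scale (c i) (g i)) = 0"
proof (cases "inj_on g I")
  case False
  then obtain i j where ij: "i \<in> I" "j \<in> I" "i \<noteq> j" "g i = g j" unfolding inj_on_def by blast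
  define c where "c = (\<lambda>k. if k = i then 1 else if k = j then -1 else (0::'a))"
  have "(\<Sum>k\<in>I. scale (c k) (g k)) = (\<Sum>k\<in>{i,j}. scale (c k) (g k))"
    using ij assms(2) by (intro sum.mono_neutral_right) (auto simp: c_def)
  also have "\<dots> = 0" using ij by (simp add: c_def)
  finally show ?thesis using ij by (intro exI[of _ c]) (auto simp: c_def)
next
  case True
  obtain B where B: "B \<subseteq> T" "finite B" "V.independent B" "T \<subseteq> V.span B" "card B = V.dim T"
    using fin_dim_basis[OF assms(1)] by blast
  have "V.dependent (g ` I)"
  proof (rule ccontr)
    assume "V.independent (g ` I)"
    then have "card (g ` I) \<le> card B"
      using V.independent_span_bound[of B "g ` I"] B assms(3) by blast
    then show False using assms(4) B card_image[OF True] by simp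
  qed
  then obtain u where u: "\<exists>v\<in>g ` I. u v \<noteq> 0" "(\<Sum>v\<in>g ` I. scale (u v) v) = 0"
    using V.dependent_finite[of "g ` I"] assms(2) by auto
  then show ?thesis using sum.reindex[OF True, of "\<lambda>v. scale (u v) v"]
    by (intro exI[of _ "\<lambda>i. u (g i)"]) auto
qed

lemma dim_eq_imp_eq:
  assumes "fin_dim T" "S \<subseteq> T" "V.subspace S" "V.dim T \<le> V.dim S"
  shows "S = T"
proof -
  obtain B where B: "B \<subseteq> S" "finite B" "V.independent B" "S \<subseteq> V.span B" "card B = V.dim S"
    using fin_dim_basis[OF fin_dim_subset[OF assms(1,2)]] by blast
  have sp: "V.span B = S" using B assms(3) V.span_minimal by blast
  have "x \<in> S" if x: "x \<in> T" for x
  proof (rule ccontr)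
    assume "x \<notin> S"
    then have i: "V.independent (insert x B)" using B sp V.independent_insertI by blast
    obtain C where C: "C \<subseteq> T" "finite C" "V.independent C" "T \<subseteq> V.span C" "card C = V.dim T"
      using fin_dim_basis[OF assms(1)] by blast
    have "insert x B \<subseteq> V.span C" using x C B assms by blast
    then have "card (insert x B) \<le> card C" using V.independent_span_bound[OF C(2) i] by blast
    moreover have "x \<notin> B" using \<open>x \<notin> S\<close> B by blast
    ultimately show False using B C assms by simp
  qed
  then show ?thesis using assms(2) by blast
qed

lemma dim_zero_iff:
  assumes "fin_dim S"
  shows "V.dim S = 0 \<longleftrightarrow> S \<subseteq> {0}"
proof
  assume 0: "V.dim S = 0"
  obtain B where "B \<subseteq> S" "finite B" "V.independent B" "S \<subseteq> V.span B" "card B = V.dim S"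
    using fin_dim_basis[OF assms] by blast
  then show "S \<subseteq> {0}" using 0 by auto
next
  assume "S \<subseteq> {0}"
  then show "V.dim S = 0" using V.dim_le_card[of S "{}"] by simp
qed

end

locale fd_space_pair = vector_space_pair scale1 scale2 + vs1: fd_space scale1 + vs2: fd_space scale2
  for scale1 :: "'a::field \<Rightarrow> 'b::ab_group_add \<Rightarrow> 'b" (infixr "*a" 75)
  and scale2 :: "'a \<Rightarrow> 'c::ab_group_add \<Rightarrow> 'c" (infixr "*b" 75)
begin

text \<open>A basis of the kernel is extended to a basis of \<open>S\<close>; the added vectors map
  injectively onto a basis of the image.\<close>

lemma rank_nullity:
  assumes f: "Vector_Spaces.linear scale1 scale2 f" and S: "vs1.subspace S" and fin: "vs1.fin_dim S"
  shows "vs1.dim S = vs1.dim {x\<in>S. f x = 0} + vs2.dim (f ` S)"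
proof -
  interpret f: Vector_Spaces.linear scale1 scale2 f by (rule f)
  let ?K = "{x\<in>S. f x = 0}"
  have K: "vs1.subspace ?K"
    using S unfolding vs1.subspace_def by (simp add: f.add f.scale)
  have finK: "vs1.fin_dim ?K" by (rule vs1.fin_dim_subset[OF fin]) simp
  obtain B where B: "B \<subseteq> ?K" "finite B" "vs1.independent B" "?K \<subseteq> vs1.span B" "card B = vs1.dim ?K"
    using vs1.fin_dim_basis[OF finK] .
  obtain A where A: "B \<subseteq> A" "A \<subseteq> S" "vs1.independent A" "S \<subseteq> vs1.span A"
    using vs1.maximal_independent_subset_extend[of B S] B by blast
  obtain C where "finite C" "S \<subseteq> vs1.span C" using fin unfolding vs1.fin_dim_def by blast
  then have finA: "finite A" using A vs1.independent_span_bound[of C A] by blast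
  let ?D = "A - B"
  have iD: "vs1.independent ?D" using A vs1.independent_mono by blast
  have inj: "inj_on f (vs1.span ?D)"
    unfolding linear_inj_on_iff_eq_0[OF f vs1.subspace_span]
  proof (intro ballI impI)
    fix x assume x: "x \<in> vs1.span ?D" "f x = 0"
    have "x \<in> S" using x A S vs1.span_minimal[of ?D S] by blast
    then have "x \<in> vs1.span B" using x B by blast
    then obtain p where p: "x = (\<Sum>b\<in>B. scale1 (p b) b)"
      unfolding vs1.span_finite[OF B(2)] by blast
    obtain q where q: "x = (\<Sum>b\<in>?D. scale1 (q b) b)"
      using x(1) unfolding vs1.span_finite[OF finite_Diff[OF finA]] by blast
    \<comment> \<open>A kernel element in the span of the added vectors has two expansions; their
      difference is a relation on the independent set \<open>A\<close>.\<close>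
    define u where "u = (\<lambda>b. if b \<in> B then p b else - q b)"
    have "(\<Sum>b\<in>A. scale1 (u b) b) = (\<Sum>b\<in>?D. scale1 (u b) b) + (\<Sum>b\<in>B. scale1 (u b) b)"
      using sum.subset_diff[OF A(1) finA] by blast
    also have "(\<Sum>b\<in>B. scale1 (u b) b) = x" unfolding p by (simp add: u_def)
    also have "(\<Sum>b\<in>?D. scale1 (u b) b) = - x" unfolding q
      by (simp add: u_def sum_negf vs1.scale_minus_left)
    finally have "(\<Sum>b\<in>A. scale1 (u b) b) = 0" by simp
    then have "\<And>b. b \<in> A \<Longrightarrow> u b = 0" using vs1.independentD[OF A(3) finA] by blast
    then have "\<And>b. b \<in> B \<Longrightarrow> p b = 0" using A(1) unfolding u_def by (metis subsetD)
    then show "x = 0" unfolding p by simp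
  qed
  have i2: "vs2.independent (f ` ?D)" using f.independent_injective_image[OF iD inj] .
  have "f ` S = f ` vs1.span ?D"
  proof
    show "f ` vs1.span ?D \<subseteq> f ` S" using A S vs1.span_minimal[of ?D S] by blast
    show "f ` S \<subseteq> f ` vs1.span ?D"
    proof
      fix y assume "y \<in> f ` S"
      then obtain x where x: "x \<in> S" "y = f x" by blast
      have "x \<in> vs1.span (B \<union> ?D)" using x A by (metis Un_Diff_cancel subsetD sup.absorb2)
      then obtain b e where be: "x = b + e" "b \<in> vs1.span B" "e \<in> vs1.span ?D"
        unfolding vs1.span_Un by blast
      have "b \<in> ?K" using be(2) vs1.span_minimal[OF B(1) K] by blast
      then show "y \<in> f ` vs1.span ?D" using be x f.add by auto
    qed
  qed
  then have "vs2.dim (f ` S) = vs2.dim (vs2.span (f ` ?D))" using f.span_image by simp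
  also have "\<dots> = card (f ` ?D)" using i2 vs2.dim_eq_card_independent by simp
  also have "\<dots> = card ?D" using inj vs1.span_superset inj_on_subset by (metis card_image)
  finally have "vs2.dim (f ` S) = card A - card B" using A B finA by (simp add: card_Diff_subset)
  moreover have "card A = vs1.dim S" using A vs1.basis_card_eq_dim by blast
  moreover have "card B \<le> card A" using A finA card_mono by blast
  ultimately show ?thesis using B by simp
qed

end

interpretation pol: vector_space "pscale :: 'k::field \<Rightarrow> 'k pol \<Rightarrow> 'k pol"
  by standard (auto simp: pscale_def fun_eq_iff algebra_simps)

interpretation chn: vector_space "chain_scale :: 'k::field \<Rightarrow> 'k chain \<Rightarrow> 'k chain"
  by standard (auto simp: chain_scale_def fun_eq_iff algebra_simps)

interpretation pol: fd_space "pscale :: 'k::field \<Rightarrow> 'k pol \<Rightarrow> 'k pol" ..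
interpretation chn: fd_space "chain_scale :: 'k::field \<Rightarrow> 'k chain \<Rightarrow> 'k chain" ..

interpretation pp: fd_space_pair "pscale :: 'k::field \<Rightarrow> 'k pol \<Rightarrow> 'k pol" pscale ..
interpretation cp: fd_space_pair "chain_scale :: 'k::field \<Rightarrow> 'k chain \<Rightarrow> 'k chain" pscale ..
interpretation cc: fd_space_pair "chain_scale :: 'k::field \<Rightarrow> 'k chain \<Rightarrow> 'k chain" chain_scale ..

lemma sum_fun_eval: "(\<Sum>i\<in>I. f i) x = (\<Sum>i\<in>I. (f i x :: 'a::comm_monoid_add))"
  by (induction I rule: infinite_finite_induct) auto

lemma pscale_apply [simp]: "pscale a p m = a * p m"
  by (simp add: pscale_def)

lemma chain_scale_apply [simp]: "chain_scale a c S = pscale a (c S)"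
  by (simp add: chain_scale_def pscale_def)

lemma pp_linearI:
  assumes "\<And>x y. f (x + y) = f x + f y" "\<And>c x. f (pscale c x) = pscale c (f x)"
  shows "Vector_Spaces.linear pscale pscale f"
  using assms by (simp add: Vector_Spaces.linear_iff pol.vector_space_axioms)

lemma pp_linear_sum:
  assumes "Vector_Spaces.linear pscale pscale f"
  shows "f (\<Sum>i\<in>I. g i) = (\<Sum>i\<in>I. f (g i))"
proof -
  interpret f: Vector_Spaces.linear pscale pscale f by (rule assms)
  show ?thesis by (rule f.sum)
qed

lemma cc_linearI:
  assumes "\<And>x y. f (x + y) = f x + f y" "\<And>c x. f (chain_scale c x) = chain_scale c (f x)"
  shows "Vector_Spaces.linear chain_scale chain_scale f"
  using assms by (simp add: Vector_Spaces.linear_iff chn.vector_space_axioms)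

lemma cp_linearI:
  assumes "\<And>x y. f (x + y) = f x + f y" "\<And>c x. f (chain_scale c x) = pscale c (f x)"
  shows "Vector_Spaces.linear chain_scale pscale f"
  using assms by (simp add: Vector_Spaces.linear_iff chn.vector_space_axioms pol.vector_space_axioms)

section \<open>Homogeneous functions and the shift action\<close>

definition mons :: "nat \<Rightarrow> monom set" where "mons k = {a. mdeg a = k}"

lemma mdeg_add: "mdeg (a + b) = mdeg a + mdeg b"
  by (simp add: mdeg_def sum.distrib)

lemma mdeg_monom_var [simp]: "mdeg (monom_var w) = 1"
  by (simp add: mdeg_def monom_var_def)

lemma mdeg_0_iff: "mdeg m = 0 \<longleftrightarrow> m = 0"
  by (auto simp: mdeg_def fun_eq_iff)

lemma finite_mons: "finite (mons k)"
proof -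
  have "finite {f. \<forall>x::var. (x \<in> UNIV \<longrightarrow> f x \<in> {0..k}) \<and> (x \<notin> UNIV \<longrightarrow> f x = 0)}"
    by (rule finite_set_of_finite_funs) auto
  then show ?thesis
    by (rule rev_finite_subset) (auto simp: mons_def mdeg_def intro!: member_le_sum)
qed

lemma monom_minus_var: "0 < m w \<Longrightarrow> \<exists>m'. m = m' + monom_var w"
  by (rule exI[of _ "m(w := m w - 1)"]) (auto simp: fun_eq_iff monom_var_def)

definition shift :: "monom \<Rightarrow> 'k pol \<Rightarrow> 'k pol" where
  "shift a f = (\<lambda>m. f (m + a))"

definition dv :: "var \<Rightarrow> 'k pol \<Rightarrow> 'k pol" where
  "dv w = shift (monom_var w)"

lemma shift_simps [simp]:
  "shift a (f + g) = shift a f + shift a (g :: 'k::field pol)"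
  "shift a (f - g) = shift a f - shift a (g :: 'k pol)"
  "shift a (- g) = - shift a (g :: 'k pol)"
  "shift a 0 = (0 :: 'k pol)"
  "shift a (pscale c f) = pscale c (shift a f)"
  "shift 0 f = f"
  by (simp_all add: shift_def fun_eq_iff)

lemma linear_shift: "Vector_Spaces.linear pscale pscale (shift a :: 'k::field pol \<Rightarrow> _)"
  by (rule pp_linearI) simp_all

lemma shift_sum [simp]: "shift a (\<Sum>i\<in>I. g i) = (\<Sum>i\<in>I. shift a (g i :: 'k::field pol))"
  by (rule pp_linear_sum[OF linear_shift])

lemma shift_shift: "shift a (shift b f) = shift (a + b) f"
  by (simp add: shift_def add.assoc)

lemma shift_comm: "shift a (shift b f) = shift b (shift a f)"
  by (simp add: shift_shift add.commute)

lemma dv_comm: "dv v (dv w f) = dv w (dv v f)"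
  by (simp add: dv_def shift_comm)

lemma dv_shift: "dv v (shift a f) = shift a (dv v f)"
  by (simp add: dv_def shift_comm)

lemma dv_simps [simp]:
  "dv a (f + g) = dv a f + dv a (g :: 'k::field pol)"
  "dv a (f - g) = dv a f - dv a (g :: 'k pol)"
  "dv a (- g) = - dv a (g :: 'k pol)"
  "dv a 0 = (0 :: 'k pol)"
  "dv a (pscale c f) = pscale c (dv a f)"
  "dv a (\<Sum>i\<in>I. h i) = (\<Sum>i\<in>I. dv a (h i :: 'k::field pol))"
  by (simp_all add: dv_def)

lemma linear_dv: "Vector_Spaces.linear pscale pscale (dv a :: 'k::field pol \<Rightarrow> _)"
  by (rule pp_linearI) simp_all

lemma homog_shift: "homog e f \<Longrightarrow> homog (e - mdeg a) (shift a f)"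
  by (auto simp: homog_def shift_def mdeg_add)

lemma homog_dv: "homog e f \<Longrightarrow> homog (e - 1) (dv w f)"
  using homog_shift[of e f "monom_var w"] by (simp add: dv_def)

text \<open>A monomial of positive degree is divisible by some variable, so each coefficient
  reappears in a first derivative. Constants are the reason for \<open>0 < e\<close>.\<close>

lemma homog_eq_0I:
  assumes "homog e f" "0 < e" "\<And>w. dv w f = (0 :: 'k::field pol)"
  shows "f = 0"
proof
  fix m
  show "f m = 0 m"
  proof (cases "mdeg m = e")
    case True
    then have "m \<noteq> 0" using assms(2) mdeg_0_iff[of m] by auto
    then obtain w where "0 < m w" by (auto simp: fun_eq_iff)
    then obtain m' where "m = m' + monom_var w" using monom_minus_var by blast
    then have "f m = dv w f m'" by (simp add: dv_def shift_def)
    then show ?thesis by (simp add: assms(3))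
  qed (use assms in \<open>auto simp: homog_def\<close>)
qed

lemma homog_0 [simp]: "homog k 0"
  by (simp add: homog_def)

lemma homog_add: "homog k f \<Longrightarrow> homog k g \<Longrightarrow> homog k (f + g :: 'k::field pol)"
  unfolding homog_def by (metis add.left_neutral plus_fun_apply)

lemma homog_pscale: "homog k f \<Longrightarrow> homog k (pscale c f :: 'k::field pol)"
  by (auto simp: homog_def)

lemma subspace_Rdeg: "pol.subspace (Rdeg k :: 'k::field pol set)"
  unfolding pol.subspace_def by (auto simp: Rdeg_def homog_add homog_pscale)

definition monomial :: "monom \<Rightarrow> 'k::field pol" where
  "monomial a = (\<lambda>m. if m = a then 1 else 0)"

lemma homog_expand:
  assumes "homog k (r :: 'k::field pol)"
  shows "r = (\<Sum>a\<in>mons k. pscale (r a) (monomial a))"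
proof
  fix m
  have "(\<Sum>a\<in>mons k. pscale (r a) (monomial a)) m = (\<Sum>a\<in>mons k. if a = m then r m else 0)"
    unfolding sum_fun_eval by (intro sum.cong) (auto simp: monomial_def)
  also have "\<dots> = r m" using assms finite_mons[of k]
    by (auto simp: homog_def mons_def)
  finally show "r m = (\<Sum>a\<in>mons k. pscale (r a) (monomial a)) m" by simp
qed

lemma fin_dim_Rdeg: "pol.fin_dim (Rdeg k :: 'k::field pol set)"
  unfolding pol.fin_dim_def
proof (intro exI conjI subsetI)
  show "finite (monomial ` mons k :: 'k pol set)" by (simp add: finite_mons)
  fix r :: "'k pol" assume "r \<in> Rdeg k"
  then have r: "r = (\<Sum>a\<in>mons k. pscale (r a) (monomial a))" by (intro homog_expand) (simp add: Rdeg_def)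
  show "r \<in> pol.span (monomial ` mons k)"
    by (subst r) (intro pol.span_sum pol.span_scale pol.span_base imageI)
qed

text \<open>The sum runs over the finite set \<open>mons k\<close> instead of the support of
  \<open>r\<close>. This makes it linear in every coefficient function \<open>r\<close>; it is the
  action on \<open>f\<close> when \<open>r\<close> is homogeneous of degree
  \<open>k\<close>.\<close>

definition apol :: "nat \<Rightarrow> 'k::field pol \<Rightarrow> 'k pol \<Rightarrow> 'k pol" where
  "apol k f r = (\<Sum>a\<in>mons k. pscale (r a) (shift a f))"

lemma apol_add: "apol k f (r + s) = apol k f r + apol k f s"
  by (simp add: apol_def pol.scale_left_distrib sum.distrib)

lemma apol_pscale: "apol k f (pscale c r) = pscale c (apol k f r)"
  by (simp add: apol_def pol.scale_sum_right)

lemma apol_0: "apol k f 0 = 0"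
  by (simp add: apol_def)

lemma linear_apol: "Vector_Spaces.linear pscale pscale (apol k f)"
  by (rule pp_linearI) (simp_all add: apol_add apol_pscale)

lemma apol_sum: "apol k f (\<Sum>i\<in>I. h i) = (\<Sum>i\<in>I. apol k f (h i))"
  by (rule pp_linear_sum[OF linear_apol])

lemmas apol_simps = apol_add apol_pscale apol_0 apol_sum

lemma apol_monomial: "mdeg a = k \<Longrightarrow> apol k f (monomial a) = shift a f"
proof -
  assume a: "mdeg a = k"
  have "apol k f (monomial a) = (\<Sum>b\<in>mons k. if b = a then shift a f else 0)"
    unfolding apol_def by (intro sum.cong) (auto simp: monomial_def)
  then show ?thesis using a finite_mons by (simp add: mons_def)
qed

text \<open>Multiplication by a variable in R becomes differentiation of \<open>apol k f r\<close>.
  This carries the Koszul differential over from R to the spaces of derivatives.\<close>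

lemma apol_mulvar:
  assumes "homog k r"
  shows "apol (Suc k) f (mulvar w r) = dv w (apol k f r)"
proof -
  have mv: "mulvar w (monomial a) = (monomial (a + monom_var w) :: 'a pol)" for a
  proof
    fix m :: monom
    have "0 < m w \<Longrightarrow> m(w := m w - 1) = a \<longleftrightarrow> m = a + monom_var w"
      by (auto simp: fun_eq_iff monom_var_def)
    moreover have "m = a + monom_var w \<Longrightarrow> 0 < m w" by (simp add: monom_var_def)
    ultimately show "mulvar w (monomial a) m = (monomial (a + monom_var w) :: 'a pol) m"
      by (auto simp: mulvar_def monomial_def)
  qed
  have mlin: "mulvar w (\<Sum>a\<in>I. pscale (r a) (monomial a)) = (\<Sum>a\<in>I. pscale (r a) (mulvar w (monomial a) :: 'a pol))" for I
    by (auto simp: fun_eq_iff mulvar_def sum_fun_eval)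
  have "mulvar w r = (\<Sum>a\<in>mons k. pscale (r a) (monomial (a + monom_var w)))"
    using mlin[of "mons k"] homog_expand[OF assms] mv by simp
  then have "apol (Suc k) f (mulvar w r) = (\<Sum>a\<in>mons k. pscale (r a) (shift (a + monom_var w) f))"
    by (simp add: apol_simps apol_monomial mdeg_add mons_def)
  also have "\<dots> = dv w (apol k f r)"
    by (simp add: apol_def dv_def shift_shift add.commute)
  finally show ?thesis .
qed

definition derivs :: "'k::field pol \<Rightarrow> nat \<Rightarrow> 'k pol set" where
  "derivs f k = pol.span ((\<lambda>a. shift a f) ` mons k)"

lemma derivs_eq: "derivs f k = apol k f ` Rdeg k"
proof
  have s: "pol.subspace (apol k f ` Rdeg k)"
    using pp.linear_subspace_image[OF linear_apol subspace_Rdeg] .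
  have "shift a f \<in> apol k f ` Rdeg k" if "a \<in> mons k" for a
    using apol_monomial[of a k f] that
    by (intro image_eqI[of _ _ "monomial a"]) (auto simp: mons_def Rdeg_def homog_def monomial_def)
  then show "derivs f k \<subseteq> apol k f ` Rdeg k"
    unfolding derivs_def by (intro pol.span_minimal s) auto
  show "apol k f ` Rdeg k \<subseteq> derivs f k"
    unfolding derivs_def apol_def by (intro image_subsetI pol.span_sum pol.span_scale pol.span_base imageI)
qed

lemma subspace_derivs: "pol.subspace (derivs f k)"
  by (simp add: derivs_def)

lemma fin_dim_derivs: "pol.fin_dim (derivs f k)"
  unfolding pol.fin_dim_def derivs_def using finite_mons by blast

lemma dv_derivs: "n \<in> derivs f k \<Longrightarrow> dv w n \<in> derivs f (Suc k)"
proof -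
  have "shift a f \<in> {n. dv w n \<in> derivs f (Suc k)}" if "a \<in> mons k" for a
    using that unfolding derivs_def dv_def shift_shift
    by (auto simp: shift_shift mons_def mdeg_add intro!: pol.span_base)
  moreover have "pol.subspace {n. dv w n \<in> derivs f (Suc k)}"
    unfolding pol.subspace_def derivs_def by (auto simp: pol.span_zero pol.span_add pol.span_scale)
  ultimately have "derivs f k \<subseteq> {n. dv w n \<in> derivs f (Suc k)}"
    unfolding derivs_def[of f k] by (intro pol.span_minimal) auto
  then show "n \<in> derivs f k \<Longrightarrow> dv w n \<in> derivs f (Suc k)" by blast
qed

lemma homog_derivs: "homog d f \<Longrightarrow> n \<in> derivs f k \<Longrightarrow> homog (d - k) n"
proof -
  assume f: "homog d f" and n: "n \<in> derivs f k"
  have "derivs f k \<subseteq> Rdeg (d - k)" unfolding derivs_def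
    using f homog_shift by (intro pol.span_minimal subspace_Rdeg) (auto simp: Rdeg_def mons_def)
  then show ?thesis using n by (auto simp: Rdeg_def)
qed

text \<open>Divided powers: in the coefficients of \<open>hat f\<close> differentiation acts by shifting exponents.\<close>

definition hat :: "'k::field_char_0 pol \<Rightarrow> 'k pol" where
  "hat f = (\<lambda>m. f m * of_nat (\<Prod>v\<in>UNIV. fact (m v)))"

lemma hat_eq_0_iff: "hat f = 0 \<longleftrightarrow> f = 0"
  by (auto simp: hat_def fun_eq_iff)

lemma hat_contract:
  fixes F :: "'k::field_char_0 pol"
  assumes "homog k r"
  shows "hat (contract r F) = apol k (hat F) r"
proof
  fix m
  have div: "(\<Prod>v\<in>UNIV. fact (m v + a v) div fact (m v)) * (\<Prod>v\<in>UNIV. fact (m v)) =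
    (\<Prod>v\<in>UNIV. fact ((m + a) v) :: nat)" for a :: monom
    by (simp add: prod.distrib[symmetric] fact_dvd)
  have "hat (contract r F) m = (\<Sum>a\<in>{a. r a \<noteq> 0}. r a * hat F (m + a))"
    unfolding hat_def contract_def sum_distrib_right
    by (intro sum.cong refl) (simp only: mult.assoc of_nat_mult[symmetric] div, simp add: plus_fun_def)
  also have "\<dots> = (\<Sum>a\<in>mons k. r a * hat F (m + a))"
    using assms finite_mons by (intro sum.mono_neutral_left) (auto simp: homog_def mons_def)
  also have "\<dots> = apol k (hat F) r m" by (simp add: apol_def sum_fun_eval shift_def)
  finally show "hat (contract r F) m = apol k (hat F) r m" .
qed

lemma Ann_deg_eq:
  fixes F :: "'k::field_char_0 pol"
  shows "Ann_deg F k = {r \<in> Rdeg k. apol k (hat F) r = 0}"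
proof -
  have "homog k r \<Longrightarrow> contract r F = (\<lambda>m. 0) \<longleftrightarrow> apol k (hat F) r = 0" for r :: "'k pol"
    using hat_contract[of k r F] hat_eq_0_iff[of "contract r F"] by (simp add: zero_fun_def)
  then show ?thesis unfolding Ann_deg_def Rdeg_def by blast
qed

lemma dim_derivs_hat: "pol.dim (derivs (hat F) k) = hilb F k"
  using pp.rank_nullity[OF linear_apol[of k "hat F"] subspace_Rdeg fin_dim_Rdeg]
  by (simp add: hilb_def pol_dim_def derivs_eq Ann_deg_eq)

section \<open>Koszul complexes of a family of operators\<close>

definition fam :: "(var set \<Rightarrow> 'k pol set) \<Rightarrow> 'k chain set" where
  "fam M = {c. \<forall>S. c S \<in> M S}"

definition emb :: "var set \<Rightarrow> 'k::field pol \<Rightarrow> 'k chain" where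
  "emb S p = (\<lambda>T. if T = S then p else 0)"

lemma chain_expand: "c = (\<Sum>S\<in>UNIV. emb S (c S))"
proof
  fix T
  have "(\<Sum>S\<in>UNIV. emb S (c S)) T = (\<Sum>S\<in>UNIV. emb S (c S) T)" by (rule sum_fun_eval)
  also have "\<dots> = (\<Sum>S\<in>UNIV. if S = T then c T else 0)"
    by (intro sum.cong) (auto simp: emb_def)
  finally show "c T = (\<Sum>S\<in>UNIV. emb S (c S)) T" by simp
qed

lemma linear_emb: "Vector_Spaces.linear pscale chain_scale (emb S)"
  by (auto simp: Vector_Spaces.linear_iff chn.vector_space_axioms pol.vector_space_axioms emb_def fun_eq_iff)

interpretation pc: fd_space_pair "pscale :: 'k::field \<Rightarrow> 'k pol \<Rightarrow> 'k pol" chain_scale ..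

lemma linear_eval: "Vector_Spaces.linear chain_scale pscale (\<lambda>c. c S)"
  by (rule cp_linearI) auto

lemma subspace_fam: "(\<And>S. pol.subspace (M S)) \<Longrightarrow> chn.subspace (fam M)"
  unfolding chn.subspace_def pol.subspace_def fam_def by auto

lemma fin_dim_fam:
  assumes "\<And>S. pol.fin_dim (M S)"
  shows "chn.fin_dim (fam M)"
proof -
  obtain B where B: "\<And>S. finite (B S) \<and> M S \<subseteq> pol.span (B S)"
    using assms unfolding pol.fin_dim_def by metis
  have "c \<in> chn.span (\<Union>S. emb S ` B S)" if "c \<in> fam M" for c
  proof -
    have "emb S (c S) \<in> chn.span (\<Union>S. emb S ` B S)" for S
    proof -
      have "c S \<in> pol.span (B S)" using that B unfolding fam_def by blast
      then have "emb S (c S) \<in> chn.span (emb S ` B S)"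
        using pc.linear_span_image[OF linear_emb] by blast
      moreover have "chn.span (emb S ` B S) \<subseteq> chn.span (\<Union>S. emb S ` B S)"
        by (rule chn.span_mono) blast
      ultimately show ?thesis by blast
    qed
    then have "(\<Sum>S\<in>UNIV. emb S (c S)) \<in> chn.span (\<Union>S. emb S ` B S)"
      by (rule chn.span_sum)
    then show ?thesis using chain_expand[of c] by metis
  qed
  then show ?thesis unfolding chn.fin_dim_def using B
    by (intro exI[of _ "\<Union>S. emb S ` B S"]) auto
qed

text \<open>Evaluation at one index \<open>S0\<close> has image \<open>M S0\<close>, and its kernel
  is the same product with that factor replaced by zero; rank-nullity then peels off one factor at a
  time.\<close>

lemma dim_fam_aux:
  assumes "finite \<S>" "\<And>S. pol.subspace (M S)" "\<And>S. pol.fin_dim (M S)" "\<And>S. S \<notin> \<S> \<Longrightarrow> M S = {0}"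
  shows "chn.dim (fam M) = (\<Sum>S\<in>\<S>. pol.dim (M S))"
  using assms
proof (induction \<S> arbitrary: M rule: finite_induct)
  case empty
  then have "fam M \<subseteq> {0}" by (auto simp: fam_def fun_eq_iff)
  then have "chn.dim (fam M) = 0" using chn.dim_zero_iff[OF fin_dim_fam, of M] empty by blast
  then show "chn.dim (fam M) = (\<Sum>S\<in>{}. pol.dim (M S))" by simp
next
  case (insert S0 \<S>)
  let ?M = "M(S0 := {0})"
  have fin: "chn.fin_dim (fam M)" by (rule fin_dim_fam) (rule insert.prems)
  have zero: "M S = {0}" if "S \<notin> insert S0 \<S>" for S using that by (rule insert.prems)
  have k: "{c \<in> fam M. c S0 = 0} = fam ?M"
    using pol.subspace_0[OF insert.prems(1)] by (auto simp: fam_def split: if_splits)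
  have i: "(\<lambda>c. c S0) ` fam M = M S0"
  proof
    show "(\<lambda>c. c S0) ` fam M \<subseteq> M S0" by (auto simp: fam_def)
    show "M S0 \<subseteq> (\<lambda>c. c S0) ` fam M"
    proof
      fix p assume "p \<in> M S0"
      then show "p \<in> (\<lambda>c. c S0) ` fam M"
        using pol.subspace_0[OF insert.prems(1)]
        by (intro image_eqI[of _ _ "emb S0 p"]) (auto simp: emb_def fam_def)
    qed
  qed
  have f0: "pol.fin_dim {0::'a pol}" unfolding pol.fin_dim_def by (intro exI[of _ "{}"]) simp
  have "chn.dim (fam ?M) = (\<Sum>S\<in>\<S>. pol.dim (?M S))"
  proof (rule insert.IH)
    fix S
    show "pol.subspace (?M S)" using insert.prems(1)[of S] by (cases "S = S0") (simp_all del: pscale_apply)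
    show "pol.fin_dim (?M S)" using insert.prems(2)[of S] f0 by (cases "S = S0") (simp_all del: pscale_apply)
    show "S \<notin> \<S> \<Longrightarrow> ?M S = {0}" using zero[of S] by (cases "S = S0") simp_all
  qed
  also have "\<dots> = (\<Sum>S\<in>\<S>. pol.dim (M S))"
    using insert.hyps by (intro sum.cong) auto
  finally show "chn.dim (fam M) = (\<Sum>S\<in>insert S0 \<S>. pol.dim (M S))"
    using cp.rank_nullity[OF linear_eval[of S0] subspace_fam[OF insert.prems(1)] fin] k i insert.hyps by simp
qed

lemma dim_fam:
  assumes "\<And>S. pol.subspace (M S)" "\<And>S. pol.fin_dim (M S)"
  shows "chn.dim (fam M) = (\<Sum>S\<in>UNIV. pol.dim (M S))"
  using assms by (intro dim_fam_aux) auto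

lemma fin_dim_0: "pol.fin_dim {0::'k::field pol}"
  unfolding pol.fin_dim_def by (intro exI[of _ "{}"]) simp

definition sg :: "var set \<Rightarrow> var \<Rightarrow> 'k::comm_ring_1" where
  "sg T w = (-1) ^ card {x\<in>T. var_idx x < var_idx w}"

text \<open>With arbitrary operators \<open>A\<close>, one formula serves for multiplication in R,
  for differentiation, and for the operators after the change of variable.\<close>

definition kos :: "(var \<Rightarrow> 'k::field pol \<Rightarrow> 'k pol) \<Rightarrow> 'k chain \<Rightarrow> 'k chain" where
  "kos A c = (\<lambda>T. \<Sum>w\<in>UNIV - T. pscale (sg T w) (A w (c (insert w T))))"

lemma koszul_d_eq: "koszul_d c = kos mulvar c"
  by (simp add: koszul_d_def kos_def fun_eq_iff sum_fun_eval sg_def)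

lemma linear_kos:
  assumes "\<And>w. Vector_Spaces.linear pscale pscale (A w)"
  shows "Vector_Spaces.linear chain_scale chain_scale (kos A)"
proof (rule cc_linearI)
  interpret A: Vector_Spaces.linear pscale pscale "A w" for w by (rule assms)
  fix x y c
  show "kos A (x + y) = kos A x + kos A y"
    by (rule ext) (simp add: kos_def A.add pol.scale_right_distrib sum.distrib)
  show "kos A (chain_scale c x) = chain_scale c (kos A x)"
    by (rule ext) (simp add: kos_def A.scale pol.scale_sum_right mult.commute)
qed

definition kchains :: "'k::field pol \<Rightarrow> nat \<Rightarrow> nat \<Rightarrow> 'k chain set" where
  "kchains f i k = fam (\<lambda>S. if card S = i then derivs f k else {0})"

definition kcycles :: "(var \<Rightarrow> 'k::field pol \<Rightarrow> 'k pol) \<Rightarrow> 'k pol \<Rightarrow> nat \<Rightarrow> nat \<Rightarrow> 'k chain set" where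
  "kcycles A f i k = {c \<in> kchains f i k. kos A c = 0}"

lemma kchainsD:
  assumes "c \<in> kchains f i k"
  shows "card S = i \<Longrightarrow> c S \<in> derivs f k" "card S \<noteq> i \<Longrightarrow> c S = 0" "c S \<in> derivs f k"
proof -
  have c: "c S \<in> (if card S = i then derivs f k else {0})" using assms unfolding kchains_def fam_def by blast
  then show "card S = i \<Longrightarrow> c S \<in> derivs f k" "card S \<noteq> i \<Longrightarrow> c S = 0" by auto
  then show "c S \<in> derivs f k" using pol.subspace_0[OF subspace_derivs] by metis
qed

lemma kchainsI:
  assumes "\<And>S. card S = i \<Longrightarrow> c S \<in> derivs f k" "\<And>S. card S \<noteq> i \<Longrightarrow> c S = 0"
  shows "c \<in> kchains f i k"
  using assms by (auto simp: kchains_def fam_def)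

lemma subspace_kchains: "chn.subspace (kchains f i k)"
  unfolding kchains_def by (rule subspace_fam) (simp add: subspace_derivs)

lemma fin_dim_kchains: "chn.fin_dim (kchains f i k)"
  unfolding kchains_def by (rule fin_dim_fam) (simp add: fin_dim_derivs fin_dim_0)

lemma card_UNIV_var: "card (UNIV :: var set) = 5"
  by (simp add: UNIV_var)

lemma dim_kchains: "chn.dim (kchains f i k) = (5 choose i) * pol.dim (derivs f k)"
proof -
  have "chn.dim (kchains f i k) = (\<Sum>S\<in>(UNIV :: var set set). pol.dim (if card S = i then derivs f k else {0}))"
    unfolding kchains_def using dim_fam[of "\<lambda>S. if card S = i then derivs f k else {0}"]
    by (simp add: subspace_derivs fin_dim_derivs fin_dim_0)
  also have "\<dots> = (\<Sum>S\<in>{S::var set. card S = i}. pol.dim (derivs f k))"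
    using pol.dim_zero_iff[OF fin_dim_0] by (intro sum.mono_neutral_cong_right) auto
  also have "\<dots> = card {S::var set. card S = i} * pol.dim (derivs f k)" by simp
  also have "card {S::var set. card S = i} = 5 choose i"
    using n_subsets[of "UNIV::var set" i] by (simp add: card_UNIV_var)
  finally show ?thesis .
qed

lemma subspace_kcycles:
  assumes "\<And>w. Vector_Spaces.linear pscale pscale (A w)"
  shows "chn.subspace (kcycles A f i k)"
proof -
  interpret l: Vector_Spaces.linear chain_scale chain_scale "kos A" by (rule linear_kos[OF assms])
  show ?thesis using subspace_kchains[of f i k]
    unfolding chn.subspace_def kcycles_def by (auto simp: l.add l.scale l.zero)
qed

lemma fin_dim_kcycles: "chn.fin_dim (kcycles A f i k)"
  by (rule chn.fin_dim_subset[OF fin_dim_kchains]) (auto simp: kcycles_def)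

lemma dim_kcycles_image:
  assumes "\<And>w. Vector_Spaces.linear pscale pscale (A w)"
  shows "chn.dim (kchains f i k) = chn.dim (kcycles A f i k) + chn.dim (kos A ` kchains f i k)"
  using cc.rank_nullity[OF linear_kos[OF assms] subspace_kchains fin_dim_kchains]
  unfolding kcycles_def .

section \<open>Betti numbers in terms of cycles\<close>

definition apolc :: "nat \<Rightarrow> 'k::field pol \<Rightarrow> 'k chain \<Rightarrow> 'k chain" where
  "apolc k f c = (\<lambda>S. apol k f (c S))"

lemma linear_apolc: "Vector_Spaces.linear chain_scale chain_scale (apolc k f)"
  by (rule cc_linearI) (auto simp: apolc_def fun_eq_iff apol_add apol_pscale)

lemma chains_eq: "chains i (i + k) = fam (\<lambda>S. if card S = i then Rdeg k else {0 :: 'k::field pol})"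
  by (auto simp: chains_def fam_def Rdeg_def zero_fun_def)

lemma chains_eq_0: "j < i \<Longrightarrow> chains i j = {0 :: 'k::field chain}"
  by (auto simp: chains_def fun_eq_iff)

lemma subspace_chains: "chn.subspace (chains i (i + k) :: 'k::field chain set)"
  unfolding chains_eq by (rule subspace_fam) (simp add: subspace_Rdeg)

lemma fin_dim_chains: "chn.fin_dim (chains i (i + k) :: 'k::field chain set)"
  unfolding chains_eq by (rule fin_dim_fam) (simp add: fin_dim_Rdeg fin_dim_0)

lemma apolc_chains: "apolc k f ` chains i (i + k) = kchains f i k"
proof
  show "apolc k f ` chains i (i + k) \<subseteq> kchains f i k"
    by (auto simp: chains_eq kchains_def fam_def apolc_def derivs_eq apol_0 split: if_splits)
  show "kchains f i k \<subseteq> apolc k f ` chains i (i + k)"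
  proof
    fix c assume c: "c \<in> kchains f i k"
    have "\<exists>r. r \<in> (if card S = i then Rdeg k else {0}) \<and> c S = apol k f r" for S
    proof (cases "card S = i")
      case True
      then have "c S \<in> derivs f k" using kchainsD(1)[OF c] by blast
      then show ?thesis using True by (auto simp: derivs_eq)
    qed (use kchainsD(2)[OF c, of S] apol_0[of k f] in auto)
    then obtain r where "\<And>S. r S \<in> (if card S = i then Rdeg k else {0}) \<and> c S = apol k f (r S)"
      by metis
    then show "c \<in> apolc k f ` chains i (i + k)"
      by (intro image_eqI[of _ _ r]) (auto simp: chains_eq fam_def apolc_def)
  qed
qed

lemma ann_chains_eq:
  "ann_chains F i (i + k) = {c \<in> chains i (i + k). apolc k (hat F) c = 0}"
proof -
  have "c S \<in> Ann_deg F k \<or> c S = (\<lambda>m. 0) \<longleftrightarrow> apol k (hat F) (c S) = 0"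
    if "c \<in> chains i (i + k)" for c :: "'a chain" and S
  proof -
    have "c S \<in> (if card S = i then Rdeg k else {0})"
      using that unfolding chains_eq fam_def by blast
    then have "c S \<in> Rdeg k" using subspace_Rdeg[of k, THEN pol.subspace_0] by (cases "card S = i") auto
    moreover have "apol k (hat F) (\<lambda>m. 0) = 0" using apol_0[of k "hat F"] by (simp add: zero_fun_def)
    ultimately show ?thesis by (auto simp: Ann_deg_eq)
  qed
  moreover have "apolc k (hat F) c = 0 \<longleftrightarrow> (\<forall>S. apol k (hat F) (c S) = 0)" for c
    unfolding apolc_def zero_fun_def[where 'a="var set"] fun_eq_iff[where 'a="var set"] by simp
  ultimately show ?thesis unfolding ann_chains_def by auto
qed

lemma homog_mulvar:
  assumes "homog k r"
  shows "homog (Suc k) (mulvar w r)"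
  unfolding homog_def
proof (intro allI impI)
  fix m assume m: "mulvar w r m \<noteq> 0"
  then have w: "0 < m w" by (auto simp: mulvar_def split: if_splits)
  then have "m = m(w := m w - 1) + monom_var w" by (auto simp: fun_eq_iff monom_var_def)
  then have "mdeg m = mdeg (m(w := m w - 1)) + 1" by (metis mdeg_add mdeg_monom_var)
  then show "mdeg m = Suc k" using m w assms by (auto simp: mulvar_def homog_def)
qed

lemma card_insert_compl: "w \<in> UNIV - T \<Longrightarrow> card (insert w T) = Suc (card (T :: var set))"
  by simp

lemma kos_mulvar_chains:
  assumes "c \<in> chains (Suc i) (Suc i + k)"
  shows "kos mulvar c \<in> chains i (i + Suc k)"
    and "apolc (Suc k) f (kos mulvar c) = kos dv (apolc k f c)"
proof -
  have m0: "mulvar w 0 = 0" for w :: var by (simp add: mulvar_def fun_eq_iff)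
  have c: "homog k (c S)" "card S \<noteq> Suc i \<Longrightarrow> c S = 0" for S
  proof -
    have *: "c S \<in> (if card S = Suc i then Rdeg k else {0})"
      using assms unfolding chains_eq fam_def by blast
    then show "card S \<noteq> Suc i \<Longrightarrow> c S = 0" by simp
    show "homog k (c S)" using * by (cases "card S = Suc i") (simp_all add: Rdeg_def)
  qed
  have "kos mulvar c T \<in> Rdeg (Suc k)" for T
    unfolding kos_def using c(1)
    by (intro pol.subspace_sum[OF subspace_Rdeg] pol.subspace_scale[OF subspace_Rdeg])
       (simp add: Rdeg_def homog_mulvar)
  moreover have "kos mulvar c T = 0" if "card T \<noteq> i" for T
    unfolding kos_def using that
    by (intro sum.neutral ballI) (simp add: c(2) card_insert_compl m0 del: insert_iff)
  ultimately show "kos mulvar c \<in> chains i (i + Suc k)"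
    unfolding chains_eq by (auto simp: fam_def)
  show "apolc (Suc k) f (kos mulvar c) = kos dv (apolc k f c)"
    by (rule ext) (simp add: apolc_def kos_def apol_sum apol_pscale apol_mulvar c(1))
qed

lemma betti_eq_0: "j < i \<Longrightarrow> betti F i j = 0"
proof -
  assume "j < i"
  then have "{c \<in> chains i j. i = 0 \<or> koszul_d c \<in> ann_chains F (i - 1) j} \<subseteq> {0}"
    using chains_eq_0 by blast
  moreover have "chn.fin_dim {0 :: 'a chain}"
    unfolding chn.fin_dim_def by (intro exI[of _ "{}"]) simp
  ultimately have "chn.dim {c \<in> chains i j. i = 0 \<or> koszul_d c \<in> ann_chains F (i - 1) j} = 0"
    using chn.dim_zero_iff chn.fin_dim_subset by blast
  then show ?thesis by (simp add: betti_def chain_dim_def Let_def)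
qed

lemma kcycles_0: "kcycles dv f 0 k = kchains f 0 k"
proof -
  have "kos dv c = 0" if "c \<in> kchains f 0 k" for c
  proof
    fix T
    have "c (insert w T) = 0" for w
      using that unfolding kchains_def fam_def by (metis (mono_tags, lifting) card_eq_0_iff finite insert_not_empty mem_Collect_eq singletonD)
    then show "kos dv c T = 0 T" unfolding kos_def by simp
  qed
  then show ?thesis unfolding kcycles_def by auto
qed

text \<open>On the numerator \<open>?Z\<close> and on the denominator \<open>?BN\<close> the map
  \<open>apolc\<close> has the same kernel \<open>?N\<close>, whose dimension therefore cancels. The
  images are the cycles with values in N_k and the boundaries of chains with values in N_{k-1}. For
  \<open>k = 0\<close> there are no boundaries, since chains of negative polynomial degree are
  zero.\<close>

theorem betti_eq:
  fixes F :: "'k::field_char_0 pol"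
  defines "f \<equiv> hat F"
  shows "betti F i (i + k) = chn.dim (kcycles dv f i k) -
    (if k = 0 then 0 else chn.dim (kchains f (Suc i) (k - 1)) - chn.dim (kcycles dv f (Suc i) (k - 1)))"
proof -
  let ?Z = "{c \<in> chains i (i + k). i = 0 \<or> koszul_d c \<in> ann_chains F (i - 1) (i + k)}"
  let ?N = "ann_chains F i (i + k)"
  let ?B = "koszul_d ` (chains (i + 1) (i + k) :: 'k chain set)"
  let ?BN = "{(\<lambda>S m. b S m + n S m) | b n. b \<in> ?B \<and> n \<in> ?N}"
  interpret P: Vector_Spaces.linear chain_scale chain_scale "apolc k f" by (rule linear_apolc)
  interpret K: Vector_Spaces.linear chain_scale chain_scale "kos dv" by (rule linear_kos) (rule linear_dv)
  have N: "?N = {c \<in> chains i (i + k). apolc k f c = 0}" by (simp add: ann_chains_eq f_def)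
  have subN: "chn.subspace ?N"
    using subspace_chains[of i k] unfolding N chn.subspace_def by (auto simp: P.add P.scale P.zero)
  \<comment> \<open>For \<open>i = 0\<close> the definition imposes no boundary condition. This
    agrees with the right-hand side because the differential vanishes on chains supported at the
    empty set.\<close>
  have Zeq: "?Z = {c \<in> chains i (i + k). kos dv (apolc k f c) = 0}"
  proof (cases i)
    case 0
    have "kos dv (apolc k f c) = 0" if "c \<in> chains i (i + k)" for c
      using that kcycles_0[of f k] apolc_chains[of k f i] 0 unfolding kcycles_def by blast
    then show ?thesis using 0 by auto
  next
    case (Suc i')
    have "koszul_d c \<in> ann_chains F i' (i + k) \<longleftrightarrow> kos dv (apolc k f c) = 0"
      if "c \<in> chains i (i + k)" for c
      using kos_mulvar_chains(1)[of c i' k] kos_mulvar_chains(2)[of c i' k f] that Suc ann_chains_eq[of F i' "Suc k"]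
      by (simp add: koszul_d_eq f_def)
    then show ?thesis using Suc by auto
  qed
  have subZ: "chn.subspace ?Z"
    using subspace_chains[of i k] unfolding Zeq chn.subspace_def
    by (auto simp: P.add P.scale P.zero K.add K.scale K.zero)
  have finZ: "chn.fin_dim ?Z" by (rule chn.fin_dim_subset[OF fin_dim_chains[of i k]]) auto
  have imZ: "apolc k f ` ?Z = kcycles dv f i k"
    unfolding Zeq kcycles_def apolc_chains[symmetric] by auto
  have kerZ: "{c \<in> ?Z. apolc k f c = 0} = ?N" unfolding Zeq N by (auto simp: K.zero)
  have dimZ: "chn.dim ?Z = chn.dim ?N + chn.dim (kcycles dv f i k)"
    using cc.rank_nullity[OF linear_apolc[of k f] subZ finZ] unfolding kerZ imZ .
  have BN: "?BN = {b + n | b n. b \<in> ?B \<and> n \<in> ?N}" by (auto simp: plus_fun_def)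
  have Bsub: "?B \<subseteq> chains i (i + k) \<and> chn.subspace ?B \<and>
    chn.dim (apolc k f ` ?B) = (if k = 0 then 0 else chn.dim (kchains f (Suc i) (k - 1)) - chn.dim (kcycles dv f (Suc i) (k - 1)))"
  proof (cases k)
    case 0
    interpret D: Vector_Spaces.linear chain_scale chain_scale "kos (mulvar :: var \<Rightarrow> 'k pol \<Rightarrow> 'k pol)"
      by (rule linear_kos, rule pp_linearI) (auto simp: mulvar_def fun_eq_iff)
    have B0: "?B = {0}" using 0 chains_eq_0[of i "i + 1", where 'k = 'k] by (simp add: koszul_d_eq D.zero)
    have "chn.fin_dim {0 :: 'k chain}" unfolding chn.fin_dim_def by (intro exI[of _ "{}"]) simp
    then have "chn.dim {0 :: 'k chain} = 0" using chn.dim_zero_iff by blast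
    moreover have "apolc k f ` {0} = {0}" by (simp add: P.zero)
    ultimately show ?thesis unfolding B0 using 0 chn.subspace_0[OF subspace_chains[of i k]] by simp
  next
    case (Suc k')
    have D: "Vector_Spaces.linear chain_scale chain_scale (kos (mulvar :: var \<Rightarrow> 'k pol \<Rightarrow> 'k pol))"
      by (rule linear_kos, rule pp_linearI) (auto simp: mulvar_def fun_eq_iff)
    have e: "chains (i + 1) (i + k) = (chains (Suc i) (Suc i + k') :: 'k chain set)"
    proof -
      have "i + 1 = Suc i" "i + k = Suc i + k'" using Suc by auto
      then show ?thesis by (simp only:)
    qed
    have "apolc k f ` ?B = kos dv ` (apolc k' f ` chains (Suc i) (Suc i + k'))"
      unfolding koszul_d_eq image_image e unfolding Suc by (intro image_cong refl kos_mulvar_chains(2))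
    also have "\<dots> = kos dv ` kchains f (Suc i) k'" unfolding apolc_chains ..
    finally have "apolc k f ` ?B = kos dv ` kchains f (Suc i) k'" .
    then have "chn.dim (apolc k f ` ?B) = chn.dim (kchains f (Suc i) k') - chn.dim (kcycles dv f (Suc i) k')"
      using dim_kcycles_image[of dv, OF linear_dv, of f "Suc i" k'] by simp
    moreover have "?B \<subseteq> chains i (i + k)"
      unfolding koszul_d_eq e unfolding Suc using kos_mulvar_chains(1) by blast
    moreover have "chn.subspace ?B"
      unfolding koszul_d_eq e using cc.linear_subspace_image[OF D subspace_chains] .
    ultimately show ?thesis using Suc by simp
  qed
  have subBN: "chn.subspace ?BN"
    unfolding BN by (rule chn.subspace_sums) (use Bsub subN in auto)
  have BNs: "?BN \<subseteq> chains i (i + k)"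
    unfolding BN using Bsub N chn.subspace_add[OF subspace_chains[of i k]] by blast
  have finBN: "chn.fin_dim ?BN" by (rule chn.fin_dim_subset[OF fin_dim_chains BNs])
  have kerBN: "{c \<in> ?BN. apolc k f c = 0} = ?N"
  proof
    show "{c \<in> ?BN. apolc k f c = 0} \<subseteq> ?N" using BNs N by blast
    show "?N \<subseteq> {c \<in> ?BN. apolc k f c = 0}"
    proof
      fix n assume n: "n \<in> ?N"
      have "0 \<in> ?B" using Bsub chn.subspace_0 by blast
      then have "0 + n \<in> ?BN" unfolding BN using n by blast
      then show "n \<in> {c \<in> ?BN. apolc k f c = 0}" using n N by simp
    qed
  qed
  have imBN: "apolc k f ` ?BN = apolc k f ` ?B"
  proof
    show "apolc k f ` ?BN \<subseteq> apolc k f ` ?B" unfolding BN unfolding N by (auto simp: P.add)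
    show "apolc k f ` ?B \<subseteq> apolc k f ` ?BN"
    proof
      fix y assume "y \<in> apolc k f ` ?B"
      then obtain b where b: "b \<in> ?B" "y = apolc k f b" by blast
      have "b + 0 \<in> ?BN" unfolding BN using b chn.subspace_0[OF subN] by blast
      then show "y \<in> apolc k f ` ?BN" by (rule rev_image_eqI) (simp add: b(2))
    qed
  qed
  have "chn.dim ?BN = chn.dim ?N + chn.dim (apolc k f ` ?B)"
    using cc.rank_nullity[OF linear_apolc[of k f] subBN finBN] unfolding kerBN imBN .
  then show ?thesis using dimZ Bsub by (simp add: betti_def chain_dim_def Let_def)
qed

section \<open>The derivatives of a minimal Perazzo form\<close>

lemma (in fd_space) list_dependent:
  assumes "fin_dim T" "set xs \<subseteq> T" "V.dim T < length xs"
  shows "\<exists>c. (\<exists>i<length xs. c i \<noteq> 0) \<and> (\<Sum>i<length xs. scale (c i) (xs ! i)) = 0"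
  using family_dependent[of T "{..<length xs}" "\<lambda>i. xs ! i"] assms by (auto simp: subset_iff)

text \<open>The cross product of the two coefficient vectors is a solution. If it vanishes, the
  vectors are proportional, and anything orthogonal to a nonzero one of them is orthogonal to
  both.\<close>

lemma cross_nontrivial:
  fixes x1 :: "'k::field"
  shows "\<exists>a b c. (a \<noteq> 0 \<or> b \<noteq> 0 \<or> c \<noteq> 0) \<and> a * x1 + b * x2 + c * x3 = 0 \<and> a * y1 + b * y2 + c * y3 = 0"
proof (cases "x2 * y3 - x3 * y2 = 0 \<and> x3 * y1 - x1 * y3 = 0 \<and> x1 * y2 - x2 * y1 = 0")
  case False
  then show ?thesis
    by (intro exI[of _ "x2 * y3 - x3 * y2"] exI[of _ "x3 * y1 - x1 * y3"] exI[of _ "x1 * y2 - x2 * y1"])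
       (auto simp: algebra_simps)
next
  case True
  have main: "\<exists>a b c. (a \<noteq> 0 \<or> b \<noteq> 0 \<or> c \<noteq> 0) \<and> a * x1 + b * x2 + c * x3 = 0 \<and> a * y1 + b * y2 + c * y3 = 0"
    if "x1 \<noteq> 0 \<or> x2 \<noteq> 0 \<or> x3 \<noteq> 0" "x2 * y3 = x3 * y2" "x3 * y1 = x1 * y3" "x1 * y2 = x2 * y1"
    for x1 x2 x3 y1 y2 y3 :: 'k
  proof (cases "x1 \<noteq> 0 \<or> x2 \<noteq> 0")
    case True
    then show ?thesis using that
      by (intro exI[of _ "x2"] exI[of _ "- x1"] exI[of _ 0]) auto
  next
    case False
    then show ?thesis using that
      by (intro exI[of _ "x3"] exI[of _ 0] exI[of _ "- x1"]) auto
  qed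
  show ?thesis
  proof (cases "x1 \<noteq> 0 \<or> x2 \<noteq> 0 \<or> x3 \<noteq> 0")
    case nz: True
    then show ?thesis using True by (intro main) auto
  next
    case z: False
    show ?thesis
    proof (cases "y1 \<noteq> 0 \<or> y2 \<noteq> 0 \<or> y3 \<noteq> 0")
      case True
      then show ?thesis using main[of y1 y2 y3 x1 x2 x3] z by auto
    next
      case False
      then show ?thesis using z by (intro exI[of _ 1]) auto
    qed
  qed
qed

text \<open>The action of the linear form c_X x + c_Y y + c_Z z; the values of \<open>c\<close> at
  \<open>U\<close> and \<open>V\<close> do not enter, and no bracket is meant. Thus W is the set of
  all \<open>lie c f\<close>.\<close>

definition lie :: "(var \<Rightarrow> 'k) \<Rightarrow> 'k::field pol \<Rightarrow> 'k pol" where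
  "lie c g = pscale (c X) (dv X g) + pscale (c Y) (dv Y g) + pscale (c Z) (dv Z g)"

definition vt :: "'k \<Rightarrow> 'k::field pol \<Rightarrow> 'k pol" where
  "vt t g = dv V g + pscale t (dv U g)"

definition quad :: "'k \<Rightarrow> 'k \<Rightarrow> 'k \<Rightarrow> 'k \<Rightarrow> 'k::field pol \<Rightarrow> 'k pol" where
  "quad t \<alpha> \<beta> \<gamma> g = pscale \<alpha> (dv U (dv U g)) + pscale \<beta> (dv U (vt t g)) + pscale \<gamma> (vt t (vt t g))"

lemma linear_vt: "Vector_Spaces.linear pscale pscale (vt t)"
  by (rule pp_linearI) (auto simp: vt_def fun_eq_iff algebra_simps)

lemmas vt_add = pp.linear_add[OF linear_vt]
lemmas vt_diff = pp.linear_diff[OF linear_vt]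
lemmas vt_0 = pp.linear_0[OF linear_vt]
lemmas vt_scale = pp.linear_scale[OF linear_vt]
lemmas vt_sum = pp.linear_sum[OF linear_vt]
lemmas vt_simps = vt_add vt_diff vt_0 vt_scale

lemma vt_dv: "vt t (dv w g) = dv w (vt t g)"
  by (simp add: vt_def dv_comm[of w])

lemma vt_shift: "vt t (shift m g) = shift m (vt t g)"
  by (simp add: vt_def dv_shift)

lemma vt_vt: "vt s (vt t g) = vt t (vt s g)"
  by (simp add: vt_def dv_comm fun_eq_iff algebra_simps)

lemma linear_vtp: "Vector_Spaces.linear pscale pscale (vt t ^^ j)"
proof (induction j)
  case 0
  show "Vector_Spaces.linear pscale pscale (vt t ^^ 0 :: 'a pol \<Rightarrow> _)" by (rule pp_linearI) simp_all
next
  case (Suc j)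
  then show "Vector_Spaces.linear pscale pscale (vt t ^^ Suc j)"
    using Vector_Spaces.linear_compose[OF Suc linear_vt[of t]] by (simp only: funpow.simps)
qed

lemmas vtp_simps = pp.linear_add[OF linear_vtp] pp.linear_diff[OF linear_vtp]
  pp.linear_0[OF linear_vtp] pp.linear_scale[OF linear_vtp]

lemma vtp_dv: "(vt t ^^ j) (dv w g) = dv w ((vt t ^^ j) g)"
  by (induction j) (simp_all add: vt_dv)

lemma linear_quad: "Vector_Spaces.linear pscale pscale (quad t \<alpha> \<beta> \<gamma>)"
  by (rule pp_linearI) (auto simp: quad_def vt_simps fun_eq_iff algebra_simps)

lemma quad_dv: "quad t \<alpha> \<beta> \<gamma> (dv w g) = dv w (quad t \<alpha> \<beta> \<gamma> g)"
  by (simp add: quad_def vt_dv vt_simps dv_comm[of w])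

lemma quad_vt: "quad t \<alpha> \<beta> \<gamma> (vt t g) = vt t (quad t \<alpha> \<beta> \<gamma> g)"
  by (simp add: quad_def vt_dv vt_simps)

lemma quad_vtp: "quad t \<alpha> \<beta> \<gamma> ((vt t ^^ j) g) = (vt t ^^ j) (quad t \<alpha> \<beta> \<gamma> g)"
  by (induction j) (simp_all add: quad_vt)

lemma linear_lie: "Vector_Spaces.linear pscale pscale (lie c)"
  by (rule pp_linearI) (auto simp: lie_def fun_eq_iff algebra_simps)

lemma lie_comm:
  assumes "Vector_Spaces.linear pscale pscale T" "\<And>w g. T (dv w g) = dv w (T g)"
  shows "T (lie c g) = lie c (T g)"
  using assms by (simp add: lie_def pp.linear_add[OF assms(1)] pp.linear_scale[OF assms(1)])

lemmas lie_vt = lie_comm[OF linear_vt vt_dv]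
lemmas lie_vtp = lie_comm[OF linear_vtp vtp_dv]
lemmas lie_quad = lie_comm[OF linear_quad quad_dv]

lemma lie_dv: "dv w (lie c g) = lie c (dv w g)"
  by (rule lie_comm[OF linear_dv dv_comm])

lemma lie_shift: "shift m (lie c g) = lie c (shift m g)"
  by (rule lie_comm[OF linear_shift]) (simp add: dv_shift)

lemma homog_diff: "homog k f \<Longrightarrow> homog k g \<Longrightarrow> homog k (f - g :: 'k::field pol)"
  unfolding homog_def by (metis (no_types, opaque_lifting) diff_zero eq_iff_diff_eq_0 fun_diff_def)

lemma homog_vt: "homog e g \<Longrightarrow> homog (e - 1) (vt t g)"
  unfolding vt_def by (intro homog_add homog_pscale homog_dv)

lemma homog_vtp: "homog e g \<Longrightarrow> homog (e - j) ((vt t ^^ j) g)"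
proof (induction j)
  case (Suc j)
  then have "homog (e - j - 1) (vt t ((vt t ^^ j) g))" by (intro homog_vt)
  then show ?case by simp
qed simp

lemma homog_lie: "homog e g \<Longrightarrow> homog (e - 1) (lie c g)"
  unfolding lie_def by (intro homog_add homog_pscale homog_dv)

lemma homog_quad:
  assumes "homog e g"
  shows "homog (e - 2) (quad t \<alpha> \<beta> \<gamma> g)"
proof -
  have "homog (e - 1 - 1) (quad t \<alpha> \<beta> \<gamma> g)"
    unfolding quad_def using assms by (intro homog_add homog_pscale homog_dv homog_vt)
  then show ?thesis by (simp add: numeral_2_eq_2)
qed

section \<open>Binary forms in U and V\<close>

definition bin :: "'k::field pol \<Rightarrow> bool" where
  "bin g \<longleftrightarrow> dv X g = 0 \<and> dv Y g = 0 \<and> dv Z g = 0"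

lemma bin_dv: "bin g \<Longrightarrow> bin (dv w g)"
  by (simp add: bin_def dv_comm[of _ w])

lemma bin_vt: "bin g \<Longrightarrow> bin (vt t g)"
  by (simp add: bin_def vt_dv[symmetric] vt_0)

lemma bin_vtp: "bin g \<Longrightarrow> bin ((vt t ^^ j) g)"
  by (induction j) (simp_all add: bin_vt)

lemma bin_quad: "bin g \<Longrightarrow> bin (quad t \<alpha> \<beta> \<gamma> g)"
  by (simp add: bin_def quad_dv[symmetric] pp.linear_0[OF linear_quad])

lemma bin_eq_0I:
  assumes "homog e g" "0 < e" "bin g" "dv U g = 0" "vt t g = 0"
  shows "g = 0"
proof (rule homog_eq_0I[OF assms(1,2)])
  have "dv V g = vt t g - pscale t (dv U g)" by (simp add: vt_def)
  also have "\<dots> = 0" using assms(4,5) by simp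
  finally have V: "dv V g = 0" .
  fix w show "dv w g = 0"
    using V assms(3,4) unfolding bin_def by (cases w) simp_all
qed

text \<open>In the kernel of v' the derivative by u is the only one left, so vanishing descends from
  u^3 g to u^2 g, u g and g. The first of these must have positive degree, hence
  \<open>3 \<le> e\<close>.\<close>

lemma bin_UUU_eq_0:
  assumes "homog e g" "3 \<le> e" "bin g" "vt t g = 0" "dv U (dv U (dv U g)) = 0"
  shows "g = 0"
proof -
  have h: "homog (e - 1) (dv U g)" "homog (e - 1 - 1) (dv U (dv U g))"
    using assms(1) by (blast intro: homog_dv)+
  have z: "vt t (dv U g) = 0" "vt t (dv U (dv U g)) = 0"
    unfolding vt_dv assms(4) by simp_all
  have b: "bin (dv U g)" "bin (dv U (dv U g))" using assms(3) by (blast intro: bin_dv)+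
  have "dv U (dv U g) = 0" using bin_eq_0I[OF h(2) _ b(2) assms(5) z(2)] assms(2) by linarith
  then have "dv U g = 0" using bin_eq_0I[OF h(1) _ b(1) _ z(1)] assms(2) by linarith
  then show ?thesis using bin_eq_0I[OF assms(1) _ assms(3) _ assms(4)] assms(2) by linarith
qed

text \<open>The kernels of four different operators \<open>v + s u\<close> on binary forms of degree at least three are
  independent lines: multiply a relation by three of the operators to isolate one term.\<close>

lemma vt_kernels_independent:
  fixes p p1 p2 p3 :: "'k::field pol"
  assumes rel: "pscale e p + pscale e1 p1 + pscale e2 p2 + pscale e3 p3 = 0"
    and z: "vt t p = 0" "vt t1 p1 = 0" "vt t2 p2 = 0" "vt t3 p3 = 0"
    and ne: "t \<noteq> t1" "t \<noteq> t2" "t \<noteq> t3"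
    and p: "homog k p" "3 \<le> k" "bin p" "p \<noteq> 0"
  shows "e = 0"
proof -
  \<comment> \<open>On the kernel of v + t u each other operator v + s u acts as the multiple s - t
    of u.\<close>
  have shift: "vt s g = pscale (s - t) (dv U g)" if "vt t g = 0" for s g
  proof -
    have "vt s g = vt t g + pscale (s - t) (dv U g)"
      by (simp add: vt_def fun_eq_iff algebra_simps)
    then show ?thesis using that by simp
  qed
  have zU: "vt t (dv U g) = 0" if "vt t g = 0" for g using that by (simp add: vt_dv)
  let ?T = "\<lambda>g. vt t1 (vt t2 (vt t3 g))"
  have "?T p1 = 0" "?T p2 = 0" "?T p3 = 0"
    using z vt_vt[of t1 t2] vt_vt[of t1 t3] vt_vt[of t2 t3] by (simp_all add: vt_0)
  moreover have "?T (pscale e p + pscale e1 p1 + pscale e2 p2 + pscale e3 p3) = 0"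
    unfolding rel by (simp add: vt_0)
  ultimately have A: "pscale e (?T p) = 0"
    by (simp only: vt_add vt_scale pol.scale_zero_right add_0_right)
  have B: "?T p = pscale ((t1 - t) * (t2 - t) * (t3 - t)) (dv U (dv U (dv U p)))"
    using shift[OF z(1)] shift[OF zU[OF z(1)]] shift[OF zU[OF zU[OF z(1)]]]
    by (simp add: vt_scale mult_ac)
  have "dv U (dv U (dv U p)) \<noteq> 0" using bin_UUU_eq_0[OF p(1-3) z(1)] p(4) by blast
  then have "e * ((t1 - t) * (t2 - t) * (t3 - t)) = 0"
    using A unfolding B pol.scale_scale pol.scale_eq_0_iff by blast
  then show ?thesis using ne by auto
qed

section \<open>Consequences of the minimal Hilbert function\<close>

locale min_perazzo =
  fixes f :: "'k::field_char_0 pol" and d :: nat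
  assumes homog_f: "homog d f"
    and d_ge: "5 \<le> d"
    and dims: "pol.dim (derivs f k) = minimal_hilb d k"
    and flat: "a \<in> {X, Y, Z} \<Longrightarrow> bin (dv a f)"
begin

lemma lie_lie: "bin (lie c f)"
proof -
  have "dv b (dv a f) = 0" if "a \<in> {X, Y, Z}" "b \<in> {X, Y, Z}" for a b
    using flat[OF that(1)] that(2) unfolding bin_def by blast
  then show ?thesis unfolding bin_def lie_def by simp
qed

lemma mons_1: "mons 1 = range monom_var"
proof
  show "mons 1 \<subseteq> range monom_var"
  proof
    fix m assume "m \<in> mons 1"
    then have m: "mdeg m = 1" by (simp add: mons_def)
    then have "m \<noteq> 0" using mdeg_0_iff[of m] by simp
    then obtain w where "0 < m w" by (auto simp: fun_eq_iff)
    then obtain m' where m': "m = m' + monom_var w" using monom_minus_var by blast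
    then have "mdeg m' = 0" using m by (simp add: mdeg_add)
    then have "m' = 0" using mdeg_0_iff by blast
    then show "m \<in> range monom_var" using m' by simp
  qed
  show "range monom_var \<subseteq> mons 1" by (auto simp: mons_def)
qed

lemma derivs_1: "derivs f 1 = pol.span (range (\<lambda>w. dv w f))"
  unfolding derivs_def mons_1 image_image dv_def ..

lemma derivs_0: "derivs f 0 = pol.span {f}"
proof -
  have "mons 0 = {0}" by (auto simp: mons_def mdeg_0_iff)
  then show ?thesis by (simp add: derivs_def)
qed

text \<open>A nontrivial relation would let four of the five first derivatives span N_1, whose
  dimension is 5.\<close>

lemma dv_f_independent:
  assumes "(\<Sum>w\<in>UNIV. pscale (c w) (dv w f)) = 0"
  shows "c w = 0"
proof (rule ccontr)
  assume w: "c w \<noteq> 0"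
  let ?B = "(\<lambda>w. dv w f) ` (UNIV - {w})"
  have "pscale (c w) (dv w f) + (\<Sum>x\<in>UNIV - {w}. pscale (c x) (dv x f)) = 0"
    using assms by (simp add: sum.remove[of UNIV w])
  then have "pscale (c w) (dv w f) = - (\<Sum>x\<in>UNIV - {w}. pscale (c x) (dv x f))"
    by (rule eq_neg_iff_add_eq_0[THEN iffD2])
  also have "\<dots> \<in> pol.span ?B"
    by (intro pol.span_neg pol.span_sum pol.span_scale pol.span_base imageI)
  finally have "pscale (1 / c w) (pscale (c w) (dv w f)) \<in> pol.span ?B" by (rule pol.span_scale)
  then have "dv w f \<in> pol.span ?B" using w by (simp only: pol.scale_scale) simp
  then have "range (\<lambda>w. dv w f) \<subseteq> pol.span ?B"
    using pol.span_superset[of ?B] by blast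
  then have "derivs f 1 \<subseteq> pol.span ?B" unfolding derivs_1 using pol.span_minimal pol.subspace_span by blast
  then have "pol.dim (derivs f 1) \<le> card ?B" by (rule pol.dim_le_card) simp
  also have "card ?B \<le> card (UNIV - {w})" by (rule card_image_le) simp
  also have "\<dots> = 4" by (simp add: card_Diff_singleton card_UNIV_var)
  finally show False using dims[of 1] by (simp add: minimal_hilb_def)
qed

lemma dv_f_independent':
  assumes "lie c f + pscale a (dv U f) + pscale b (dv V f) = 0"
  shows "c X = 0" "c Y = 0" "c Z = 0" "a = 0" "b = 0"
proof -
  define e where "e = c(U := a, V := b)"
  have "(\<Sum>w\<in>UNIV. pscale (e w) (dv w f)) = lie c f + pscale a (dv U f) + pscale b (dv V f)"
    by (simp add: UNIV_var lie_def e_def add_ac)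
  then have "e w = 0" for w using dv_f_independent[of e] assms by simp
  from this[of X] this[of Y] this[of Z] this[of U] this[of V]
  show "c X = 0" "c Y = 0" "c Z = 0" "a = 0" "b = 0" by (simp_all add: e_def)
qed

lemma lie_eq_0:
  assumes "lie c f = 0"
  shows "c X = 0" "c Y = 0" "c Z = 0"
  using dv_f_independent'[of c 0 0] assms by simp_all

lemma homog_lie_f: "homog (d - 1) (lie c f)"
  by (rule homog_lie[OF homog_f])

text \<open>If all four values failed, each would give a nonzero element of W in the kernel of its
  operator. These four elements are independent, although W is spanned by three vectors. The
  elements of W have degree d - 1, which is at least 3, as independence requires.\<close>

lemma ex_vt_inj:
  "\<exists>t\<in>{0, 1, 2, 3}. \<forall>c. vt t (lie c f) = 0 \<longrightarrow> lie c f = 0"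
proof (rule ccontr)
  assume "\<not> ?thesis"
  then have "\<forall>t\<in>{0, 1, 2, 3}. \<exists>p. p \<in> range (\<lambda>c. lie c f) \<and> vt t p = 0 \<and> p \<noteq> 0" by blast
  then obtain P where P: "\<And>t. t \<in> {0, 1, 2, 3} \<Longrightarrow> P t \<in> range (\<lambda>c. lie c f) \<and> vt t (P t) = 0 \<and> P t \<noteq> 0"
    by metis
  let ?W = "pol.span {dv X f, dv Y f, dv Z f}"
  have W: "lie c f \<in> ?W" for c
    unfolding lie_def by (intro pol.span_add pol.span_scale pol.span_base) auto
  have PW: "P t \<in> ?W" if "t \<in> {0, 1, 2, 3}" for t using P[OF that] W by auto
  have "pol.fin_dim ?W" unfolding pol.fin_dim_def by (intro exI[of _ "{dv X f, dv Y f, dv Z f}"]) simp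
  moreover have "set [P 0, P 1, P 2, P 3] \<subseteq> ?W" using PW by simp
  moreover have "pol.dim ?W \<le> card {dv X f, dv Y f, dv Z f}" by (rule pol.dim_le_card) auto
  then have "pol.dim ?W < length [P 0, P 1, P 2, P 3]"
    using card_insert_le_m1[of 3 "{dv Y f, dv Z f}" "dv X f"] card_insert_le_m1[of 2 "{dv Z f}" "dv Y f"] by simp
  ultimately obtain c where c: "\<exists>i<length [P 0, P 1, P 2, P 3]. c i \<noteq> 0"
    "(\<Sum>i<length [P 0, P 1, P 2, P 3]. pscale (c i) ([P 0, P 1, P 2, P 3] ! i)) = 0"
    using pol.list_dependent by blast
  have rel: "pscale (c 0) (P 0) + pscale (c 1) (P 1) + pscale (c 2) (P 2) + pscale (c 3) (P 3) = 0"
    using c(2) by (simp add: numeral_eq_Suc)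
  have hb: "homog (d - 1) (P t) \<and> bin (P t)" if "t \<in> {0, 1, 2, 3}" for t
    using P[OF that] lie_lie homog_lie_f by auto
  have d: "3 \<le> d - 1" using d_ge by simp
  have "c 0 = 0"
    by (rule vt_kernels_independent[of "c 0" "P 0" "c 1" "P 1" "c 2" "P 2" "c 3" "P 3" 0 1 2 3 "d - 1"])
       (use rel P hb d in auto)
  moreover have "c 1 = 0"
    by (rule vt_kernels_independent[of "c 1" "P 1" "c 0" "P 0" "c 2" "P 2" "c 3" "P 3" 1 0 2 3 "d - 1"])
       (use rel P hb d in \<open>auto simp: add_ac\<close>)
  moreover have "c 2 = 0"
    by (rule vt_kernels_independent[of "c 2" "P 2" "c 0" "P 0" "c 1" "P 1" "c 3" "P 3" 2 0 1 3 "d - 1"])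
       (use rel P hb d in \<open>auto simp: add_ac\<close>)
  moreover have "c 3 = 0"
    by (rule vt_kernels_independent[of "c 3" "P 3" "c 0" "P 0" "c 1" "P 1" "c 2" "P 2" 3 0 1 2 "d - 1"])
       (use rel P hb d in \<open>auto simp: add_ac\<close>)
  ultimately show False using c(1) by (auto simp: less_Suc_eq numeral_eq_Suc)
qed

end

definition bmon :: "nat \<Rightarrow> nat \<Rightarrow> monom" where
  "bmon i j = (\<lambda>_. 0)(U := i, V := j)"

lemma bmon_dv: "dv U g (bmon i j) = g (bmon (Suc i) j)" "dv V g (bmon i j) = g (bmon i (Suc j))"
proof -
  have "bmon i j + monom_var U = bmon (Suc i) j" "bmon i j + monom_var V = bmon i (Suc j)"
    by (auto simp: bmon_def monom_var_def fun_eq_iff)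
  then show "dv U g (bmon i j) = g (bmon (Suc i) j)" "dv V g (bmon i j) = g (bmon i (Suc j))"
    by (simp_all add: dv_def shift_def)
qed

lemma bin_eq_0_coeffs:
  assumes "homog e g" "bin g" "\<And>i j. i + j = e \<Longrightarrow> g (bmon i j) = 0"
  shows "g = 0"
proof
  fix m
  have z: "g m = 0" if "dv w g = 0" "0 < m w" for w
  proof -
    obtain m' where "m = m' + monom_var w" using monom_minus_var \<open>0 < m w\<close> by blast
    then have "g m = dv w g m'" by (simp add: dv_def shift_def)
    then show ?thesis using that(1) by simp
  qed
  show "g m = 0 m"
  proof (cases "m X = 0 \<and> m Y = 0 \<and> m Z = 0")
    case True
    then have m: "m w = bmon (m U) (m V) w" for w by (cases w) (simp_all add: bmon_def)
    then have m: "m = bmon (m U) (m V)" by blast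
    have "mdeg m = m U + m V" using True by (simp add: mdeg_def UNIV_var)
    then show ?thesis using assms(1,3) m unfolding homog_def by (metis zero_fun_apply)
  next
    case False
    then show ?thesis using z assms(2) unfolding bin_def by auto
  qed
qed

lemma bin_iff_lie: "bin n \<longleftrightarrow> (\<forall>c. lie c n = 0)"
proof
  show "bin n \<Longrightarrow> \<forall>c. lie c n = 0" by (simp add: bin_def lie_def)
  assume a: "\<forall>c. lie c n = 0"
  have "lie ((\<lambda>_. 0)(X := 1)) n = dv X n" "lie ((\<lambda>_. 0)(Y := 1)) n = dv Y n"
    "lie ((\<lambda>_. 0)(Z := 1)) n = dv Z n" by (simp_all add: lie_def)
  then show "bin n" using a unfolding bin_def by metis
qed

lemma self_derivs: "f \<in> derivs f 0"
  unfolding derivs_def using shift_simps(6)[of f] 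
  by (intro pol.span_base image_eqI[of _ _ 0]) (simp_all add: mons_def mdeg_0_iff)

lemma vt_derivs: "n \<in> derivs f k \<Longrightarrow> vt t n \<in> derivs f (Suc k)"
  unfolding vt_def
  by (intro pol.subspace_add[OF subspace_derivs] pol.subspace_scale[OF subspace_derivs] dv_derivs)

lemma vtp_derivs: "n \<in> derivs f k \<Longrightarrow> (vt t ^^ j) n \<in> derivs f (k + j)"
  by (induction j) (simp_all add: vt_derivs)

lemma lie_derivs: "n \<in> derivs f k \<Longrightarrow> lie c n \<in> derivs f (Suc k)"
  unfolding lie_def
  by (intro pol.subspace_add[OF subspace_derivs] pol.subspace_scale[OF subspace_derivs] dv_derivs)

text \<open>Lets identities between operators that commute with shifts be checked on
  \<open>f\<close> alone and then used on all derivatives of \<open>f\<close>.\<close>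

lemma derivs_kill:
  assumes T: "Vector_Spaces.linear pscale pscale T" "\<And>m g. T (shift m g) = shift m (T g)"
    and "T f = 0" "n \<in> derivs f k"
  shows "T n = 0"
proof -
  have "pol.subspace {n. T n = 0}"
    unfolding pol.subspace_def
    by (simp add: pp.linear_add[OF T(1)] pp.linear_scale[OF T(1)] pp.linear_0[OF T(1)])
  moreover have "T (shift m f) = 0" for m using T(2) assms(3) by simp
  ultimately have "derivs f k \<subseteq> {n. T n = 0}"
    unfolding derivs_def by (intro pol.span_minimal) auto
  then show ?thesis using assms(4) by blast
qed

context min_perazzo
begin

lemma ex_lie_vanishing: "\<exists>c. lie c f \<noteq> 0 \<and> lie c f m1 = 0 \<and> lie c f m2 = 0"
proof -
  obtain a b c where abc: "a \<noteq> 0 \<or> b \<noteq> 0 \<or> c \<noteq> 0"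
    "a * dv X f m1 + b * dv Y f m1 + c * dv Z f m1 = 0"
    "a * dv X f m2 + b * dv Y f m2 + c * dv Z f m2 = 0"
    using cross_nontrivial[of "dv X f m1" "dv Y f m1" "dv Z f m1" "dv X f m2" "dv Y f m2" "dv Z f m2"] by blast
  define e where "e = (\<lambda>_::var. 0::'k)(X := a, Y := b, Z := c)"
  have "lie e f \<noteq> 0" using lie_eq_0[of e] abc(1) by (auto simp: e_def)
  then show ?thesis using abc(2,3) by (intro exI[of _ e]) (simp add: lie_def e_def)
qed

text \<open>A nonzero binary quadric imposes a three-term recursion on coefficients, which leaves at
  most two free parameters. Since W has dimension three, it contains a nonzero form for which the
  two free coefficients vanish, and the recursion would make this form zero.\<close>

lemma quad_V_nonzero:
  assumes q: "\<And>c. pscale \<alpha> (dv U (dv U (lie c f))) + pscale \<beta> (dv U (dv V (lie c f))) + pscale \<gamma> (dv V (dv V (lie c f))) = 0"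
  shows "\<alpha> = 0 \<and> \<beta> = 0 \<and> \<gamma> = 0"
proof -
  let ?e = "d - 1"
  have rec: "\<alpha> * lie c f (bmon (i + 2) j) + \<beta> * lie c f (bmon (i + 1) (j + 1)) + \<gamma> * lie c f (bmon i (j + 2)) = 0" for c i j
    using fun_cong[OF q[of c], of "bmon i j"] by (simp add: bmon_dv)
  have contra: False if "lie c f \<noteq> 0" "\<And>i j. i + j = ?e \<Longrightarrow> lie c f (bmon i j) = 0" for c
    using bin_eq_0_coeffs[OF homog_lie_f lie_lie that(2)] that(1) by blast
  \<comment> \<open>If \<open>\<gamma>\<close> is nonzero, the recursion runs upwards in the
    exponent of V, with starting values at exponents 0 and 1.\<close>
  have g: "\<gamma> = 0"
  proof (rule ccontr)
    assume "\<gamma> \<noteq> 0"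
    obtain c where c: "lie c f \<noteq> 0" "lie c f (bmon ?e 0) = 0" "lie c f (bmon (?e - 1) 1) = 0"
      using ex_lie_vanishing by blast
    have "lie c f (bmon i j) = 0" if "i + j = ?e" for i j
      using that
    proof (induction j arbitrary: i rule: less_induct)
      case (less j)
      show ?case
      proof (cases "j \<le> 1")
        case True
        then have "j = 0 \<and> i = ?e \<or> j = 1 \<and> i = ?e - 1" using less.prems by auto
        then show "lie c f (bmon i j) = 0" using c(2,3) by blast
      next
        case False
        then have j: "j = (j - 2) + 2" by simp
        have "lie c f (bmon (i + 2) (j - 2)) = 0" "lie c f (bmon (i + 1) (j - 2 + 1)) = 0"
          using less.prems False by (auto intro!: less.IH)
        then have "\<gamma> * lie c f (bmon i (j - 2 + 2)) = 0" using rec[of c i "j - 2"] by simp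
        then show ?thesis using \<open>\<gamma> \<noteq> 0\<close> j by simp
      qed
    qed
    then show False using contra c by blast
  qed
  \<comment> \<open>Now the recursion, in which the term of \<open>\<gamma>\<close> is gone, runs
    upwards in the exponent of U.\<close>
  have a: "\<alpha> = 0"
  proof (rule ccontr)
    assume "\<alpha> \<noteq> 0"
    obtain c where c: "lie c f \<noteq> 0" "lie c f (bmon 0 ?e) = 0" "lie c f (bmon 1 (?e - 1)) = 0"
      using ex_lie_vanishing by blast
    have "lie c f (bmon i j) = 0" if "i + j = ?e" for i j
      using that
    proof (induction i arbitrary: j rule: less_induct)
      case (less i)
      show ?case
      proof (cases "i \<le> 1")
        case True
        then have "i = 0 \<and> j = ?e \<or> i = 1 \<and> j = ?e - 1" using less.prems by auto
        then show "lie c f (bmon i j) = 0" using c(2,3) by blast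
      next
        case False
        then have i: "i = (i - 2) + 2" by simp
        have "lie c f (bmon (i - 2 + 1) (j + 1)) = 0"
          using less.prems False by (auto intro!: less.IH)
        then have "\<alpha> * lie c f (bmon (i - 2 + 2) j) = 0" using rec[of c "i - 2" j] g by simp
        then show ?thesis using \<open>\<alpha> \<noteq> 0\<close> i by simp
      qed
    qed
    then show False using contra c by blast
  qed
  \<comment> \<open>If only the mixed derivative remained, all mixed coefficients would vanish, so
    the free coefficients are those of the two pure powers.\<close>
  have b: "\<beta> = 0"
  proof (rule ccontr)
    assume "\<beta> \<noteq> 0"
    obtain c where c: "lie c f \<noteq> 0" "lie c f (bmon 0 ?e) = 0" "lie c f (bmon ?e 0) = 0"
      using ex_lie_vanishing by blast
    have "lie c f (bmon i j) = 0" if "i + j = ?e" for i j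
    proof (cases "i = 0 \<or> j = 0")
      case True
      then show ?thesis using c that by auto
    next
      case False
      then have "i = i - 1 + 1" "j = j - 1 + 1" by auto
      then show ?thesis using rec[of c "i - 1" "j - 1"] a g \<open>\<beta> \<noteq> 0\<close> by simp
    qed
    then show False using contra c by blast
  qed
  show ?thesis using a b g by simp
qed

lemma quad_nonzero:
  assumes "\<And>c. quad t \<alpha> \<beta> \<gamma> (lie c f) = 0"
  shows "\<alpha> = 0 \<and> \<beta> = 0 \<and> \<gamma> = 0"
proof -
  have "quad t \<alpha> \<beta> \<gamma> g = pscale (\<alpha> + \<beta> * t + \<gamma> * t * t) (dv U (dv U g)) +
    pscale (\<beta> + 2 * \<gamma> * t) (dv U (dv V g)) + pscale \<gamma> (dv V (dv V g))" for g
    by (simp add: quad_def vt_def dv_comm[of V U] fun_eq_iff algebra_simps)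
  then have "\<alpha> + \<beta> * t + \<gamma> * t * t = 0 \<and> \<beta> + 2 * \<gamma> * t = 0 \<and> \<gamma> = 0"
    using assms by (intro quad_V_nonzero) simp
  then show ?thesis by auto
qed

lemma bin_lie: "n \<in> derivs f k \<Longrightarrow> bin (lie c n)"
proof -
  assume n: "n \<in> derivs f k"
  have "lie b (lie c n) = 0" for b
  proof (rule derivs_kill[OF _ _ _ n])
    show "Vector_Spaces.linear pscale pscale (\<lambda>n. lie b (lie c n))"
      by (rule pp_linearI) (simp_all add: pp.linear_add[OF linear_lie] pp.linear_scale[OF linear_lie])
    show "lie b (lie c f) = 0" using lie_lie bin_iff_lie by blast
  qed (simp add: lie_shift)
  then show ?thesis using bin_iff_lie by blast
qed

text \<open>The elements \<open>n\<close>, \<open>v^{j+1} a f\<close> for \<open>a = x, y, z\<close>, and \<open>q v^j f\<close> for the quadratic monomials \<open>q\<close> in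
  \<open>u, v\<close> are seven elements of a space of dimension six. Applying \<open>x, y, z\<close> to a relation between them
  removes the quadratic part.\<close>

lemma bin_derivs_eq:
  assumes k: "2 \<le> k" "k \<le> d - 2" and j: "j = k - 2"
    and n: "n \<in> derivs f k" "bin n"
    and G: "\<And>\<alpha> \<beta> \<gamma>. (\<And>c. quad t \<alpha> \<beta> \<gamma> ((vt t ^^ j) (lie c f)) = 0) \<Longrightarrow> \<alpha> = 0 \<and> \<beta> = 0 \<and> \<gamma> = 0"
    and I: "\<And>c. (vt t ^^ Suc j) (lie c f) = 0 \<Longrightarrow> lie c f = 0"
  shows "\<exists>c. n = (vt t ^^ Suc j) (lie c f)"
proof -
  let ?v = "vt t" and ?w = "(vt t ^^ j) f"
  let ?u = "(vt t ^^ Suc j)"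
  let ?xs = "[n, ?u (dv X f), ?u (dv Y f), ?u (dv Z f), dv U (dv U ?w), dv U (?v ?w), ?v (?v ?w)]"
  have w: "?w \<in> derivs f j" using vtp_derivs[OF self_derivs[of f], where t = t and j = j] by simp
  have kj: "Suc (Suc j) = k" "Suc 0 + Suc j = k" using k j by auto
  have "dv U (dv U ?w) \<in> derivs f k" "dv U (?v ?w) \<in> derivs f k" "?v (?v ?w) \<in> derivs f k"
    using dv_derivs[OF dv_derivs[OF w]] dv_derivs[OF vt_derivs[OF w]] vt_derivs[OF vt_derivs[OF w]]
    unfolding kj(1) by blast+
  moreover have "?u (dv a f) \<in> derivs f k" for a
    using vtp_derivs[OF dv_derivs[OF self_derivs[of f]], where t = t and j = "Suc j" and w1 = a] unfolding kj(2) .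
  ultimately have "set ?xs \<subseteq> derivs f k" using n(1) by simp
  moreover have "pol.dim (derivs f k) < length ?xs"
    using dims[of k] k d_ge by (simp add: minimal_hilb_def)
  ultimately obtain e where e: "\<exists>i<length ?xs. e i \<noteq> 0" "(\<Sum>i<length ?xs. pscale (e i) (?xs ! i)) = 0"
    using pol.list_dependent[OF fin_dim_derivs] by blast
  define c where "c = (\<lambda>_. 0)(X := e 1, Y := e 2, Z := e 3)"
  have ulin: "?u (lie c f) = pscale (e 1) (?u (dv X f)) + pscale (e 2) (?u (dv Y f)) + pscale (e 3) (?u (dv Z f))"
    unfolding lie_def by (simp only: vtp_simps) (simp add: c_def)
  have sum_eq: "(\<Sum>i<length ?xs. pscale (e i) (?xs ! i)) =
    pscale (e 0) n + ?u (lie c f) + quad t (e 4) (e 5) (e 6) ?w"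
    unfolding ulin quad_def by (simp add: numeral_eq_Suc del: funpow.simps)
  have rel: "pscale (e 0) n + ?u (lie c f) + quad t (e 4) (e 5) (e 6) ?w = 0"
    by (rule trans[OF sum_eq[symmetric] e(2)])
  have "quad t (e 4) (e 5) (e 6) ((vt t ^^ j) (lie b f)) = 0" for b
  proof -
    have "lie b (pscale (e 0) n + ?u (lie c f) + quad t (e 4) (e 5) (e 6) ?w) = 0"
      unfolding rel by (rule pp.linear_0[OF linear_lie])
    moreover have "lie b n = 0" using n(2) bin_iff_lie by blast
    moreover have "lie b (?u (lie c f)) = 0" using bin_vtp[OF lie_lie] bin_iff_lie by blast
    ultimately have "lie b (quad t (e 4) (e 5) (e 6) ?w) = 0"
      by (simp only: pp.linear_add[OF linear_lie] pp.linear_scale[OF linear_lie] pol.scale_zero_right add_0_left)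
    then show ?thesis by (simp only: lie_quad lie_vtp)
  qed
  then have z: "e 4 = 0" "e 5 = 0" "e 6 = 0" using G by blast+
  then have rel': "pscale (e 0) n + ?u (lie c f) = 0" using rel by (simp add: quad_def del: funpow.simps)
  \<comment> \<open>Without \<open>n\<close> the relation would lie in v^{j+1} W, and
    \<open>I\<close> would make its coefficients vanish.\<close>
  have "e 0 \<noteq> 0"
  proof
    assume "e 0 = 0"
    then have "?u (lie c f) = 0" using rel' by (simp del: funpow.simps)
    then have "lie c f = 0" by (rule I)
    then have "e 1 = 0" "e 2 = 0" "e 3 = 0" using lie_eq_0[of c] by (auto simp: c_def)
    then show False using e(1) z \<open>e 0 = 0\<close> by (auto simp: less_Suc_eq numeral_eq_Suc)
  qed
  have "pscale (e 0) n = pscale (-1) (?u (lie c f))"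
    using rel' by (simp only: eq_neg_iff_add_eq_0[symmetric] pol.scale_minus_left pol.scale_one)
  then have "pscale (1 / e 0) (pscale (e 0) n) = pscale (1 / e 0) (pscale (-1) (?u (lie c f)))" by (simp only:)
  then have "n = pscale (- 1 / e 0) (?u (lie c f))" using \<open>e 0 \<noteq> 0\<close> by (simp only: pol.scale_scale) simp
  also have "\<dots> = ?u (pscale (- 1 / e 0) (lie c f))" by (simp only: vtp_simps)
  also have "pscale (- 1 / e 0) (lie c f) = lie (\<lambda>a. - 1 / e 0 * c a) f"
    by (simp add: lie_def pol.scale_right_distrib)
  finally show ?thesis by blast
qed

end

lemma funpow_split:
  assumes "j \<le> n"
  shows "(h ^^ n) x = (h ^^ (n - j)) ((h ^^ j) x)"
proof -
  have "n = n - j + j" using assms by simp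
  then have "(h ^^ n) x = (h ^^ (n - j + j)) x" by simp
  then show ?thesis by (simp only: funpow_add o_apply)
qed

section \<open>Injectivity of multiplication by v'\<close>

locale gen_perazzo = min_perazzo f d for f :: "'k::field_char_0 pol" and d :: nat +
  fixes t :: 'k
  assumes vt_inj: "vt t (lie c f) = 0 \<Longrightarrow> lie c f = 0"
begin

lemma ex_U_dv: "\<exists>c. dv U (dv a f) = vt t (lie c f)" if a: "a \<in> {X, Y, Z}"
proof -
  have "\<exists>c. dv U (dv a f) = (vt t ^^ Suc 0) (lie c f)"
  proof (rule bin_derivs_eq)
    show "dv U (dv a f) \<in> derivs f 2"
      using dv_derivs[OF dv_derivs[OF self_derivs]] by (simp add: numeral_2_eq_2)
    show "bin (dv U (dv a f))" using flat[OF a] by (rule bin_dv)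
    show "(vt t ^^ Suc 0) (lie c f) = 0 \<Longrightarrow> lie c f = 0" for c using vt_inj by simp
    show "(\<And>c. quad t \<alpha> \<beta> \<gamma> ((vt t ^^ 0) (lie c f)) = 0) \<Longrightarrow> \<alpha> = 0 \<and> \<beta> = 0 \<and> \<gamma> = 0" for \<alpha> \<beta> \<gamma>
      using quad_nonzero[of t \<alpha> \<beta> \<gamma>] by simp
  qed (use d_ge in auto)
  then show ?thesis by simp
qed

text \<open>A row of the matrix of the fraction u / v' on W: u a f is v' times the combination of x
  f, y f, z f with these coefficients.\<close>

definition Cm :: "var \<Rightarrow> var \<Rightarrow> 'k" where
  "Cm a = (SOME c. dv U (dv a f) = vt t (lie c f))"

lemma U_dv: "a \<in> {X, Y, Z} \<Longrightarrow> dv U (dv a f) = vt t (lie (Cm a) f)"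
  unfolding Cm_def by (rule someI_ex[OF ex_U_dv])

text \<open>The same matrix acting on a coefficient vector, so that u times \<open>lie c f\<close>
  becomes v' times \<open>lie (Cc c) f\<close>.\<close>

definition Cc :: "(var \<Rightarrow> 'k) \<Rightarrow> var \<Rightarrow> 'k" where
  "Cc c = (\<lambda>b. c X * Cm X b + c Y * Cm Y b + c Z * Cm Z b)"

lemma lie_Cc: "lie (Cc c) g = pscale (c X) (lie (Cm X) g) + pscale (c Y) (lie (Cm Y) g) + pscale (c Z) (lie (Cm Z) g)"
  by (simp add: lie_def Cc_def fun_eq_iff algebra_simps)

lemma U_lie:
  assumes "n \<in> derivs f k"
  shows "dv U (lie c n) = vt t (lie (Cc c) n)"
proof -
  have "dv U (lie c n) - vt t (lie (Cc c) n) = 0"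
  proof (rule derivs_kill[OF _ _ _ assms])
    show "Vector_Spaces.linear pscale pscale (\<lambda>n. dv U (lie c n) - vt t (lie (Cc c) n))"
      by (rule pp_linearI)
         (simp_all add: pp.linear_add[OF linear_lie] pp.linear_scale[OF linear_lie] vt_simps pol.scale_right_diff_distrib)
    show "dv U (lie c f) - vt t (lie (Cc c) f) = 0"
      unfolding lie_Cc vt_simps by (simp add: lie_def U_dv)
    show "dv U (lie c (shift m g)) - vt t (lie (Cc c) (shift m g)) =
      shift m (dv U (lie c g) - vt t (lie (Cc c) g))" for m g
      by (simp add: lie_shift[symmetric] dv_shift[symmetric] vt_shift[symmetric])
  qed
  then show ?thesis by simp
qed

text \<open>The forms \<open>lie c n\<close> are binary and killed by v' for every \<open>c\<close>;
  since u times such a form is v' times another one, u kills them too. For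
  \<open>k \<le> d - 2\<close> their degree is positive, so they vanish.\<close>

lemma lie_eq_0_of_vt:
  assumes n: "n \<in> derivs f k" "k \<le> d - 2" and v: "\<And>c. vt t (lie c n) = 0"
  shows "bin n"
proof -
  have "lie c n = 0" for c
  proof (rule bin_eq_0I)
    show "homog (d - k - 1) (lie c n)" by (rule homog_lie[OF homog_derivs[OF homog_f n(1)]])
    show "0 < d - k - 1" using n(2) d_ge by simp
    show "bin (lie c n)" by (rule bin_lie[OF n(1)])
    show "dv U (lie c n) = 0" using U_lie[OF n(1)] v by simp
  qed (rule v)
  then show ?thesis using bin_iff_lie by blast
qed

text \<open>Since \<open>u W \<subseteq> v W\<close>, a quadric killing \<open>v^{d-3} W\<close> has all its derivatives of order \<open>d - 3\<close> on \<open>W\<close> zero, so it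
  kills \<open>W\<close>.\<close>

lemma quad_vtp_nonzero:
  assumes j: "j \<le> d - 3" and q: "\<And>c. quad t \<alpha> \<beta> \<gamma> ((vt t ^^ j) (lie c f)) = 0"
  shows "\<alpha> = 0 \<and> \<beta> = 0 \<and> \<gamma> = 0"
proof -
  \<comment> \<open>One factor v' is removed at each step. The induction hypothesis, used for
    \<open>c\<close> and for \<open>Cc c\<close>, shows that v' and u kill the remaining binary
    form, and its degree \<open>Suc i\<close> is positive.\<close>
  have "(vt t ^^ (d - 3 - i)) (quad t \<alpha> \<beta> \<gamma> (lie c f)) = 0" if "i \<le> d - 3" for i c
    using that
  proof (induction i arbitrary: c)
    case 0
    have "(vt t ^^ (d - 3)) (quad t \<alpha> \<beta> \<gamma> (lie c f)) = (vt t ^^ (d - 3 - j)) ((vt t ^^ j) (quad t \<alpha> \<beta> \<gamma> (lie c f)))"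
      by (rule funpow_split[OF j])
    also have "\<dots> = 0" unfolding quad_vtp[symmetric] q by (rule pp.linear_0[OF linear_vtp])
    finally show "(vt t ^^ (d - 3 - 0)) (quad t \<alpha> \<beta> \<gamma> (lie c f)) = 0" by simp
  next
    case (Suc i)
    let ?q = "quad t \<alpha> \<beta> \<gamma>" and ?p = "vt t ^^ (d - 3 - Suc i)"
    have s: "d - 3 - i = Suc (d - 3 - Suc i)" using Suc.prems by simp
    have IH: "vt t (?p (?q (lie c f))) = 0" for c
    proof -
      have "(vt t ^^ Suc (d - 3 - Suc i)) (?q (lie c f)) = 0"
        using Suc.IH[of c] Suc.prems unfolding s by linarith
      then show ?thesis unfolding funpow.simps o_apply .
    qed
    show "?p (?q (lie c f)) = 0"
    proof (rule bin_eq_0I)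
      show "homog (d - 1 - 2 - (d - 3 - Suc i)) (?p (?q (lie c f)))"
        by (intro homog_vtp homog_quad homog_lie_f)
      show "0 < d - 1 - 2 - (d - 3 - Suc i)" using Suc.prems by simp
      show "bin (?p (?q (lie c f)))" by (intro bin_vtp bin_quad lie_lie)
      have "dv U (?p (?q (lie c f))) = ?p (?q (vt t (lie (Cc c) f)))"
        by (simp only: vtp_dv[symmetric] quad_dv[symmetric] U_lie[OF self_derivs])
      also have "\<dots> = vt t (?p (?q (lie (Cc c) f)))"
        unfolding quad_vt by (metis funpow_swap1)
      finally show "dv U (?p (?q (lie c f))) = 0" using IH by simp
    qed (rule IH)
  qed
  from this[of "d - 3"] have "quad t \<alpha> \<beta> \<gamma> (lie c f) = 0" for c by simp
  then show ?thesis by (rule quad_nonzero)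
qed

text \<open>After d - 3 applications of v' the elements of W are binary forms of degree 2, and
  \<open>r\<close> pairs three of them with the three quadratic monomials. A kernel element makes
  this square matrix singular, so some nonzero quadric kills all of v^{d-3} W, against
  \<open>quad_vtp_nonzero\<close>.\<close>

lemma vtp_inj_top:
  assumes "(vt t ^^ (d - 3)) (lie c f) = 0"
  shows "lie c f = 0"
proof (rule ccontr)
  assume nz: "lie c f \<noteq> 0"
  let ?p = "vt t ^^ (d - 3)"
  define r where "r \<alpha> \<beta> \<gamma> a = quad t \<alpha> \<beta> \<gamma> (?p (dv a f)) 0" for \<alpha> \<beta> \<gamma> a
  have r: "r \<alpha> \<beta> \<gamma> a = \<alpha> * dv U (dv U (?p (dv a f))) 0 + \<beta> * dv U (vt t (?p (dv a f))) 0 + \<gamma> * vt t (vt t (?p (dv a f))) 0" for \<alpha> \<beta> \<gamma> a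
    by (simp add: r_def quad_def)
  have rlie: "quad t \<alpha> \<beta> \<gamma> (?p (lie e f)) 0 = e X * r \<alpha> \<beta> \<gamma> X + e Y * r \<alpha> \<beta> \<gamma> Y + e Z * r \<alpha> \<beta> \<gamma> Z" for \<alpha> \<beta> \<gamma> e
    unfolding r_def lie_def
    by (simp add: vtp_simps pp.linear_add[OF linear_quad] pp.linear_scale[OF linear_quad])
  \<comment> \<open>Two of the three equations always have a common nonzero solution; the third
    follows from \<open>dep\<close> by dividing by a nonzero coefficient of
    \<open>c\<close>.\<close>
  have two: "\<exists>\<alpha> \<beta> \<gamma>. (\<alpha> \<noteq> 0 \<or> \<beta> \<noteq> 0 \<or> \<gamma> \<noteq> 0) \<and> r \<alpha> \<beta> \<gamma> a = 0 \<and> r \<alpha> \<beta> \<gamma> b = 0" for a b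
    unfolding r by (rule cross_nontrivial)
  have dep: "c X * r \<alpha> \<beta> \<gamma> X + c Y * r \<alpha> \<beta> \<gamma> Y + c Z * r \<alpha> \<beta> \<gamma> Z = 0" for \<alpha> \<beta> \<gamma>
    using rlie[of \<alpha> \<beta> \<gamma> c] assms by (simp add: pp.linear_0[OF linear_quad])
  have "c X \<noteq> 0 \<or> c Y \<noteq> 0 \<or> c Z \<noteq> 0" using nz by (auto simp: lie_def)
  then have "\<exists>\<alpha> \<beta> \<gamma>. (\<alpha> \<noteq> 0 \<or> \<beta> \<noteq> 0 \<or> \<gamma> \<noteq> 0) \<and> r \<alpha> \<beta> \<gamma> X = 0 \<and> r \<alpha> \<beta> \<gamma> Y = 0 \<and> r \<alpha> \<beta> \<gamma> Z = 0"
  proof (elim disjE)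
    assume n: "c X \<noteq> 0"
    obtain \<alpha> \<beta> \<gamma> where g: "\<alpha> \<noteq> 0 \<or> \<beta> \<noteq> 0 \<or> \<gamma> \<noteq> 0" "r \<alpha> \<beta> \<gamma> Y = 0" "r \<alpha> \<beta> \<gamma> Z = 0" using two by blast
    then have "r \<alpha> \<beta> \<gamma> X = 0" using dep[of \<alpha> \<beta> \<gamma>] n by simp
    then show ?thesis using g by blast
  next
    assume n: "c Y \<noteq> 0"
    obtain \<alpha> \<beta> \<gamma> where g: "\<alpha> \<noteq> 0 \<or> \<beta> \<noteq> 0 \<or> \<gamma> \<noteq> 0" "r \<alpha> \<beta> \<gamma> X = 0" "r \<alpha> \<beta> \<gamma> Z = 0" using two by blast
    then have "r \<alpha> \<beta> \<gamma> Y = 0" using dep[of \<alpha> \<beta> \<gamma>] n by simp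
    then show ?thesis using g by blast
  next
    assume n: "c Z \<noteq> 0"
    obtain \<alpha> \<beta> \<gamma> where g: "\<alpha> \<noteq> 0 \<or> \<beta> \<noteq> 0 \<or> \<gamma> \<noteq> 0" "r \<alpha> \<beta> \<gamma> X = 0" "r \<alpha> \<beta> \<gamma> Y = 0" using two by blast
    then have "r \<alpha> \<beta> \<gamma> Z = 0" using dep[of \<alpha> \<beta> \<gamma>] n by simp
    then show ?thesis using g by blast
  qed
  then obtain \<alpha> \<beta> \<gamma> where g: "\<alpha> \<noteq> 0 \<or> \<beta> \<noteq> 0 \<or> \<gamma> \<noteq> 0"
    "r \<alpha> \<beta> \<gamma> X = 0" "r \<alpha> \<beta> \<gamma> Y = 0" "r \<alpha> \<beta> \<gamma> Z = 0" by blast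
  have "quad t \<alpha> \<beta> \<gamma> (?p (lie e f)) = 0" for e
  proof
    fix m
    have "homog (d - 1 - (d - 3) - 2) (quad t \<alpha> \<beta> \<gamma> (?p (lie e f)))"
      by (intro homog_quad homog_vtp homog_lie_f)
    then have "homog 0 (quad t \<alpha> \<beta> \<gamma> (?p (lie e f)))" using d_ge by simp
    moreover have "quad t \<alpha> \<beta> \<gamma> (?p (lie e f)) 0 = 0" unfolding rlie g by simp
    ultimately show "quad t \<alpha> \<beta> \<gamma> (?p (lie e f)) m = 0 m"
      unfolding homog_def mdeg_0_iff by (metis zero_fun_apply)
  qed
  then show False using quad_vtp_nonzero[of "d - 3"] g(1) by blast
qed

lemma vtp_inj:
  assumes "j \<le> d - 3" "(vt t ^^ j) (lie c f) = 0"
  shows "lie c f = 0"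
proof (rule vtp_inj_top)
  have "(vt t ^^ (d - 3)) (lie c f) = (vt t ^^ (d - 3 - j)) ((vt t ^^ j) (lie c f))"
    by (rule funpow_split[OF assms(1)])
  then show "(vt t ^^ (d - 3)) (lie c f) = 0"
    unfolding assms(2) by (simp only: pp.linear_0[OF linear_vtp])
qed

text \<open>Descending induction on \<open>k\<close>. At k = d - 3 a kernel element is binary, hence
  equal to v^{d-4} applied to an element of W, and the injectivity of v^{d-3} on W applies. Below
  that, all first derivatives of a kernel element are kernel elements one degree up, so they
  vanish.\<close>

lemma vt_inj_derivs:
  assumes "k \<le> d - 3" "n \<in> derivs f k" "vt t n = 0"
  shows "n = 0"
  using assms
proof (induction "d - 3 - k" arbitrary: k n)
  case 0
  then have k: "k = d - 3" by simp
  have "bin n"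
  proof (rule lie_eq_0_of_vt[OF 0(3)])
    show "vt t (lie c n) = 0" for c
      unfolding lie_vt 0(4) by (rule pp.linear_0[OF linear_lie])
  qed (use k in simp)
  have "\<exists>c. n = (vt t ^^ Suc (k - 2)) (lie c f)"
  proof (rule bin_derivs_eq[OF _ _ refl 0(3) \<open>bin n\<close>])
    show "2 \<le> k" "k \<le> d - 2" using k d_ge by simp_all
    show "(vt t ^^ Suc (k - 2)) (lie c f) = 0 \<Longrightarrow> lie c f = 0" for c
      by (rule vtp_inj) (use k d_ge in \<open>simp_all del: funpow.simps\<close>)
    show "(\<And>c. quad t \<alpha> \<beta> \<gamma> ((vt t ^^ (k - 2)) (lie c f)) = 0) \<Longrightarrow> \<alpha> = 0 \<and> \<beta> = 0 \<and> \<gamma> = 0" for \<alpha> \<beta> \<gamma>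
      by (rule quad_vtp_nonzero[of "k - 2"]) (use k in auto)
  qed
  then obtain c where c: "n = (vt t ^^ Suc (k - 2)) (lie c f)" ..
  have "(vt t ^^ (d - 3)) (lie c f) = vt t n"
  proof -
    have "d - 3 = Suc (Suc (k - 2))" using k d_ge by simp
    then show ?thesis unfolding c by (simp only: funpow.simps o_apply)
  qed
  also have "vt t n = 0" by (rule 0(4))
  finally have "lie c f = 0" by (rule vtp_inj_top)
  then show "n = 0" unfolding c by (simp only: pp.linear_0[OF linear_vtp])
next
  case (Suc x)
  show "n = 0"
  proof (rule homog_eq_0I[OF homog_derivs[OF homog_f Suc(4)]])
    show "0 < d - k" using Suc(2) by simp
    fix w
    show "dv w n = 0"
    proof (rule Suc(1))
      show "x = d - 3 - Suc k" "Suc k \<le> d - 3" using Suc(2) by simp_all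
      show "dv w n \<in> derivs f (Suc k)" by (rule dv_derivs[OF Suc(4)])
      show "vt t (dv w n) = 0" unfolding vt_dv Suc(5) by simp
    qed
  qed
qed

end

context gen_perazzo
begin

lemma vt_image:
  assumes "2 \<le> k" "k \<le> d - 3"
  shows "vt t ` derivs f k = derivs f (Suc k)"
proof (rule pol.dim_eq_imp_eq[OF fin_dim_derivs])
  show "vt t ` derivs f k \<subseteq> derivs f (Suc k)" using vt_derivs by blast
  show "pol.subspace (vt t ` derivs f k)" by (rule pp.linear_subspace_image[OF linear_vt subspace_derivs])
  have "{n \<in> derivs f k. vt t n = 0} \<subseteq> {0}" using vt_inj_derivs[OF assms(2)] by blast
  then have "pol.dim {n \<in> derivs f k. vt t n = 0} = 0"
    using pol.dim_zero_iff pol.fin_dim_subset[OF fin_dim_0] by blast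
  then have "pol.dim (vt t ` derivs f k) = pol.dim (derivs f k)"
    using pp.rank_nullity[OF linear_vt[of t] subspace_derivs[of f k] fin_dim_derivs] by simp
  moreover have "minimal_hilb d k = 6" "minimal_hilb d (Suc k) = 6"
    using assms d_ge unfolding minimal_hilb_def by auto
  then have "pol.dim (derivs f k) = 6" "pol.dim (derivs f (Suc k)) = 6" by (simp_all add: dims)
  ultimately show "pol.dim (derivs f (Suc k)) \<le> pol.dim (vt t ` derivs f k)" by simp
qed

section \<open>The kernel of v' in degree d - 2\<close>

definition tau :: "'k pol set" where
  "tau = {n \<in> derivs f (d - 2). vt t n = 0}"

lemma subspace_tau: "pol.subspace tau"
  using subspace_derivs[of f "d - 2"] unfolding tau_def pol.subspace_def by (auto simp: vt_simps)

lemma fin_dim_tau: "pol.fin_dim tau"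
  by (rule pol.fin_dim_subset[OF fin_dim_derivs[of f "d - 2"]]) (auto simp: tau_def)

lemma tau_bin: "n \<in> tau \<Longrightarrow> bin n"
proof -
  assume n: "n \<in> tau"
  show "bin n"
  proof (rule lie_eq_0_of_vt)
    show "n \<in> derivs f (d - 2)" using n by (simp add: tau_def)
    show "vt t (lie c n) = 0" for c
      using n unfolding lie_vt tau_def by (simp add: pp.linear_0[OF linear_lie])
  qed simp
qed

lemma tau_U:
  assumes "n \<in> tau" "dv U n = 0"
  shows "n = 0"
proof (rule bin_eq_0I[OF _ _ tau_bin[OF assms(1)] assms(2)])
  show "homog (d - (d - 2)) n" using assms(1) homog_derivs[OF homog_f] by (auto simp: tau_def)
  show "0 < d - (d - 2)" using d_ge by simp
  show "vt t n = 0" using assms(1) by (simp add: tau_def)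
qed

text \<open>The dimension drops from 6 to 5, so there is a kernel. Its elements are binary forms of
  degree 2 killed by v', hence determined by the constant u^2 n, so the kernel is at most a
  line.\<close>

lemma dim_tau: "pol.dim tau = 1"
proof -
  have "vt t ` derivs f (d - 2) \<subseteq> derivs f (d - 1)"
    using vt_derivs[of _ f "d - 2" t] d_ge by (auto simp: numeral_2_eq_2 Suc_diff_Suc)
  then have "pol.dim (vt t ` derivs f (d - 2)) \<le> pol.dim (derivs f (d - 1))"
    by (rule pol.dim_le_of_subset[OF fin_dim_derivs])
  also have "\<dots> = 5" using d_ge by (simp add: dims minimal_hilb_def)
  finally have "pol.dim (vt t ` derivs f (d - 2)) \<le> 5" .
  moreover have "pol.dim (derivs f (d - 2)) = 6" using d_ge by (simp add: dims minimal_hilb_def)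
  ultimately have ge: "1 \<le> pol.dim tau"
    using pp.rank_nullity[OF linear_vt[of t] subspace_derivs[of f "d - 2"] fin_dim_derivs]
    unfolding tau_def by linarith
  let ?T = "\<lambda>n. dv U (dv U n)"
  have lin: "Vector_Spaces.linear pscale pscale ?T" by (rule pp_linearI) simp_all
  have "n = 0" if n: "n \<in> tau" "?T n = 0" for n
  proof (rule tau_U[OF n(1)])
    have h: "homog (d - (d - 2)) n" using n(1) homog_derivs[OF homog_f] by (auto simp: tau_def)
    have v: "vt t (dv U n) = 0" using n(1) unfolding vt_dv tau_def by simp
    have "0 < d - (d - 2) - 1" using d_ge by simp
    then show "dv U n = 0"
      using bin_eq_0I[OF homog_dv[OF h] _ bin_dv[OF tau_bin[OF n(1)]] n(2) v] by blast
  qed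
  then have "{n \<in> tau. ?T n = 0} \<subseteq> {0}" by blast
  then have "pol.dim {n \<in> tau. ?T n = 0} = 0"
    using pol.dim_zero_iff pol.fin_dim_subset[OF fin_dim_0] by blast
  then have "pol.dim tau = pol.dim (?T ` tau)"
    using pp.rank_nullity[OF lin subspace_tau fin_dim_tau] by simp
  also have "\<dots> \<le> card {monomial 0 :: 'k pol}"
  proof (rule pol.dim_le_card)
    show "?T ` tau \<subseteq> pol.span {monomial 0}"
    proof (rule image_subsetI)
      fix n assume "n \<in> tau"
      then have "homog (d - (d - 2)) n" using homog_derivs[OF homog_f] by (auto simp: tau_def)
      then have "homog (d - (d - 2) - 1 - 1) (?T n)" by (intro homog_dv)
      then have "homog 0 (?T n)" using d_ge by simp
      from homog_expand[OF this] have "?T n = (\<Sum>a\<in>mons 0. pscale (?T n a) (monomial a))" .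
      also have "mons 0 = {0}" by (auto simp: mons_def mdeg_0_iff)
      also have "(\<Sum>a\<in>{0}. pscale (?T n a) (monomial a)) \<in> pol.span {monomial 0}"
        by (intro pol.span_sum pol.span_scale pol.span_base) simp
      finally show "?T n \<in> pol.span {monomial 0}" .
    qed
  qed simp
  finally show ?thesis using ge by simp
qed

section \<open>Divisibility by v' in low degrees\<close>

lemma derivs_1_decomp:
  assumes "n \<in> derivs f 1"
  obtains c a b where "n = lie c f + pscale a (dv U f) + pscale b (vt t f)"
proof -
  let ?S = "{lie c f + pscale a (dv U f) + pscale b (vt t f) | c a b. True}"
  have S: "lie c f + pscale a (dv U f) + pscale b (vt t f) \<in> ?S" for c a b by blast
  have sub: "pol.subspace ?S"
  proof (rule pol.subspaceI)
    show "0 \<in> ?S" using S[of "\<lambda>_. 0" 0 0] by (simp add: lie_def)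
    fix x y assume "x \<in> ?S" "y \<in> ?S"
    then obtain c a b c' a' b' where xy: "x = lie c f + pscale a (dv U f) + pscale b (vt t f)"
      "y = lie c' f + pscale a' (dv U f) + pscale b' (vt t f)" by blast
    have "x + y = lie (\<lambda>w. c w + c' w) f + pscale (a + a') (dv U f) + pscale (b + b') (vt t f)"
      unfolding xy by (simp add: lie_def fun_eq_iff algebra_simps)
    then show "x + y \<in> ?S" by blast
  next
    fix e x assume "x \<in> ?S"
    then obtain c a b where x: "x = lie c f + pscale a (dv U f) + pscale b (vt t f)" by blast
    have "pscale e x = lie (\<lambda>w. e * c w) f + pscale (e * a) (dv U f) + pscale (e * b) (vt t f)"
      unfolding x by (simp add: lie_def fun_eq_iff algebra_simps)
    then show "pscale e x \<in> ?S" by blast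
  qed
  have "dv w f \<in> ?S" for w
  proof (cases w)
    case X then show ?thesis using S[of "(\<lambda>_. 0)(X := 1)" 0 0] by (simp add: lie_def)
  next
    case Y then show ?thesis using S[of "(\<lambda>_. 0)(Y := 1)" 0 0] by (simp add: lie_def)
  next
    case Z then show ?thesis using S[of "(\<lambda>_. 0)(Z := 1)" 0 0] by (simp add: lie_def)
  next
    case U then show ?thesis using S[of "\<lambda>_. 0" 1 0] by (simp add: lie_def)
  next
    case V
    have "lie (\<lambda>_. 0) f + pscale (- t) (dv U f) + pscale 1 (vt t f) = dv V f"
      by (simp add: lie_def vt_def fun_eq_iff)
    then show ?thesis using S[of "\<lambda>_. 0" "- t" 1] V by (simp only:)
  qed
  then have "derivs f 1 \<subseteq> ?S" unfolding derivs_1 by (intro pol.span_minimal sub) auto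
  then show thesis using assms that by blast
qed

text \<open>Expanding \<open>n\<close> turns the relation into q f plus an element of v' W, where q
  is a quadric with u^2-coefficient \<open>a\<close>. Applying x, y, z removes the second part, so q
  kills W and all its coefficients vanish.\<close>

lemma UU_not_in_vt_image:
  assumes "n \<in> derivs f 1" "vt t n + pscale a (dv U (dv U f)) = 0"
  shows "a = 0"
proof -
  obtain c x y where n: "n = lie c f + pscale x (dv U f) + pscale y (vt t f)"
    using derivs_1_decomp[OF assms(1)] .
  have "quad t a x y f + vt t (lie c f) = vt t n + pscale a (dv U (dv U f))"
    unfolding n vt_simps quad_def by (simp add: vt_dv)
  then have rel: "quad t a x y f + vt t (lie c f) = 0" using assms(2) by simp
  have "quad t a x y (lie b f) = 0" for b
  proof -
    have "lie b (quad t a x y f + vt t (lie c f)) = 0" unfolding rel by (rule pp.linear_0[OF linear_lie])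
    moreover have "lie b (vt t (lie c f)) = 0" using bin_vt[OF lie_lie] bin_iff_lie by blast
    ultimately have "lie b (quad t a x y f) = 0" by (simp only: pp.linear_add[OF linear_lie] add_0_right)
    then show ?thesis by (simp only: lie_quad)
  qed
  then show ?thesis using quad_nonzero by blast
qed

lemma U_dv_decomp: "\<exists>n'\<in>derivs f 1. \<exists>a. dv U (dv w f) = vt t n' + pscale a (dv U (dv U f))"
proof (cases w)
  case U
  show ?thesis unfolding U using pol.subspace_0[OF subspace_derivs]
    by (intro bexI[of _ 0] exI[of _ 1]) (simp_all add: vt_0)
next
  case V
  have "dv U f \<in> derivs f 1" using dv_derivs[OF self_derivs] by simp
  moreover have "dv U (dv V f) = vt t (dv U f) + pscale (- t) (dv U (dv U f))"
    by (simp add: vt_def dv_comm[of V U])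
  ultimately show ?thesis unfolding V by blast
qed (use U_dv[of w] lie_derivs[OF self_derivs, where c = "Cm w"] in
     \<open>auto intro!: bexI[of _ "lie (Cm w) f"] exI[of _ 0]\<close>)

text \<open>Modulo v' N_1 only u^2 f survives: products within x, y, z kill \<open>f\<close>, u a f
  is divisible by v' for a in x, y, z, and v equals v' - t u.\<close>

lemma derivs_2_decomp:
  assumes "n \<in> derivs f 2"
  obtains n' a where "n' \<in> derivs f 1" "n = vt t n' + pscale a (dv U (dv U f))"
proof -
  let ?S = "{vt t n' + pscale a (dv U (dv U f)) | n' a. n' \<in> derivs f 1}"
  have sub: "pol.subspace ?S"
  proof (rule pol.subspaceI)
    have "vt t 0 + pscale 0 (dv U (dv U f)) \<in> ?S" using pol.subspace_0[OF subspace_derivs] by blast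
    then show "0 \<in> ?S" by (simp add: vt_0)
    fix x y assume "x \<in> ?S" "y \<in> ?S"
    then obtain n1 a n2 b where xy: "x = vt t n1 + pscale a (dv U (dv U f))" "n1 \<in> derivs f 1"
      "y = vt t n2 + pscale b (dv U (dv U f))" "n2 \<in> derivs f 1" by blast
    have "x + y = vt t (n1 + n2) + pscale (a + b) (dv U (dv U f))"
      unfolding xy vt_simps by (simp add: pol.scale_left_distrib)
    then show "x + y \<in> ?S" using pol.subspace_add[OF subspace_derivs xy(2,4)] by blast
  next
    fix e x assume "x \<in> ?S"
    then obtain n1 a where x: "x = vt t n1 + pscale a (dv U (dv U f))" "n1 \<in> derivs f 1" by blast
    have "pscale e x = vt t (pscale e n1) + pscale (e * a) (dv U (dv U f))"
      unfolding x vt_simps by (simp add: pol.scale_right_distrib)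
    then show "pscale e x \<in> ?S" using pol.subspace_scale[OF subspace_derivs x(2)] by blast
  qed
  have UU: "dv U (dv w f) \<in> ?S" for w using U_dv_decomp[of w] by blast
  have vS: "vt t (dv w f) \<in> ?S" for w
  proof -
    have "dv w f \<in> derivs f 1" using dv_derivs[OF self_derivs[of f], of w] by simp
    then have "vt t (dv w f) + pscale 0 (dv U (dv U f)) \<in> ?S" by blast
    then show ?thesis by simp
  qed
  have VS: "dv V (dv w f) \<in> ?S" for w
  proof -
    have "dv V (dv w f) = vt t (dv w f) + pscale (- t) (dv U (dv w f))" by (simp add: vt_def)
    then show ?thesis using pol.subspace_add[OF sub vS pol.subspace_scale[OF sub UU]] by (simp only:)
  qed
  have S: "dv w (dv w' f) \<in> ?S" for w w'
  proof -
    consider "w = U" | "w = V" | "w' = U" | "w' = V" | "w \<in> {X, Y, Z}" "w' \<in> {X, Y, Z}"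
      by (cases w; cases w') auto
    then show ?thesis
    proof cases
      case 3 then show ?thesis using UU[of w] dv_comm[of U w f] by simp
    next
      case 4 then show ?thesis using VS[of w] dv_comm[of V w f] by simp
    next
      case 5
      then have "dv w (dv w' f) = 0" using flat[of w'] unfolding bin_def by blast
      then show ?thesis using pol.subspace_0[OF sub] by (simp only:)
    qed (use UU VS in blast)+
  qed
  have "shift m f \<in> ?S" if "m \<in> mons 2" for m
  proof -
    have m: "mdeg m = 2" using that by (simp add: mons_def)
    then have "m \<noteq> 0" using mdeg_0_iff[of m] by auto
    then obtain w where "0 < m w" by (auto simp: fun_eq_iff)
    then obtain m' where m': "m = m' + monom_var w" using monom_minus_var by blast
    then have "m' \<in> mons 1" using m by (simp add: mdeg_add mons_def)
    then obtain w' where "m' = monom_var w'" unfolding mons_1 by blast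
    then have "shift m f = dv w' (dv w f)" unfolding m' dv_def by (simp add: shift_shift)
    then show ?thesis using S by (simp only:)
  qed
  then have "derivs f 2 \<subseteq> ?S" unfolding derivs_def[of f 2] by (intro pol.span_minimal sub) auto
  then show thesis using assms that by blast
qed

text \<open>An element \<open>n\<close> is good for \<open>Q\<close> if the fractions \<open>w n / v\<close> for \<open>w\<close> in \<open>Q\<close> make sense and commute
  with \<open>Q\<close>; this is what extends a cochain with values \<open>n\<close> to a Koszul cycle.\<close>

definition good :: "nat \<Rightarrow> var set \<Rightarrow> 'k pol \<Rightarrow> bool" where
  "good k Q n \<longleftrightarrow> (\<exists>C. (\<forall>w\<in>Q. C w \<in> derivs f k \<and> vt t (C w) = dv w n) \<and>
     (\<forall>w\<in>Q. \<forall>w'\<in>Q. dv w (C w') = dv w' (C w)))"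

lemma good_add:
  assumes "good k Q m" "good k Q n"
  shows "good k Q (m + n)"
proof -
  obtain C D where "\<forall>w\<in>Q. C w \<in> derivs f k \<and> vt t (C w) = dv w m" "\<forall>w\<in>Q. \<forall>w'\<in>Q. dv w (C w') = dv w' (C w)"
    "\<forall>w\<in>Q. D w \<in> derivs f k \<and> vt t (D w) = dv w n" "\<forall>w\<in>Q. \<forall>w'\<in>Q. dv w (D w') = dv w' (D w)"
    using assms unfolding good_def by blast
  then show ?thesis unfolding good_def
    by (intro exI[of _ "\<lambda>w. C w + D w"]) (auto simp: vt_simps intro!: pol.subspace_add[OF subspace_derivs])
qed

lemma good_scale:
  assumes "good k Q n"
  shows "good k Q (pscale c n)"
proof -
  obtain C where "\<forall>w\<in>Q. C w \<in> derivs f k \<and> vt t (C w) = dv w n" "\<forall>w\<in>Q. \<forall>w'\<in>Q. dv w (C w') = dv w' (C w)"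
    using assms unfolding good_def by blast
  then show ?thesis unfolding good_def
    by (intro exI[of _ "\<lambda>w. pscale c (C w)"]) (auto simp: vt_simps intro!: pol.subspace_scale[OF subspace_derivs])
qed

text \<open>For v' n the fraction by v' is w n, and derivatives commute.\<close>

lemma good_vt: "n \<in> derivs f k \<Longrightarrow> good (Suc k) Q (vt t n)"
  unfolding good_def by (intro exI[of _ "\<lambda>w. dv w n"]) (auto simp: dv_derivs vt_dv dv_comm)

lemma dv_lie_f: "a \<in> {X, Y, Z} \<Longrightarrow> dv a (lie c f) = 0"
  using lie_lie[of c] unfolding bin_def by blast

lemma good_lie_f:
  assumes "V \<notin> Q"
  shows "good 1 Q (lie c f)"
  unfolding good_def
proof (intro exI conjI ballI)
  let ?C = "\<lambda>w. if w = U then lie (Cc c) f else 0"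
  fix w assume w: "w \<in> Q"
  then have w': "w = U \<or> w \<in> {X, Y, Z}" using assms by (cases w) auto
  show "?C w \<in> derivs f 1"
    using lie_derivs[OF self_derivs[of f]] pol.subspace_0[OF subspace_derivs] by auto
  show "vt t (?C w) = dv w (lie c f)"
    using w' U_lie[OF self_derivs, of c] dv_lie_f[of w c] by (auto simp: vt_0)
  fix x assume x: "x \<in> Q"
  then have x': "x = U \<or> x \<in> {X, Y, Z}" using assms by (cases x) auto
  show "dv w (?C x) = dv x (?C w)" using w' x' dv_lie_f by auto
qed

text \<open>Only fractions of a u f with a in x, y, z are needed. They lie in W, so they are killed
  by x, y, z. The assumption \<open>U \<notin> Q\<close> avoids u^2 f, which is not divisible by
  v'.\<close>

lemma good_U_f:
  assumes "V \<notin> Q" "U \<notin> Q"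
  shows "good 1 Q (dv U f)"
  unfolding good_def
proof (intro exI conjI ballI)
  fix w assume w: "w \<in> Q"
  then have w': "w \<in> {X, Y, Z}" using assms by (cases w) auto
  show "lie (Cm w) f \<in> derivs f 1"
    using lie_derivs[OF self_derivs[of f]] by simp
  show "vt t (lie (Cm w) f) = dv w (dv U f)"
    using w' U_dv[of w] dv_comm[of w U f] by simp
  fix x assume x: "x \<in> Q"
  then have x': "x \<in> {X, Y, Z}" using assms by (cases x) auto
  show "dv w (lie (Cm x) f) = dv x (lie (Cm w) f)" using w' x' dv_lie_f by simp
qed

text \<open>Write \<open>u a f = v C_a f\<close> on \<open>W\<close> and choose \<open>\<phi>\<close> with \<open>v \<phi> = u^3 f\<close>. The fractions \<open>u C_a f\<close> and \<open>\<phi>\<close>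
  commute because \<open>\<omega>_a = a \<phi> - u^2 C_a f\<close> is killed by every variable.\<close>

lemma good_UU_f:
  assumes "V \<notin> Q"
  shows "good 2 Q (dv U (dv U f))"
proof -
  have f3: "dv U (dv U (dv U f)) \<in> derivs f (Suc 2)"
    using dv_derivs[OF dv_derivs[OF dv_derivs[OF self_derivs[of f]]]] by (simp add: numeral_2_eq_2)
  have "derivs f (Suc 2) = vt t ` derivs f 2" using vt_image[of 2] d_ge by simp
  then obtain \<phi> where \<phi>: "\<phi> \<in> derivs f 2" "dv U (dv U (dv U f)) = vt t \<phi>" using f3 by blast
  define \<omega> where "\<omega> c = lie c \<phi> - dv U (dv U (lie (Cc c) f))" for c
  have v\<omega>: "vt t (\<omega> c) = 0" for c
  proof -
    have "vt t (\<omega> c) = lie c (dv U (dv U (dv U f))) - dv U (dv U (vt t (lie (Cc c) f)))"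
      by (simp only: \<omega>_def vt_simps lie_vt \<phi>(2) vt_dv)
    also have "\<dots> = 0" by (simp only: U_lie[OF self_derivs, symmetric] lie_dv[symmetric] diff_self)
    finally show ?thesis .
  qed
  have "\<omega> c = 0" for c
  proof (rule bin_eq_0I)
    have "homog (d - 2) \<phi>" by (rule homog_derivs[OF homog_f \<phi>(1)])
    then have "homog (d - 2 - 1) (lie c \<phi>)" by (rule homog_lie)
    moreover have "homog (d - 1 - 1 - 1) (dv U (dv U (lie (Cc c) f)))" by (intro homog_dv homog_lie_f)
    ultimately show "homog (d - 3) (\<omega> c)" unfolding \<omega>_def by (intro homog_diff) (simp_all add: numeral_eq_Suc)
    show "0 < d - 3" using d_ge by simp
    have "bin (lie c \<phi>)" "bin (dv U (dv U (lie (Cc c) f)))"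
      using bin_lie[OF \<phi>(1)] bin_dv[OF bin_dv[OF lie_lie]] by blast+
    then show "bin (\<omega> c)" unfolding \<omega>_def bin_def by simp
    have "dv U (\<omega> c) = dv U (lie c \<phi>) - dv U (dv U (dv U (lie (Cc c) f)))"
      by (simp only: \<omega>_def dv_simps)
    also have "\<dots> = vt t (lie (Cc c) \<phi>) - dv U (dv U (vt t (lie (Cc (Cc c)) f)))"
      by (simp only: U_lie[OF \<phi>(1)] U_lie[OF self_derivs])
    also have "\<dots> = vt t (\<omega> (Cc c))" by (simp only: \<omega>_def vt_simps vt_dv)
    finally show "dv U (\<omega> c) = 0" using v\<omega> by simp
  qed (rule v\<omega>)
  then have lie\<phi>: "lie c \<phi> = dv U (dv U (lie (Cc c) f))" for c unfolding \<omega>_def by (metis eq_iff_diff_eq_0)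
  have dv\<phi>: "dv a \<phi> = dv U (dv U (lie (Cm a) f))" if "a \<in> {X, Y, Z}" for a
  proof -
    have "lie ((\<lambda>_. 0)(a := 1)) \<phi> = dv a \<phi>" using that by (auto simp: lie_def)
    moreover have "Cc ((\<lambda>_. 0)(a := 1)) = Cm a" using that by (auto simp: Cc_def)
    ultimately show ?thesis using lie\<phi>[of "(\<lambda>_. 0)(a := 1)"] by simp
  qed
  let ?C = "\<lambda>w. if w = U then \<phi> else dv U (lie (Cm w) f)"
  show ?thesis unfolding good_def
  proof (intro exI[of _ ?C] conjI ballI)
    fix w assume w: "w \<in> Q"
    then have w': "w = U \<or> w \<in> {X, Y, Z}" using assms by (cases w) auto
    have "dv U (lie (Cm w) f) \<in> derivs f 2"
      using dv_derivs[OF lie_derivs[OF self_derivs[of f]]] by (simp add: numeral_2_eq_2)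
    then show "?C w \<in> derivs f 2" using \<phi>(1) by simp
    have "vt t (dv U (lie (Cm w) f)) = dv w (dv U (dv U f))" if "w \<in> {X, Y, Z}"
      by (simp only: vt_dv U_dv[OF that, symmetric] dv_comm[of w U])
    then show "vt t (?C w) = dv w (dv U (dv U f))" using w' \<phi>(2) by auto
    fix x assume x: "x \<in> Q"
    then have x': "x = U \<or> x \<in> {X, Y, Z}" using assms by (cases x) auto
    have "dv w (dv U (lie (Cm x) f)) = 0" if "w \<in> {X, Y, Z}" for w x
      using dv_lie_f[OF that] by (simp add: dv_comm[of w U])
    then show "dv w (?C x) = dv x (?C w)" using w' x' dv\<phi> by auto
  qed
qed

lemma good_1_XYZ:
  assumes "V \<notin> Q" "U \<notin> Q" "n \<in> derivs f 1"
  shows "good 1 Q n"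
proof -
  obtain c a b where n: "n = lie c f + pscale a (dv U f) + pscale b (vt t f)"
    using derivs_1_decomp[OF assms(3)] .
  show ?thesis unfolding n
    using good_lie_f[OF assms(1)] good_U_f[OF assms(1,2)] good_vt[OF self_derivs]
    by (intro good_add good_scale) auto
qed

text \<open>W together with v' f, a hyperplane of N_1 that omits u f. It is the exact range for
  components of degree-one cycles at sets containing U but not V.\<close>

definition derivs_1' :: "'k pol set" where
  "derivs_1' = {lie c f + pscale b (vt t f) | c b. True}"

lemma good_1:
  assumes "V \<notin> Q" "n \<in> derivs_1'"
  shows "good 1 Q n"
proof -
  obtain c b where n: "n = lie c f + pscale b (vt t f)" using assms(2) unfolding derivs_1'_def by blast
  show ?thesis unfolding n
    using good_lie_f[OF assms(1)] good_vt[OF self_derivs] by (intro good_add good_scale) auto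
qed

text \<open>Above degree 2 every element is v' times another one, including k = d - 2, since v' maps
  N_{d-3} onto N_{d-2}. In degree 2 only the line of u^2 f needs its own fractions.\<close>

lemma good_ge_2:
  assumes "V \<notin> Q" "2 \<le> k" "k \<le> d - 2" "n \<in> derivs f k"
  shows "good k Q n"
proof (cases "k = 2")
  case True
  then obtain n' a where n: "n' \<in> derivs f 1" "n = vt t n' + pscale a (dv U (dv U f))"
    using derivs_2_decomp[of n] assms(4) by blast
  have "good 2 Q (vt t n')" using good_vt[OF n(1)] by (simp add: numeral_2_eq_2)
  then show ?thesis unfolding n(2) True using good_UU_f[OF assms(1)] by (intro good_add good_scale)
next
  case False
  then have k: "k = Suc (k - 1)" "2 \<le> k - 1" "k - 1 \<le> d - 3" using assms d_ge by auto
  then have "n \<in> vt t ` derivs f (k - 1)" using vt_image[OF k(2,3)] assms(4) by simp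
  then obtain n' where "n' \<in> derivs f (k - 1)" "n = vt t n'" by blast
  then show ?thesis using good_vt[of n' "k - 1" Q] k(1) by simp
qed

end

section \<open>Linear change of the last variable in the Koszul complex\<close>

definition opv :: "'k \<Rightarrow> var \<Rightarrow> 'k::field pol \<Rightarrow> 'k pol" where
  "opv t w = (if w = V then vt t else dv w)"

lemma linear_opv: "Vector_Spaces.linear pscale pscale (opv t w)"
  using linear_vt[of t] linear_dv[of w] unfolding opv_def by (cases "w = V") (simp_all only: simp_thms if_True if_False)

lemma opv_simps: "opv t V = vt t" "w \<noteq> V \<Longrightarrow> opv t w = dv w"
  by (simp_all add: opv_def)

lemma kos_expand:
  fixes A :: "var \<Rightarrow> 'k::field pol \<Rightarrow> 'k pol"
  shows "kos A c T = (let h = (\<lambda>w. if w \<in> T then 0 else pscale (sg T w) (A w (c (insert w T))))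
    in h X + (h Y + (h Z + (h U + h V))))"
proof -
  let ?h = "\<lambda>w. if w \<in> T then 0 else pscale (sg T w) (A w (c (insert w T)))"
  have "kos A c T = (\<Sum>w\<in>UNIV - T. ?h w)" unfolding kos_def by (intro sum.cong) auto
  also have "\<dots> = (\<Sum>w\<in>UNIV. ?h w)" by (intro sum.mono_neutral_left) auto
  also have "\<dots> = ?h X + (?h Y + (?h Z + (?h U + ?h V)))"
    unfolding UNIV_var by (simp only: sum.insert sum.empty finite.intros insert_iff var.distinct empty_iff simp_thms if_False) simp
  finally show ?thesis unfolding Let_def .
qed

lemma sg_insert_less:
  assumes "var_idx w < var_idx x" "w \<notin> T"
  shows "sg (insert w T) x = - sg T x"
proof -
  have "{y \<in> insert w T. var_idx y < var_idx x} = insert w {y \<in> T. var_idx y < var_idx x}"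
    using assms by auto
  then show ?thesis using assms(2) by (simp add: sg_def)
qed

lemma sg_insert_ge:
  assumes "\<not> var_idx w < var_idx x"
  shows "sg (insert w T) x = sg T x"
proof -
  have "{y \<in> insert w T. var_idx y < var_idx x} = {y \<in> T. var_idx y < var_idx x}"
    using assms by auto
  then show ?thesis by (simp add: sg_def)
qed

lemma var_idx_inj: "var_idx w = var_idx x \<Longrightarrow> w = x"
  by (cases w; cases x) auto

text \<open>The antisymmetry behind d^2 = 0; it also makes the double sums of fractions cancel in
  \<open>extend_good\<close>.\<close>

lemma sg_swap:
  assumes "w \<noteq> x" "w \<notin> T" "x \<notin> T"
  shows "sg T w * sg (insert w T) x = - (sg T x * sg (insert x T) w :: 'k::comm_ring_1)"
proof -
  have *: "sg T w * sg (insert w T) x = - (sg T x * sg (insert x T) w :: 'k)"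
    if "var_idx w < var_idx x" "w \<notin> T" for w x
    using that by (simp add: sg_insert_less sg_insert_ge)
  consider "var_idx w < var_idx x" | "var_idx x < var_idx w"
    using var_idx_inj assms(1) by (metis linorder_neqE_nat)
  then show ?thesis
  proof cases
    case 2
    then show ?thesis using *[of x w] assms by simp
  qed (use * assms in auto)
qed

lemma sg_V: "V \<notin> T \<Longrightarrow> sg T V = (-1) ^ card T"
proof -
  assume "V \<notin> T"
  then have "{x \<in> T. var_idx x < var_idx V} = T"
  proof (intro Collect_cong[of _ "\<lambda>x. x \<in> T", unfolded Collect_mem_eq])
    fix x show "x \<in> T \<and> var_idx x < var_idx V \<longleftrightarrow> x \<in> T"
      using \<open>V \<notin> T\<close> by (cases x) auto
  qed
  then show ?thesis by (simp add: sg_def)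
qed

lemma sg_sq: "sg T w * sg T w = (1 :: 'k::comm_ring_1)"
  by (simp add: sg_def power_mult_distrib[symmetric])

lemma sg_nonzero: "sg T w \<noteq> (0 :: 'k::field)"
  using sg_sq[of T w, where 'k = 'k] by auto

text \<open>U and V are adjacent in the order of the variables, so only U itself could lie before V
  but not before U.\<close>

lemma sg_U_V: "U \<notin> T \<Longrightarrow> sg T V = sg T U"
proof -
  assume "U \<notin> T"
  then have "x \<in> T \<and> var_idx x < var_idx V \<longleftrightarrow> x \<in> T \<and> var_idx x < var_idx U" for x by (cases x) auto
  then show ?thesis by (simp add: sg_def)
qed

text \<open>Evaluates a cochain on the dual basis, where \<open>e_U\<close> is replaced by \<open>e_U - t e_V\<close>.\<close>

definition chg :: "'k \<Rightarrow> 'k::field chain \<Rightarrow> 'k chain" where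
  "chg t c = (\<lambda>S. if U \<in> S \<and> V \<notin> S then c S - pscale t (c (insert V (S - {U}))) else c S)"

lemma linear_chg: "Vector_Spaces.linear chain_scale chain_scale (chg t)"
  by (rule cc_linearI) (auto simp: chg_def fun_eq_iff algebra_simps)

lemma chg_chg: "chg t (chg (- t) c) = c"
  by (rule ext) (simp add: chg_def)

lemma chg_kchains: "c \<in> kchains f i k \<Longrightarrow> chg t c \<in> kchains f i k"
proof (rule kchainsI)
  fix S assume c: "c \<in> kchains f i k"
  show "chg t c S \<in> derivs f k"
    unfolding chg_def using kchainsD(3)[OF c]
    by (auto intro!: pol.subspace_diff[OF subspace_derivs] pol.subspace_scale[OF subspace_derivs])
  have "U \<in> S \<Longrightarrow> V \<notin> S \<Longrightarrow> card (insert V (S - {U})) = card S"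
    by (metis card.insert_remove card_insert_disjoint Diff_iff finite insert_Diff insert_absorb)
  then show "card S \<noteq> i \<Longrightarrow> chg t c S = 0"
    unfolding chg_def using kchainsD(2)[OF c] by simp
qed

lemma kos_chg: "kos (opv t) (chg t c) = chg t (kos dv c)"
proof
  fix T
  show "kos (opv t) (chg t c) T = chg t (kos dv c) T"
  proof (cases "U \<in> T")
    case False
    \<comment> \<open>The correction in the component at \<open>insert U T\<close> cancels the t u
      part of v' at \<open>insert V T\<close>, because the signs at U and V agree.\<close>
    have "V \<notin> T \<Longrightarrow> insert V (insert U T - {U}) = insert V T" using False by auto
    then show ?thesis using False
      by (simp add: kos_expand chg_def Let_def opv_simps sg_U_V vt_def pol.scale_right_diff_distrib
          pol.scale_right_distrib mult.commute)
  next
    case U: True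
    show ?thesis
    proof (cases "V \<in> T")
      case True
      then show ?thesis using U by (simp add: kos_expand chg_def Let_def opv_simps)
    next
      case False
      let ?T = "insert V (T - {U})"
      have i: "insert w ?T = insert V (insert w T - {U})" if "w \<noteq> U" for w using that by auto
      have j: "insert U ?T = insert V T" using U by auto
      have T: "insert U (T - {U}) = T" using U by auto
      have s: "sg ?T w = (sg T w :: 'a)" if "w \<in> {X, Y, Z}" for w
      proof -
        have "sg ?T w = (sg (T - {U}) w :: 'a)" using that by (intro sg_insert_ge) auto
        also have "\<dots> = sg (insert U (T - {U})) w" using that by (intro sg_insert_ge[symmetric]) auto
        finally show ?thesis unfolding T .
      qed
      \<comment> \<open>With this sign, -t times the U-term of the differential at \<open>?T\<close>
        is the t u part of v' in the V-term at \<open>T\<close>.\<close>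
      have sU: "sg ?T U = - (sg T V :: 'a)"
      proof -
        have "sg ?T U = (sg (T - {U}) U :: 'a)" by (intro sg_insert_ge) simp
        also have "\<dots> = sg (T - {U}) V" by (intro sg_U_V[symmetric]) simp
        also have "\<dots> = - sg (insert U (T - {U})) V" by (subst sg_insert_less) simp_all
        finally show ?thesis unfolding T .
      qed
      show ?thesis using U False
        by (simp add: kos_expand[of _ _ T] kos_expand[of dv c ?T] chg_def Let_def opv_simps i[symmetric] j s sU vt_def
            pol.scale_right_diff_distrib pol.scale_right_distrib algebra_simps)
    qed
  qed
qed

lemma dim_kcycles_opv: "chn.dim (kcycles dv f i k) = chn.dim (kcycles (opv t) f i k)"
proof -
  have "chg t ` kcycles dv f i k = kcycles (opv t) f i k"
  proof
    show "chg t ` kcycles dv f i k \<subseteq> kcycles (opv t) f i k"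
      unfolding kcycles_def using chg_kchains kos_chg[of t] cc.linear_0[OF linear_chg, of t] by auto
    show "kcycles (opv t) f i k \<subseteq> chg t ` kcycles dv f i k"
    proof
      fix c assume c: "c \<in> kcycles (opv t) f i k"
      let ?b = "chg (- t) c"
      have "chg t (kos dv ?b) = 0" using c unfolding kos_chg[symmetric] chg_chg kcycles_def by simp
      then have "chg (- t) (chg (- (- t)) (kos dv ?b)) = chg (- t) 0" by simp
      then have "kos dv ?b = 0" unfolding chg_chg by (simp only: cc.linear_0[OF linear_chg])
      then have "?b \<in> kcycles dv f i k" using c chg_kchains unfolding kcycles_def by blast
      then show "c \<in> chg t ` kcycles dv f i k" using chg_chg[of t c] by (metis imageI)
    qed
  qed
  moreover have "{c \<in> kcycles dv f i k. chg t c = 0} \<subseteq> {0}"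
  proof
    fix c assume c: "c \<in> {c \<in> kcycles dv f i k. chg t c = 0}"
    have "c = chg (- t) (chg (- (- t)) c)" by (rule chg_chg[symmetric])
    also have "\<dots> = chg (- t) 0" using c by simp
    also have "\<dots> = 0" by (rule cc.linear_0[OF linear_chg])
    finally show "c \<in> {0}" by simp
  qed
  then have "chn.dim {c \<in> kcycles dv f i k. chg t c = 0} = 0"
    using chn.dim_zero_iff[OF chn.fin_dim_subset[OF fin_dim_kcycles[of dv f i k]]] by blast
  ultimately show ?thesis
    using cc.rank_nullity[OF linear_chg[of t] subspace_kcycles[of dv, OF linear_dv] fin_dim_kcycles[of dv f i k]] by simp
qed

section \<open>Extension of cochains and cycle counts\<close>

text \<open>Exchanging the indices shows that the sum equals its own negative, and 2 is
  invertible.\<close>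

lemma antisym_sum:
  fixes h :: "'i \<Rightarrow> 'i \<Rightarrow> 'k::field_char_0 pol"
  assumes "finite P" "\<And>x y. x \<in> P \<Longrightarrow> y \<in> P \<Longrightarrow> x \<noteq> y \<Longrightarrow> h x y = - h y x"
  shows "(\<Sum>x\<in>P. \<Sum>y\<in>P - {x}. h x y) = 0"
proof -
  define g where "g x y = (if x = y then 0 else h x y)" for x y
  have inner: "(\<Sum>y\<in>P - {x}. h x y) = (\<Sum>y\<in>P. g x y)" if "x \<in> P" for x
    using assms(1) by (intro sum.mono_neutral_cong_left) (auto simp: g_def)
  then have eq: "(\<Sum>x\<in>P. \<Sum>y\<in>P - {x}. h x y) = (\<Sum>x\<in>P. \<Sum>y\<in>P. g x y)" by (rule sum.cong[OF refl])
  have "(\<Sum>x\<in>P. \<Sum>y\<in>P. g x y) = (\<Sum>y\<in>P. \<Sum>x\<in>P. g x y)" by (rule sum.swap)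
  also have "\<dots> = (\<Sum>y\<in>P. \<Sum>x\<in>P. - g y x)"
  proof (intro sum.cong refl)
    fix x y assume "y \<in> P" "x \<in> P"
    then show "g x y = - g y x" using assms(2)[of x y] unfolding g_def
      by (cases "x = y") (simp_all only: simp_thms if_True if_False minus_zero, metis)
  qed
  also have "\<dots> = - (\<Sum>x\<in>P. \<Sum>y\<in>P. g x y)" by (simp only: sum_negf)
  finally have e: "(\<Sum>x\<in>P. \<Sum>y\<in>P. g x y) = - (\<Sum>x\<in>P. \<Sum>y\<in>P. g x y)" .
  have "q = 0" if "q = - q" for q :: "'k pol"
  proof
    fix m
    have "q m = - q m" using fun_cong[OF that, of m] by simp
    then show "q m = 0 m" by simp
  qed
  then show ?thesis using e eq by metis
qed

definition rst :: "'k::field chain \<Rightarrow> 'k chain" where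
  "rst c = (\<lambda>S. if V \<in> S then 0 else c S)"

lemma linear_rst: "Vector_Spaces.linear chain_scale chain_scale rst"
  by (rule cc_linearI) (auto simp: rst_def fun_eq_iff)

lemma kos_opv_split:
  assumes "V \<notin> T"
  shows "kos (opv t) c T = pscale (sg T V) (vt t (c (insert V T))) +
    (\<Sum>w\<in>UNIV - T - {V}. pscale (sg T w) (dv w (c (insert w T))))"
proof -
  have "kos (opv t) c T = pscale (sg T V) (opv t V (c (insert V T))) +
    (\<Sum>w\<in>UNIV - T - {V}. pscale (sg T w) (opv t w (c (insert w T))))"
    unfolding kos_def using assms by (intro sum.remove) auto
  also have "(\<Sum>w\<in>UNIV - T - {V}. pscale (sg T w) (opv t w (c (insert w T)))) =
    (\<Sum>w\<in>UNIV - T - {V}. pscale (sg T w) (dv w (c (insert w T))))"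
    by (intro sum.cong) (auto simp: opv_def)
  finally show ?thesis by (simp only: opv_simps)
qed

lemma kos_opv_V:
  assumes "V \<in> T"
  shows "kos (opv t) c T = (\<Sum>w\<in>UNIV - T. pscale (sg T w) (dv w (c (insert w T))))"
  unfolding kos_def using assms by (intro sum.cong) (auto simp: opv_def)

context gen_perazzo
begin

text \<open>The cycle equation at a set T without V prescribes v' times the component at T with V
  added; the chosen fractions supply that component. The equations at sets containing V then hold
  because the fractions commute and the Koszul signs are antisymmetric.\<close>

lemma extend_good:
  assumes a: "\<And>S. card S = i \<Longrightarrow> V \<notin> S \<Longrightarrow> a S \<in> derivs f k \<and> good k S (a S)"
    and a0: "\<And>S. card S \<noteq> i \<or> V \<in> S \<Longrightarrow> a S = 0"
  shows "\<exists>c\<in>kcycles (opv t) f i k. rst c = a"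
proof -
  have "\<exists>C. card S = i \<longrightarrow> V \<notin> S \<longrightarrow> (\<forall>w\<in>S. C w \<in> derivs f k \<and> vt t (C w) = dv w (a S)) \<and>
     (\<forall>w\<in>S. \<forall>w'\<in>S. dv w (C w') = dv w' (C w))" for S
    using a[of S] unfolding good_def by (cases "card S = i \<and> V \<notin> S") auto
  then obtain C where C': "\<And>S. card S = i \<longrightarrow> V \<notin> S \<longrightarrow> (\<forall>w\<in>S. C S w \<in> derivs f k \<and> vt t (C S w) = dv w (a S)) \<and>
     (\<forall>w\<in>S. \<forall>w'\<in>S. dv w (C S w') = dv w' (C S w))" by metis
  have C: "C S w \<in> derivs f k" "vt t (C S w) = dv w (a S)" if "card S = i" "V \<notin> S" "w \<in> S" for S w
    using C'[of S] that by blast+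
  have Cc: "dv w (C S w') = dv w' (C S w)" if "card S = i" "V \<notin> S" "w \<in> S" "w' \<in> S" for S w w'
    using C'[of S] that by blast
  define b where "b T = pscale (- ((-1) ^ card T)) (\<Sum>w\<in>UNIV - T - {V}. pscale (sg T w) (C (insert w T) w))"
    for T :: "var set"
  define c where "c S = (if card S \<noteq> i then 0 else if V \<in> S then b (S - {V}) else a S)" for S
  have cT: "c (insert V T) = b T" if "V \<notin> T" "Suc (card T) = i" for T
    using that by (simp add: c_def)
  have ca: "c S = a S" if "V \<notin> S" for S using that a0[of S] by (simp add: c_def)
  have bd: "b T \<in> derivs f k" if "V \<notin> T" "Suc (card T) = i" for T
    unfolding b_def using that
    by (intro pol.subspace_scale[OF subspace_derivs] pol.subspace_sum[OF subspace_derivs] C) auto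
  have ck: "c \<in> kchains f i k"
  proof (rule kchainsI)
    fix S
    show "card S \<noteq> i \<Longrightarrow> c S = 0" by (simp add: c_def)
    assume S: "card S = i"
    show "c S \<in> derivs f k"
    proof (cases "V \<in> S")
      case True
      then have "Suc (card (S - {V})) = i" using S by (metis card_Suc_Diff1 finite)
      then have "b (S - {V}) \<in> derivs f k" by (intro bd) auto
      then show ?thesis using True S by (simp add: c_def)
    next
      case False
      then show ?thesis using a[OF S False] ca[OF False] by simp
    qed
  qed
  have "kos (opv t) c = 0"
  proof
    fix T
    show "kos (opv t) c T = 0 T"
    proof (cases "Suc (card T) = i")
      case False
      then have "c (insert w T) = 0" if "w \<notin> T" for w using that by (simp add: c_def)
      then have "opv t w (c (insert w T)) = 0" if "w \<notin> T" for w
        using that pp.linear_0[OF linear_opv] by metis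
      then show ?thesis unfolding kos_def by simp
    next
      case cardT: True
      show ?thesis
      proof (cases "V \<in> T")
        case False
        let ?s = "\<Sum>w\<in>UNIV - T - {V}. pscale (sg T w) (dv w (a (insert w T)))"
        have "vt t (c (insert V T)) = vt t (b T)" by (simp only: cT[OF False cardT])
        also have "\<dots> = pscale (- ((-1) ^ card T)) (\<Sum>w\<in>UNIV - T - {V}. pscale (sg T w) (vt t (C (insert w T) w)))"
          unfolding b_def vt_scale vt_sum ..
        also have "(\<Sum>w\<in>UNIV - T - {V}. pscale (sg T w) (vt t (C (insert w T) w))) = ?s"
        proof (intro sum.cong refl)
          fix w assume "w \<in> UNIV - T - {V}"
          then have "vt t (C (insert w T) w) = dv w (a (insert w T))" using False cardT by (intro C) auto
          then show "pscale (sg T w) (vt t (C (insert w T) w)) = pscale (sg T w) (dv w (a (insert w T)))" by (simp only:)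
        qed
        finally have "pscale (sg T V) (vt t (c (insert V T))) = pscale (sg T V * (- ((-1) ^ card T))) ?s"
          by (simp only: pol.scale_scale)
        also have "sg T V * (- ((-1) ^ card T)) = (-1 :: 'k)"
          using sg_sq[of T V, where 'k = 'k] by (simp add: sg_V[OF False])
        finally have 1: "pscale (sg T V) (vt t (c (insert V T))) = - ?s"
          by (simp only: pol.scale_minus_left pol.scale_one)
        have 2: "(\<Sum>w\<in>UNIV - T - {V}. pscale (sg T w) (dv w (c (insert w T)))) = ?s"
        proof (intro sum.cong refl)
          fix w assume "w \<in> UNIV - T - {V}"
          then have "c (insert w T) = a (insert w T)" using False by (intro ca) auto
          then show "pscale (sg T w) (dv w (c (insert w T))) = pscale (sg T w) (dv w (a (insert w T)))" by (simp only:)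
        qed
        show ?thesis unfolding kos_opv_split[OF False] 1 2 by simp
      next
        case True
        define P where "P = UNIV - T"
        let ?T = "T - {V}"
        have TV: "insert V ?T = T" using True by auto
        have cT': "Suc (Suc (card ?T)) = i" using True cardT by (metis card_Suc_Diff1 finite)
        have sgT: "sg T w = (sg ?T w :: 'k)" if "w \<noteq> V" for w
        proof -
          have "sg (insert V ?T) w = (sg ?T w :: 'k)" using that by (intro sg_insert_ge) (cases w, auto)
          then show ?thesis unfolding TV .
        qed
        \<comment> \<open>The contribution of adding \<open>w\<close> and then \<open>x\<close>.
          Both orders reach the same set and the same family of fractions, so only the sign
          changes.\<close>
        define h where "h w x = pscale (sg ?T w * sg (insert w ?T) x) (dv w (C (insert x (insert w ?T)) x))" for w x
        have summand: "pscale (sg T w) (dv w (c (insert w T))) =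
            pscale (- ((-1) ^ Suc (card ?T))) (\<Sum>x\<in>P - {w}. h w x)" if w: "w \<in> P" for w
        proof -
          have w': "w \<notin> T" "w \<noteq> V" using w True by (auto simp: P_def)
          have i: "insert w T = insert V (insert w ?T)" using True by auto
          have "c (insert w T) = b (insert w ?T)"
            unfolding i using w' cT' by (intro cT) auto
          moreover have "UNIV - insert w ?T - {V} = P - {w}" using True by (auto simp: P_def)
          moreover have "card (insert w ?T) = Suc (card ?T)" using w' by simp
          ultimately show ?thesis
            unfolding b_def sgT[OF w'(2)] h_def
            by (simp only: dv_simps pol.scale_scale pol.scale_sum_right mult_ac)
        qed
        have "(\<Sum>w\<in>P. pscale (sg T w) (dv w (c (insert w T)))) =
          (\<Sum>w\<in>P. pscale (- ((-1) ^ Suc (card ?T))) (\<Sum>x\<in>P - {w}. h w x))"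
          by (intro sum.cong refl summand)
        also have "\<dots> = pscale (- ((-1) ^ Suc (card ?T))) (\<Sum>w\<in>P. \<Sum>x\<in>P - {w}. h w x)"
          by (simp only: pol.scale_sum_right)
        also have "(\<Sum>w\<in>P. \<Sum>x\<in>P - {w}. h w x) = 0"
        proof (rule antisym_sum)
          fix w x assume wx: "w \<in> P" "x \<in> P" "w \<noteq> x"
          have i: "insert w (insert x ?T) = insert x (insert w ?T)" by auto
          have n: "w \<notin> ?T" "x \<notin> ?T" "w \<noteq> V" "x \<noteq> V" using wx True by (auto simp: P_def)
          have "dv w (C (insert x (insert w ?T)) x) = dv x (C (insert x (insert w ?T)) w)"
            using n wx cT' by (intro Cc) auto
          then show "h w x = - h x w"
            unfolding h_def i sg_swap[OF wx(3) n(1,2)] by (simp only: pol.scale_minus_left)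
        qed (simp add: P_def)
        finally show ?thesis unfolding kos_opv_V[OF True] P_def pol.scale_zero_right
          by (rule trans[OF _ zero_fun_apply[symmetric]])
      qed
    qed
  qed
  then have "c \<in> kcycles (opv t) f i k" using ck by (simp only: kcycles_def mem_Collect_eq simp_thms)
  moreover have "rst c = a"
  proof
    fix S show "rst c S = a S" using ca[of S] a0[of S] by (cases "V \<in> S") (simp_all add: rst_def)
  qed
  ultimately show ?thesis by blast
qed

text \<open>By \<open>suff\<close> and \<open>nec\<close> the restriction to sets without V maps the
  cycles onto the full product of the spaces \<open>G S\<close>; rank-nullity adds the cycles with
  zero restriction.\<close>

lemma dim_kcycles_fam:
  assumes G: "\<And>S. pol.subspace (G S)" "\<And>S. G S \<subseteq> derivs f k"
    and suff: "\<And>S n. V \<notin> S \<Longrightarrow> n \<in> G S \<Longrightarrow> good k S n"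
    and nec: "\<And>c S. c \<in> kcycles (opv t) f i k \<Longrightarrow> V \<notin> S \<Longrightarrow> card S = i \<Longrightarrow> c S \<in> G S"
  shows "chn.dim (kcycles (opv t) f i k) = chn.dim {c \<in> kcycles (opv t) f i k. rst c = 0} +
    (\<Sum>S | card S = i \<and> V \<notin> S. pol.dim (G S))"
proof -
  let ?M = "\<lambda>S. if card S = i \<and> V \<notin> S then G S else {0}"
  have "rst ` kcycles (opv t) f i k = fam ?M"
  proof
    show "rst ` kcycles (opv t) f i k \<subseteq> fam ?M"
    proof (rule image_subsetI)
      fix c assume c: "c \<in> kcycles (opv t) f i k"
      then have "c \<in> kchains f i k" by (simp add: kcycles_def)
      from kchainsD(2)[OF this] show "rst c \<in> fam ?M"
        using nec[OF c] by (simp add: fam_def rst_def)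
    qed
    show "fam ?M \<subseteq> rst ` kcycles (opv t) f i k"
    proof
      fix a assume "a \<in> fam ?M"
      then have a: "a S \<in> ?M S" for S unfolding fam_def by blast
      have "a S \<in> derivs f k \<and> good k S (a S)" if "card S = i" "V \<notin> S" for S
        using a[of S] that G(2)[of S] suff by auto
      moreover have "a S = 0" if "card S \<noteq> i \<or> V \<in> S" for S using a[of S] that by auto
      ultimately obtain c where "c \<in> kcycles (opv t) f i k" "rst c = a"
        using extend_good[of i a k] by blast
      then show "a \<in> rst ` kcycles (opv t) f i k" by blast
    qed
  qed
  moreover have "chn.dim (fam ?M) = (\<Sum>S\<in>UNIV. pol.dim (?M S))"
  proof (rule dim_fam)
    show "pol.subspace (?M S)" for S
      using G(1)[of S] by (cases "card S = i \<and> V \<notin> S") (simp_all only: simp_thms if_True if_False pol.subspace_single_0)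
    show "pol.fin_dim (?M S)" for S
      using pol.fin_dim_subset[OF fin_dim_derivs G(2)] fin_dim_0
      by (cases "card S = i \<and> V \<notin> S") (simp_all only: simp_thms if_True if_False)
  qed
  moreover have "(\<Sum>S\<in>UNIV. pol.dim (?M S)) = (\<Sum>S | card S = i \<and> V \<notin> S. pol.dim (G S))"
  proof -
    have "pol.dim {0 :: 'k pol} = 0" using pol.dim_zero_iff[OF fin_dim_0] by blast
    then show ?thesis by (intro sum.mono_neutral_cong_right) auto
  qed
  ultimately show ?thesis
    using cc.rank_nullity[OF linear_rst subspace_kcycles[of "opv t", OF linear_opv] fin_dim_kcycles, of f i k] by simp
qed

end

section \<open>Index sets and cycle counts up to degree d - 2\<close>

lemma card_subsets_insert:
  assumes "finite B" "x \<notin> B"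
  shows "card {S. card S = Suc i \<and> x \<in> S \<and> S \<subseteq> insert x B} = card B choose i"
proof -
  have "{S. card S = Suc i \<and> x \<in> S \<and> S \<subseteq> insert x B} = insert x ` {S. S \<subseteq> B \<and> card S = i}"
  proof
    show "insert x ` {S. S \<subseteq> B \<and> card S = i} \<subseteq> {S. card S = Suc i \<and> x \<in> S \<and> S \<subseteq> insert x B}"
      using assms finite_subset[OF _ assms(1)] by (auto simp: card_insert_if)
    show "{S. card S = Suc i \<and> x \<in> S \<and> S \<subseteq> insert x B} \<subseteq> insert x ` {S. S \<subseteq> B \<and> card S = i}"
    proof
      fix S assume S: "S \<in> {S. card S = Suc i \<and> x \<in> S \<and> S \<subseteq> insert x B}"
      then have "finite S" using assms(1) finite_subset by blast
      then have "S - {x} \<in> {S. S \<subseteq> B \<and> card S = i}" using S by (auto simp: card_Diff_singleton)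
      moreover have "S = insert x (S - {x})" using S by auto
      ultimately show "S \<in> insert x ` {S. S \<subseteq> B \<and> card S = i}" by blast
    qed
  qed
  moreover have "inj_on (insert x) {S. S \<subseteq> B \<and> card S = i}"
    using assms(2) by (intro inj_onI) (metis Diff_insert_absorb mem_Collect_eq subsetD)
  ultimately show ?thesis using n_subsets[OF assms(1), of i] by (simp add: card_image)
qed

lemma XYZ_eq: "{X, Y, Z} = - {U, V}"
proof -
  have "x \<in> {X, Y, Z} \<longleftrightarrow> x \<notin> {U, V}" for x by (cases x) simp_all
  then show ?thesis by blast
qed

lemma card_sets:
  "card {S. card S = i \<and> V \<notin> S} = 4 choose i"
  "card {S. card S = i \<and> V \<notin> S \<and> U \<notin> S} = 3 choose i"
  "card {S. card S = Suc i \<and> V \<notin> S \<and> U \<in> S} = 3 choose i"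
  "card {S. card S = Suc i \<and> V \<in> S \<and> U \<notin> S} = 3 choose i"
proof -
  have "{S. card S = i \<and> V \<notin> S} = {S. S \<subseteq> UNIV - {V} \<and> card S = i}" by auto
  then show "card {S. card S = i \<and> V \<notin> S} = 4 choose i"
    using n_subsets[of "UNIV - {V}" i] by (simp add: card_Diff_singleton card_UNIV_var)
  have "{S. card S = i \<and> V \<notin> S \<and> U \<notin> S} = {S. S \<subseteq> {X, Y, Z} \<and> card S = i}"
    unfolding XYZ_eq by auto
  then show "card {S. card S = i \<and> V \<notin> S \<and> U \<notin> S} = 3 choose i"
    using n_subsets[of "{X, Y, Z}" i] by (simp add: numeral_3_eq_3)
  have "{S. card S = Suc i \<and> V \<notin> S \<and> U \<in> S} = {S. card S = Suc i \<and> U \<in> S \<and> S \<subseteq> insert U {X, Y, Z}}"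
    unfolding XYZ_eq by auto
  then show "card {S. card S = Suc i \<and> V \<notin> S \<and> U \<in> S} = 3 choose i"
    using card_subsets_insert[of "{X, Y, Z}" U i] by (simp add: numeral_3_eq_3)
  have "{S. card S = Suc i \<and> V \<in> S \<and> U \<notin> S} = {S. card S = Suc i \<and> V \<in> S \<and> S \<subseteq> insert V {X, Y, Z}}"
    unfolding XYZ_eq by auto
  then show "card {S. card S = Suc i \<and> V \<in> S \<and> U \<notin> S} = 3 choose i"
    using card_subsets_insert[of "{X, Y, Z}" V i] by (simp add: numeral_3_eq_3)
qed

lemma rst_eq_0_iff: "rst c = 0 \<longleftrightarrow> (\<forall>S. V \<notin> S \<longrightarrow> c S = 0)"
proof -
  have "rst c = 0 \<longleftrightarrow> (\<forall>S. rst c S = 0 S)" by (rule fun_eq_iff)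
  then show ?thesis by (auto simp: rst_def)
qed

lemma chain_eq_0I:
  fixes c :: "'k::field chain"
  assumes "\<And>S. c S = 0"
  shows "c = 0"
  by (rule ext) (rule trans[OF assms zero_fun_apply[symmetric]])

lemma kcyclesD:
  assumes "c \<in> kcycles A f i k"
  shows "c \<in> kchains f i k" "kos A c T = 0"
proof -
  show "c \<in> kchains f i k" using assms unfolding kcycles_def by blast
  have "kos A c = 0" using assms unfolding kcycles_def by blast
  show "kos A c T = 0" unfolding \<open>kos A c = 0\<close> by (rule zero_fun_apply)
qed

context gen_perazzo
begin

text \<open>In the cycle equation at \<open>S - {V}\<close> every term except the V-term uses a set
  without V, where the cycle vanishes.\<close>

lemma rst_0_vt:
  assumes c: "c \<in> kcycles (opv t) f i k" "rst c = 0" and S: "V \<in> S"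
  shows "vt t (c S) = 0"
proof -
  let ?T = "S - {V}"
  have T: "V \<notin> ?T" "insert V ?T = S" using S by auto
  have c0: "c (insert w ?T) = 0" if "w \<in> UNIV - ?T - {V}" for w
    using c(2) that unfolding rst_eq_0_iff by auto
  have sum0: "(\<Sum>w\<in>UNIV - ?T - {V}. pscale (sg ?T w) (dv w (c (insert w ?T)))) = 0"
    by (intro sum.neutral ballI) (simp only: c0 dv_simps pol.scale_zero_right)
  have "kos (opv t) c ?T = pscale (sg ?T V) (vt t (c S)) + 0"
    using kos_opv_split[OF T(1), of t c] unfolding sum0 unfolding T(2) .
  then have "pscale (sg ?T V) (vt t (c S)) = 0"
    using kcyclesD(2)[OF c(1), of ?T] by (simp only: add_0_right)
  then show ?thesis using sg_nonzero pol.scale_eq_0_iff by blast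
qed

lemma rst_kernel_0:
  assumes "k \<le> d - 3"
  shows "chn.dim {c \<in> kcycles (opv t) f i k. rst c = 0} = 0"
proof -
  have "{c \<in> kcycles (opv t) f i k. rst c = 0} \<subseteq> {0}"
  proof
    fix c assume "c \<in> {c \<in> kcycles (opv t) f i k. rst c = 0}"
    then have c: "c \<in> kcycles (opv t) f i k" "rst c = 0" by auto
    have "c S = 0" for S
    proof (cases "V \<in> S")
      case True
      show ?thesis
        by (rule vt_inj_derivs[OF assms kchainsD(3)[OF kcyclesD(1)[OF c(1)]] rst_0_vt[OF c True]])
    next
      case False
      then show ?thesis using c(2) unfolding rst_eq_0_iff by blast
    qed
    then have "c = 0" by (rule chain_eq_0I)
    then show "c \<in> {0}" by blast
  qed
  then show ?thesis
    using chn.dim_zero_iff[OF chn.fin_dim_subset[OF fin_dim_kcycles[of "opv t" f i k]]] by blast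
qed

text \<open>All components lie in \<open>tau\<close>, which x, y, z and v' kill. For a set
  containing both U and V, the cycle equation at the set without U is therefore reduced to its
  u-term, and u is injective on \<open>tau\<close>. At sets with V but without U nothing constrains
  the component, since the operators still to be applied kill it.\<close>

lemma rst_kernel_tau:
  "{c \<in> kcycles (opv t) f i (d - 2). rst c = 0} =
    fam (\<lambda>S. if card S = i \<and> V \<in> S \<and> U \<notin> S then tau else {0})" (is "?L = fam ?M")
proof
  show "?L \<subseteq> fam ?M"
  proof
    fix c assume "c \<in> ?L"
    then have c: "c \<in> kcycles (opv t) f i (d - 2)" "rst c = 0" by auto
    note ck = kcyclesD(1)[OF c(1)]
    have ct: "c S \<in> tau" for S
    proof (cases "V \<in> S")
      case True
      then show ?thesis using rst_0_vt[OF c True] kchainsD(3)[OF ck] unfolding tau_def by blast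
    next
      case False
      then have "c S = 0" using c(2) unfolding rst_eq_0_iff by blast
      then show ?thesis using pol.subspace_0[OF subspace_tau] by simp
    qed
    have cU: "c S = 0" if "V \<in> S" "U \<in> S" for S
    proof (rule tau_U[OF ct])
      let ?T = "S - {U}"
      have T: "V \<in> ?T" "insert U ?T = S" using that by auto
      have s1: "(\<Sum>w\<in>UNIV - ?T. pscale (sg ?T w) (dv w (c (insert w ?T)))) =
        pscale (sg ?T U) (dv U (c (insert U ?T))) + (\<Sum>w\<in>UNIV - ?T - {U}. pscale (sg ?T w) (dv w (c (insert w ?T))))"
        by (rule sum.remove) auto
      have s2: "(\<Sum>w\<in>UNIV - ?T - {U}. pscale (sg ?T w) (dv w (c (insert w ?T)))) = 0"
      proof (intro sum.neutral ballI)
        fix w assume "w \<in> UNIV - ?T - {U}"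
        then have "w \<in> {X, Y, Z}" using T(1) by (cases w) auto
        then have "dv w (c (insert w ?T)) = 0" using tau_bin[OF ct, of "insert w ?T"] unfolding bin_def by blast
        then show "pscale (sg ?T w) (dv w (c (insert w ?T))) = 0" by (simp only: pol.scale_zero_right)
      qed
      have "kos (opv t) c ?T = pscale (sg ?T U) (dv U (c S)) + 0"
        using kos_opv_V[OF T(1), of t c] unfolding s1 s2 unfolding T(2) .
      then have "pscale (sg ?T U) (dv U (c S)) = 0"
        using kcyclesD(2)[OF c(1), of ?T] by (simp only: add_0_right)
      then show "dv U (c S) = 0" using sg_nonzero pol.scale_eq_0_iff by blast
    qed
    have "c S \<in> ?M S" for S
    proof (cases "card S = i \<and> V \<in> S \<and> U \<notin> S")
      case True
      then show ?thesis using ct by simp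
    next
      case False
      then have "c S = 0" using kchainsD(2)[OF ck, of S] cU[of S] c(2) unfolding rst_eq_0_iff by blast
      then show ?thesis using False by (simp only: if_False singleton_iff)
    qed
    then show "c \<in> fam ?M" unfolding fam_def by blast
  qed
  show "fam ?M \<subseteq> ?L"
  proof
    fix c assume "c \<in> fam ?M"
    then have c: "c S \<in> ?M S" for S unfolding fam_def by blast
    have c0: "c S = 0" if "\<not> (card S = i \<and> V \<in> S \<and> U \<notin> S)" for S using c[of S] that by (simp only: if_False singleton_iff)
    have ct: "c S \<in> tau" for S
      using c[of S] c0[of S] pol.subspace_0[OF subspace_tau] by (cases "card S = i \<and> V \<in> S \<and> U \<notin> S") auto
    have "c \<in> kchains f i (d - 2)"
      using c0 ct by (intro kchainsI) (auto simp: tau_def)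
    moreover have "kos (opv t) c T = 0" for T
    proof -
      have "opv t w (c (insert w T)) = 0" if "w \<notin> T" for w
      proof -
        consider "w = V" | "w \<noteq> V" "V \<notin> insert w T \<or> U \<in> insert w T" | "w \<in> {X, Y, Z}" by (cases w) auto
        then show ?thesis
        proof cases
          case 1
          then show ?thesis using ct[of "insert w T"] by (simp add: opv_def tau_def)
        next
          case 2
          then have "c (insert w T) = 0" by (intro c0) auto
          then show ?thesis by (simp only: pp.linear_0[OF linear_opv])
        next
          case 3
          then have "opv t w = dv w" by (auto simp: opv_def)
          then show ?thesis using 3 tau_bin[OF ct, of "insert w T"] unfolding bin_def by auto
        qed
      qed
      then have "(\<Sum>w\<in>UNIV - T. pscale (sg T w) (opv t w (c (insert w T)))) = 0"
      proof (intro sum.neutral ballI)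
        fix w assume *: "\<And>w. w \<notin> T \<Longrightarrow> opv t w (c (insert w T)) = 0" and "w \<in> UNIV - T"
        then have "opv t w (c (insert w T)) = 0" by blast
        then show "pscale (sg T w) (opv t w (c (insert w T))) = 0" by (simp only: pol.scale_zero_right)
      qed
      then show ?thesis unfolding kos_def .
    qed
    then have "kos (opv t) c = 0" by (rule chain_eq_0I)
    moreover have "rst c = 0" unfolding rst_eq_0_iff using c0 by blast
    ultimately show "c \<in> ?L" unfolding kcycles_def by blast
  qed
qed

lemma dim_kcycles_mid:
  assumes "2 \<le> k" "k \<le> d - 3"
  shows "chn.dim (kcycles (opv t) f i k) = 6 * (4 choose i)"
proof -
  have "chn.dim (kcycles (opv t) f i k) = chn.dim {c \<in> kcycles (opv t) f i k. rst c = 0} +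
    (\<Sum>S | card S = i \<and> V \<notin> S. pol.dim (derivs f k))"
    using kchainsD(3)[OF kcyclesD(1)] good_ge_2[of _ k] assms
    by (intro dim_kcycles_fam subspace_derivs) auto
  moreover have "minimal_hilb d k = 6" using assms d_ge unfolding minimal_hilb_def by auto
  ultimately show ?thesis using rst_kernel_0[OF assms(2)] card_sets(1)[of i] by (simp add: dims)
qed

lemma dim_kcycles_d2:
  "chn.dim (kcycles (opv t) f (Suc i) (d - 2)) = 6 * (4 choose Suc i) + (3 choose i)"
proof -
  have "chn.dim (kcycles (opv t) f (Suc i) (d - 2)) = chn.dim {c \<in> kcycles (opv t) f (Suc i) (d - 2). rst c = 0} +
    (\<Sum>S | card S = Suc i \<and> V \<notin> S. pol.dim (derivs f (d - 2)))"
    using kchainsD(3)[OF kcyclesD(1)] good_ge_2[of _ "d - 2"] d_ge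
    by (intro dim_kcycles_fam subspace_derivs) auto
  moreover have "minimal_hilb d (d - 2) = 6" using d_ge unfolding minimal_hilb_def by auto
  then have "(\<Sum>S | card S = Suc i \<and> V \<notin> S. pol.dim (derivs f (d - 2))) = 6 * (4 choose Suc i)"
    using card_sets(1)[of "Suc i"] by (simp add: dims)
  moreover have "chn.dim {c \<in> kcycles (opv t) f (Suc i) (d - 2). rst c = 0} = (3 choose i)"
  proof -
    let ?M = "\<lambda>S. if card S = Suc i \<and> V \<in> S \<and> U \<notin> S then tau else {0 :: 'k pol}"
    have "chn.dim (fam ?M) = (\<Sum>S\<in>UNIV. pol.dim (?M S))"
    proof (rule dim_fam)
      show "pol.subspace (?M S)" for S
        using subspace_tau by (cases "card S = Suc i \<and> V \<in> S \<and> U \<notin> S") (simp_all only: simp_thms if_True if_False pol.subspace_single_0)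
      show "pol.fin_dim (?M S)" for S
        using fin_dim_tau fin_dim_0
        by (cases "card S = Suc i \<and> V \<in> S \<and> U \<notin> S") (simp_all only: simp_thms if_True if_False)
    qed
    also have "\<dots> = (\<Sum>S | card S = Suc i \<and> V \<in> S \<and> U \<notin> S. 1)"
    proof -
      have "pol.dim {0 :: 'k pol} = 0" using pol.dim_zero_iff[OF fin_dim_0] by blast
      then show ?thesis by (intro sum.mono_neutral_cong_right) (auto simp: dim_tau)
    qed
    also have "\<dots> = (3 choose i)" using card_sets(4)[of i] by simp
    finally show ?thesis unfolding rst_kernel_tau .
  qed
  ultimately show ?thesis by simp
qed

lemma derivs_1'_sub: "derivs_1' \<subseteq> derivs f 1"
  unfolding derivs_1'_def using lie_derivs[OF self_derivs[of f]] vt_derivs[OF self_derivs[of f]]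
  by (auto intro!: pol.subspace_add[OF subspace_derivs] pol.subspace_scale[OF subspace_derivs])

lemma derivs_1'_span: "derivs_1' = pol.span {dv X f, dv Y f, dv Z f, vt t f}"
proof
  show "derivs_1' \<subseteq> pol.span {dv X f, dv Y f, dv Z f, vt t f}"
    unfolding derivs_1'_def lie_def by (auto intro!: pol.span_add pol.span_scale intro: pol.span_base)
  have eq: "pscale a (dv X f) + (pscale b (dv Y f) + (pscale c (dv Z f) + pscale e (vt t f))) \<in> derivs_1'" for a b c e
  proof -
    have "pscale a (dv X f) + (pscale b (dv Y f) + (pscale c (dv Z f) + pscale e (vt t f))) =
      lie ((\<lambda>_. 0)(X := a, Y := b, Z := c)) f + pscale e (vt t f)"
      by (simp add: lie_def add.assoc)
    then show ?thesis unfolding derivs_1'_def by blast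
  qed
  show "pol.span {dv X f, dv Y f, dv Z f, vt t f} \<subseteq> derivs_1'"
  proof
    fix x assume "x \<in> pol.span {dv X f, dv Y f, dv Z f, vt t f}"
    then obtain a b c e where "x - pscale a (dv X f) - pscale b (dv Y f) - pscale c (dv Z f) - pscale e (vt t f) = 0"
      unfolding pol.span_breakdown_eq pol.span_empty by blast
    then have "x = pscale a (dv X f) + (pscale b (dv Y f) + (pscale c (dv Z f) + pscale e (vt t f)))"
      by (simp only: algebra_simps right_minus_eq add_0_left add_0_right)
    then show "x \<in> derivs_1'" using eq by blast
  qed
qed

lemma dim_derivs_1': "pol.dim derivs_1' = 4"
proof -
  have fd: "pol.fin_dim derivs_1'" by (rule pol.fin_dim_subset[OF fin_dim_derivs derivs_1'_sub])
  obtain B where B: "B \<subseteq> derivs_1'" "finite B" "derivs_1' \<subseteq> pol.span B" "card B = pol.dim derivs_1'"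
    using pol.fin_dim_basis[OF fd] by metis
  have "derivs f 1 \<subseteq> pol.span (insert (dv U f) B)"
  proof
    fix n assume "n \<in> derivs f 1"
    then obtain c a b where n: "n = lie c f + pscale a (dv U f) + pscale b (vt t f)" using derivs_1_decomp by blast
    have "n - pscale a (dv U f) = lie c f + pscale b (vt t f)" unfolding n by (simp add: fun_eq_iff)
    then have "n - pscale a (dv U f) \<in> derivs_1'" unfolding derivs_1'_def by blast
    then show "n \<in> pol.span (insert (dv U f) B)" using B(3) pol.span_breakdown_eq by blast
  qed
  then have "pol.dim (derivs f 1) \<le> card (insert (dv U f) B)" by (rule pol.dim_le_card) (simp add: B(2))
  also have "\<dots> \<le> Suc (card B)" by (rule card_insert_le_m1) simp_all
  finally have "5 \<le> Suc (pol.dim derivs_1')" using B(4) by (simp add: dims minimal_hilb_def)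
  moreover have "pol.dim derivs_1' \<le> card {dv X f, dv Y f, dv Z f, vt t f}"
    by (rule pol.dim_le_card) (simp_all add: derivs_1'_span)
  moreover have "card {dv X f, dv Y f, dv Z f, vt t f} \<le> 4"
    using card_length[of "[dv X f, dv Y f, dv Z f, vt t f]"] by simp
  ultimately show ?thesis by simp
qed

lemma XYZ_dv_derivs_1:
  assumes "n \<in> derivs f 1" "a \<in> {X, Y, Z}"
  shows "dv a n \<in> vt t ` derivs f 1"
proof -
  obtain c x y where n: "n = lie c f + pscale x (dv U f) + pscale y (vt t f)" using derivs_1_decomp[OF assms(1)] .
  have "dv a n = pscale x (dv a (dv U f)) + pscale y (vt t (dv a f))"
    unfolding n dv_simps dv_lie_f[OF assms(2)] vt_dv by simp
  also have "dv a (dv U f) = vt t (lie (Cm a) f)" using U_dv[OF assms(2)] dv_comm[of a U f] by simp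
  also have "pscale x (vt t (lie (Cm a) f)) + pscale y (vt t (dv a f)) = vt t (pscale x (lie (Cm a) f) + pscale y (dv a f))"
    by (simp only: vt_simps)
  finally have eq: "dv a n = vt t (pscale x (lie (Cm a) f) + pscale y (dv a f))" .
  show ?thesis unfolding eq
    using lie_derivs[OF self_derivs[of f], of "Cm a"] dv_derivs[OF self_derivs[of f], of a]
    by (intro imageI pol.subspace_add[OF subspace_derivs] pol.subspace_scale[OF subspace_derivs]) simp_all
qed

text \<open>Modulo v' N_1 the cycle equation at \<open>S - {U}\<close> keeps only its u-term,
  because x, y, z send N_1 into v' N_1. So u times the component is divisible by v', which forces
  its u f coefficient to vanish.\<close>

lemma kcycles_1_U:
  assumes c: "c \<in> kcycles (opv t) f i 1" and S: "V \<notin> S" "U \<in> S"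
  shows "c S \<in> derivs_1'"
proof -
  note cd = kchainsD(3)[OF kcyclesD(1)[OF c]]
  let ?T = "S - {U}" and ?I = "vt t ` derivs f 1"
  have I: "pol.subspace ?I" by (rule pp.linear_subspace_image[OF linear_vt subspace_derivs])
  have T: "V \<notin> ?T" "insert U ?T = S" using S by auto
  let ?g = "\<lambda>w. pscale (sg ?T w) (dv w (c (insert w ?T)))"
  let ?r = "(\<Sum>w\<in>UNIV - ?T - {V} - {U}. ?g w)"
  have "(\<Sum>w\<in>UNIV - ?T - {V}. ?g w) = ?g U + ?r" by (rule sum.remove) auto
  then have "kos (opv t) c ?T = pscale (sg ?T V) (vt t (c (insert V ?T))) + (?g U + ?r)"
    using kos_opv_split[OF T(1), of t c] by (simp only:)
  then have "pscale (sg ?T V) (vt t (c (insert V ?T))) + (?g U + ?r) = 0"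
    using kcyclesD(2)[OF c, of ?T] by (simp only:)
  then have "?g U + (pscale (sg ?T V) (vt t (c (insert V ?T))) + ?r) = 0"
    by (simp only: add_ac)
  then have g: "?g U = - (pscale (sg ?T V) (vt t (c (insert V ?T))) + ?r)"
    by (rule eq_neg_iff_add_eq_0[THEN iffD2])
  have "?r \<in> ?I"
  proof (intro pol.subspace_sum[OF I] pol.subspace_scale[OF I] XYZ_dv_derivs_1 cd)
    show "w \<in> {X, Y, Z}" if "w \<in> UNIV - ?T - {V} - {U}" for w using that by (cases w) auto
  qed
  then have "?g U \<in> ?I" unfolding g
    by (intro pol.subspace_neg[OF I] pol.subspace_add[OF I] pol.subspace_scale[OF I] imageI cd)
  then have "pscale (sg ?T U) (?g U) \<in> ?I" by (rule pol.subspace_scale[OF I])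
  then have U: "dv U (c S) \<in> ?I" by (simp only: T(2) pol.scale_scale sg_sq pol.scale_one)
  obtain b x y where n: "c S = lie b f + pscale x (dv U f) + pscale y (vt t f)" using derivs_1_decomp[OF cd] .
  have "pscale x (dv U (dv U f)) = dv U (c S) - (vt t (lie (Cc b) f) + pscale y (vt t (dv U f)))"
    unfolding n dv_simps U_lie[OF self_derivs] vt_dv by simp
  also have "\<dots> \<in> ?I"
    using lie_derivs[OF self_derivs[of f], of "Cc b"] dv_derivs[OF self_derivs[of f], of U]
    by (intro pol.subspace_diff[OF I] pol.subspace_add[OF I] pol.subspace_scale[OF I] imageI U) auto
  finally obtain m where m: "m \<in> derivs f 1" "pscale x (dv U (dv U f)) = vt t m" by blast
  have "vt t m + pscale (- x) (dv U (dv U f)) = 0" unfolding m(2)[symmetric] by simp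
  then have "- x = 0" by (rule UU_not_in_vt_image[OF m(1)])
  then have "c S = lie b f + pscale y (vt t f)" using n by simp
  then show ?thesis unfolding derivs_1'_def by blast
qed

lemma dim_kcycles_1:
  "chn.dim (kcycles (opv t) f (Suc i) 1) = 5 * (3 choose Suc i) + 4 * (3 choose i)"
proof -
  let ?G = "\<lambda>S. if U \<in> S then derivs_1' else derivs f 1"
  have "chn.dim (kcycles (opv t) f (Suc i) 1) = chn.dim {c \<in> kcycles (opv t) f (Suc i) 1. rst c = 0} +
    (\<Sum>S | card S = Suc i \<and> V \<notin> S. pol.dim (?G S))"
  proof (rule dim_kcycles_fam)
    fix S
    have "pol.subspace derivs_1'" unfolding derivs_1'_span by (rule pol.subspace_span)
    then show "pol.subspace (?G S)" using subspace_derivs[of f 1] by (cases "U \<in> S") (simp_all only: if_True if_False)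
    show "?G S \<subseteq> derivs f 1" using derivs_1'_sub by simp
    show "good 1 S n" if "V \<notin> S" "n \<in> ?G S" for n
      using that good_1[of S n] good_1_XYZ[of S n] by (cases "U \<in> S") (simp_all only: if_True if_False simp_thms)
    show "c S \<in> ?G S" if "c \<in> kcycles (opv t) f (Suc i) 1" "V \<notin> S" for c
      using kcycles_1_U[OF that] kchainsD(3)[OF kcyclesD(1)[OF that(1)]] by simp
  qed
  moreover have "chn.dim {c \<in> kcycles (opv t) f (Suc i) 1. rst c = 0} = 0"
    by (rule rst_kernel_0) (use d_ge in simp)
  moreover have "(\<Sum>S | card S = Suc i \<and> V \<notin> S. pol.dim (?G S)) =
    (\<Sum>S | card S = Suc i \<and> V \<notin> S \<and> U \<notin> S. 5) + (\<Sum>S | card S = Suc i \<and> V \<notin> S \<and> U \<in> S. 4)"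
  proof -
    have "{S. card S = Suc i \<and> V \<notin> S} = {S. card S = Suc i \<and> V \<notin> S \<and> U \<notin> S} \<union> {S. card S = Suc i \<and> V \<notin> S \<and> U \<in> S}"
      by auto
    then have "(\<Sum>S | card S = Suc i \<and> V \<notin> S. pol.dim (?G S)) =
      (\<Sum>S | card S = Suc i \<and> V \<notin> S \<and> U \<notin> S. pol.dim (?G S)) + (\<Sum>S | card S = Suc i \<and> V \<notin> S \<and> U \<in> S. pol.dim (?G S))"
      by (simp only:) (intro sum.union_disjoint, auto)
    moreover have "pol.dim (derivs f 1) = 5" by (simp add: dims minimal_hilb_def)
    ultimately show ?thesis using dim_derivs_1' by (auto intro!: arg_cong2[of _ _ _ _ "(+)"] sum.cong)
  qed
  ultimately show ?thesis using card_sets(2)[of "Suc i"] card_sets(3)[of i] by simp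
qed

end

section \<open>Cycles in the extreme degrees\<close>

context min_perazzo
begin

text \<open>All components are multiples of \<open>f\<close>, so each cycle equation is a linear
  relation among the five independent first derivatives of \<open>f\<close>.\<close>

lemma kcycles_bottom: "chn.dim (kcycles dv f (Suc i) 0) = 0"
proof -
  have "c = 0" if c: "c \<in> kcycles dv f (Suc i) 0" for c
  proof (rule chain_eq_0I)
    fix S
    have "\<exists>s. c S = pscale s f" for S
      using kchainsD(3)[OF kcyclesD(1)[OF c], of S] unfolding derivs_0 pol.span_singleton by blast
    then obtain s where s: "\<And>S. c S = pscale (s S) f" by metis
    show "c S = 0"
    proof (cases "S = {}")
      case True
      then show ?thesis using kchainsD(2)[OF kcyclesD(1)[OF c], of S] by simp
    next
      case False
      then obtain w where "w \<in> S" by blast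
      let ?T = "S - {w}"
      have T: "insert w ?T = S" "w \<notin> ?T" using \<open>w \<in> S\<close> by auto
      define e where "e x = (if x \<in> ?T then 0 else sg ?T x * s (insert x ?T))" for x
      have "kos dv c ?T = (\<Sum>x\<in>UNIV - ?T. pscale (e x) (dv x f))"
        unfolding kos_def s dv_simps pol.scale_scale
      proof (intro sum.cong refl)
        fix x assume "x \<in> UNIV - ?T"
        then have "e x = sg ?T x * s (insert x ?T)" by (simp only: e_def Diff_iff if_False)
        then show "pscale (sg ?T x * s (insert x ?T)) (dv x f) = pscale (e x) (dv x f)" by (simp only:)
      qed
      also have "\<dots> = (\<Sum>x\<in>UNIV. pscale (e x) (dv x f))"
        by (intro sum.mono_neutral_left) (auto simp: e_def)
      finally have "(\<Sum>x\<in>UNIV. pscale (e x) (dv x f)) = 0"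
        using kcyclesD(2)[OF c, of ?T] by (simp only:)
      then have "e w = 0" by (rule dv_f_independent)
      then have "s S = 0" using T sg_nonzero[of ?T w, where 'k = 'k] by (simp add: e_def)
      then show ?thesis unfolding s by (simp only: pol.scale_zero_left)
    qed
  qed
  then have "kcycles dv f (Suc i) 0 \<subseteq> {0}" by blast
  then show ?thesis using chn.dim_zero_iff[OF fin_dim_kcycles] by blast
qed

lemma derivs_above:
  assumes "d < k"
  shows "n \<in> derivs f k \<Longrightarrow> n = 0"
proof -
  have "minimal_hilb d k = 0" using assms d_ge unfolding minimal_hilb_def by auto
  then have "pol.dim (derivs f k) = 0" by (simp add: dims)
  then show "n \<in> derivs f k \<Longrightarrow> n = 0" using pol.dim_zero_iff[OF fin_dim_derivs] by blast
qed

lemma kcycles_above: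
  assumes "d \<le> k"
  shows "kcycles dv f i k = kchains f i k"
proof -
  have "kos dv c = 0" if c: "c \<in> kchains f i k" for c
  proof (rule chain_eq_0I)
    fix T
    have "dv w (c S) = 0" for w S
      by (rule derivs_above[of "Suc k"]) (use assms dv_derivs[OF kchainsD(3)[OF c]] in auto)
    then have "pscale (sg T w) (dv w (c (insert w T))) = 0" for w by (simp only: pol.scale_zero_right)
    then show "kos dv c T = 0" unfolding kos_def by (intro sum.neutral ballI)
  qed
  then show ?thesis unfolding kcycles_def by blast
qed

lemma dim_Rdeg_le: "pol.dim (Rdeg k :: 'k pol set) \<le> card (mons k)"
proof -
  have "pol.dim (Rdeg k :: 'k pol set) \<le> card (monomial ` mons k :: 'k pol set)"
  proof (rule pol.dim_le_card)
    show "Rdeg k \<subseteq> pol.span (monomial ` mons k :: 'k pol set)"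
    proof
      fix r :: "'k pol" assume "r \<in> Rdeg k"
      then have r: "r = (\<Sum>a\<in>mons k. pscale (r a) (monomial a))" by (intro homog_expand) (simp add: Rdeg_def)
      show "r \<in> pol.span (monomial ` mons k)"
        by (subst r) (intro pol.span_sum pol.span_scale pol.span_base imageI)
    qed
  qed (simp add: finite_mons)
  also have "\<dots> \<le> card (mons k)" by (rule card_image_le[OF finite_mons])
  finally show ?thesis .
qed

text \<open>N_d and N_{d-1} have dimensions 1 and 5, the numbers of monomials of degree 0 and 1, so
  they fill the spaces of forms that contain them.\<close>

lemma derivs_top: "derivs f d = Rdeg 0" "derivs f (d - 1) = Rdeg 1"
proof -
  have sub: "derivs f k \<subseteq> Rdeg (d - k)" for k
    using homog_derivs[OF homog_f] by (auto simp: Rdeg_def)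
  have "mons 0 = {0}" by (auto simp: mons_def mdeg_0_iff)
  then have "pol.dim (Rdeg 0 :: 'k pol set) \<le> 1" using dim_Rdeg_le[of 0] by simp
  then show "derivs f d = Rdeg 0"
    using sub[of d] d_ge by (intro pol.dim_eq_imp_eq fin_dim_Rdeg subspace_derivs) (simp_all add: dims minimal_hilb_def)
  have "card (mons 1) \<le> card (UNIV :: var set)" unfolding mons_1 by (rule card_image_le) simp
  then have "pol.dim (Rdeg 1 :: 'k pol set) \<le> 5" using dim_Rdeg_le[of 1] by (simp add: card_UNIV_var)
  then show "derivs f (d - 1) = Rdeg 1"
    using sub[of "d - 1"] d_ge by (intro pol.dim_eq_imp_eq fin_dim_Rdeg subspace_derivs) (simp_all add: dims minimal_hilb_def)
qed

lemma dv_mulvar_const: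
  assumes "homog 0 g"
  shows "dv w (mulvar x g) = (if w = x then g else (0 :: 'k pol))"
proof
  fix m
  show "dv w (mulvar x g) m = (if w = x then g else (0 :: 'k pol)) m"
  proof (cases "w = x")
    case True
    have "(m + monom_var x)(x := (m + monom_var x) x - 1) = m" by (auto simp: fun_eq_iff monom_var_def)
    then show ?thesis using True by (simp add: dv_def shift_def mulvar_def monom_var_def)
  next
    case False
    have "g ((m + monom_var w)(x := (m + monom_var w) x - 1)) = 0"
    proof (rule ccontr)
      assume "g ((m + monom_var w)(x := (m + monom_var w) x - 1)) \<noteq> 0"
      then have "(m + monom_var w)(x := (m + monom_var w) x - 1) = 0" using assms mdeg_0_iff unfolding homog_def by blast
      then have "((m + monom_var w)(x := (m + monom_var w) x - 1)) w = 0" by (simp only: zero_fun_apply)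
      then show False using False by (simp add: monom_var_def)
    qed
    then show ?thesis using False by (simp add: dv_def shift_def mulvar_def)
  qed
qed

text \<open>The Koszul complex of the polynomial ring is exact, by the homotopy built from multiplication with
  the variables; in the two top degrees the derivatives exhaust all forms.\<close>

lemma kos_surj_top:
  assumes i: "i \<le> 4" and e: "e \<in> kchains f i d"
  shows "\<exists>c\<in>kchains f (Suc i) (d - 1). kos dv c = e"
proof -
  have h: "homog 0 (e S)" for S using kchainsD(3)[OF e, of S] by (simp add: derivs_top Rdeg_def)
  \<comment> \<open>Since the values of \<open>e\<close> are constants, dv w keeps only the summand
    x = w. Each of the 5 - i variables outside \<open>T\<close> thus contributes a copy of
    \<open>e T\<close>, and \<open>q\<close> normalizes their number.\<close>
  define q :: 'k where "q = 1 / of_nat (5 - i)"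
  define c where "c S = (if card S = Suc i then pscale q (\<Sum>x\<in>S. pscale (sg (S - {x}) x) (mulvar x (e (S - {x})))) else 0)" for S
  have "mulvar x (e S) \<in> Rdeg 1" for x S using homog_mulvar[OF h] by (simp add: Rdeg_def)
  then have "(\<Sum>x\<in>S. pscale (sg (S - {x}) x) (mulvar x (e (S - {x})))) \<in> Rdeg 1" for S
    by (intro pol.subspace_sum[OF subspace_Rdeg] pol.subspace_scale[OF subspace_Rdeg])
  then have "pscale q (\<Sum>x\<in>S. pscale (sg (S - {x}) x) (mulvar x (e (S - {x})))) \<in> Rdeg 1" for S
    by (rule pol.subspace_scale[OF subspace_Rdeg])
  then have ck: "c \<in> kchains f (Suc i) (d - 1)"
    by (intro kchainsI) (simp_all only: c_def derivs_top simp_thms if_True if_False)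
  have "kos dv c T = e T" for T
  proof (cases "card T = i")
    case False
    then have "c (insert w T) = 0" if "w \<in> UNIV - T" for w using that by (simp add: c_def)
    then have "(\<Sum>w\<in>UNIV - T. pscale (sg T w) (dv w (c (insert w T)))) = 0"
      by (intro sum.neutral ballI) (simp only: dv_simps pol.scale_zero_right)
    then have "kos dv c T = 0" unfolding kos_def .
    then show ?thesis using kchainsD(2)[OF e False] by (simp only:)
  next
    case True
    have "pscale (sg T w) (dv w (c (insert w T))) = pscale q (e T)" if w: "w \<in> UNIV - T" for w
    proof -
      let ?S = "insert w T"
      have S: "card ?S = Suc i" "?S - {w} = T" using w True by auto
      have "dv w (c ?S) = pscale q (\<Sum>x\<in>?S. pscale (sg (?S - {x}) x) (dv w (mulvar x (e (?S - {x})))))"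
        using S(1) by (simp only: c_def simp_thms if_True dv_simps)
      also have "(\<Sum>x\<in>?S. pscale (sg (?S - {x}) x) (dv w (mulvar x (e (?S - {x}))))) =
        (\<Sum>x\<in>?S. if x = w then pscale (sg T w) (e T) else 0)"
      proof (intro sum.cong refl)
        fix x
        show "pscale (sg (?S - {x}) x) (dv w (mulvar x (e (?S - {x})))) = (if x = w then pscale (sg T w) (e T) else 0)"
          unfolding dv_mulvar_const[OF h] using S(2) by (cases "x = w") auto
      qed
      also have "\<dots> = pscale (sg T w) (e T)" by simp
      finally have "pscale (sg T w) (dv w (c ?S)) = pscale (sg T w * (q * sg T w)) (e T)"
        by (simp only: pol.scale_scale)
      also have "sg T w * (q * sg T w) = q" using sg_sq[of T w, where 'k = 'k] by (simp add: mult.left_commute)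
      finally show ?thesis .
    qed
    then have "kos dv c T = (\<Sum>w\<in>UNIV - T. pscale q (e T))" unfolding kos_def by (intro sum.cong refl)
    also have "\<dots> = pscale (of_nat (card (UNIV - T)) * q) (e T)"
      by (simp only: sum_constant_scale pol.sum_constant_scale pol.scale_scale)
    also have "card (UNIV - T) = 5 - i" using True by (simp add: card_Diff_subset card_UNIV_var)
    also have "of_nat (5 - i) * q = 1"
    proof -
      have "5 - i \<noteq> 0" using i by simp
      then have "(of_nat (5 - i) :: 'k) \<noteq> 0" by (simp only: of_nat_eq_0_iff not_False_eq_True)
      then show ?thesis unfolding q_def times_divide_eq_right mult_1_right by (rule divide_self)
    qed
    finally show ?thesis by (simp only: pol.scale_one)
  qed
  then have "kos dv c = e" by blast
  then show ?thesis using ck by blast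
qed

text \<open>The differential maps onto all chains in degree d, where N_d has dimension 1, so its
  rank is 5 choose i. The additive form avoids truncated subtraction.\<close>

lemma dim_kcycles_d1:
  assumes "i \<le> 4"
  shows "chn.dim (kcycles dv f (Suc i) (d - 1)) + (5 choose i) = 5 * (5 choose Suc i)"
proof -
  have d: "Suc (d - 1) = d" using d_ge by simp
  have "kos dv ` kchains f (Suc i) (d - 1) = kchains f i d"
  proof
    show "kchains f i d \<subseteq> kos dv ` kchains f (Suc i) (d - 1)"
      using kos_surj_top[OF assms] by blast
    show "kos dv ` kchains f (Suc i) (d - 1) \<subseteq> kchains f i d"
    proof (intro image_subsetI kchainsI)
      fix c S assume c: "c \<in> kchains f (Suc i) (d - 1)"
      have "dv w (c (insert w S)) \<in> derivs f d" for w using dv_derivs[OF kchainsD(3)[OF c]] unfolding d .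
      then show "kos dv c S \<in> derivs f d" unfolding kos_def
        by (intro pol.subspace_sum[OF subspace_derivs] pol.subspace_scale[OF subspace_derivs])
      assume "card S \<noteq> i"
      then have "c (insert w S) = 0" if "w \<in> UNIV - S" for w using that kchainsD(2)[OF c, of "insert w S"] by simp
      then have "(\<Sum>w\<in>UNIV - S. pscale (sg S w) (dv w (c (insert w S)))) = 0"
        by (intro sum.neutral ballI) (simp only: dv_simps pol.scale_zero_right)
      then show "kos dv c S = 0" unfolding kos_def .
    qed
  qed
  moreover have "minimal_hilb d (d - 1) = 5" "minimal_hilb d d = 1" using d_ge by (auto simp: minimal_hilb_def)
  ultimately show ?thesis
    using dim_kcycles_image[of dv, OF linear_dv, of f "Suc i" "d - 1"] by (simp add: dim_kchains dims)
qed

end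

section \<open>The Betti table\<close>

text \<open>In the branch \<open>k = d - 1\<close> the subtraction truncates only for \<open>i \<ge> 6\<close>, where the count is indeed \<open>0\<close>.\<close>

definition cycle_count :: "nat \<Rightarrow> nat \<Rightarrow> nat \<Rightarrow> nat" where
  "cycle_count d i k =
     (if i = 0 then minimal_hilb d k
      else if k = 0 then 0
      else if k = 1 then 5 * (3 choose i) + 4 * (3 choose (i - 1))
      else if k \<le> d - 3 then 6 * (4 choose i)
      else if k = d - 2 then 6 * (4 choose i) + (3 choose (i - 1))
      else if k = d - 1 then 5 * (5 choose i) - (5 choose (i - 1))
      else if k = d then 5 choose i else 0)"

lemma (in min_perazzo) dim_kcycles: "chn.dim (kcycles dv f i k) = cycle_count d i k"
proof (cases i)
  case 0
  then show ?thesis by (simp add: kcycles_0 dim_kchains dims cycle_count_def)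
next
  case (Suc j)
  obtain t where "\<forall>c. vt t (lie c f) = 0 \<longrightarrow> lie c f = 0" using ex_vt_inj by blast
  then interpret gen_perazzo f d t by unfold_locales blast
  have top: "cycle_count d i (d - 1) = 5 * (5 choose Suc j) - (5 choose j)"
    using Suc d_ge unfolding cycle_count_def by auto
  consider "k = 0" | "k = 1" | "2 \<le> k" "k \<le> d - 3" | "k = d - 2" | "k = d - 1" "j \<le> 4" | "k = d - 1" "5 \<le> j"
    | "d \<le> k" by linarith
  then show ?thesis
  proof cases
    case 1
    then show ?thesis using kcycles_bottom[of j] Suc by (simp add: cycle_count_def)
  next
    case 2
    then show ?thesis using dim_kcycles_1[of j] dim_kcycles_opv[of f i k t] Suc by (simp add: cycle_count_def)
  next
    case 3
    then show ?thesis using dim_kcycles_mid[of k i] dim_kcycles_opv[of f i k t] Suc by (simp add: cycle_count_def)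
  next
    case 4
    have "\<not> d - 2 \<le> d - 3" "d - 2 \<noteq> Suc 0" "d - 2 \<noteq> 0" using d_ge by arith+
    with 4 show ?thesis using dim_kcycles_d2[of j] dim_kcycles_opv[of f i k t] Suc d_ge by (simp add: cycle_count_def)
  next
    case 5
    then show ?thesis using dim_kcycles_d1[of j] Suc top by simp
  next
    case 6
    have "chn.dim (kchains f i k) = 0" using Suc 6 by (simp add: dim_kchains)
    then have "chn.dim (kcycles dv f i k) = 0"
      using dim_kcycles_image[of dv, OF linear_dv, of f i k] by linarith
    moreover have "5 choose Suc j = 0" using 6 by simp
    ultimately show ?thesis unfolding 6(1) top by linarith
  next
    case 7
    have "minimal_hilb d k = (if k = d then 1 else 0)" using 7 d_ge unfolding minimal_hilb_def by auto
    then have "chn.dim (kcycles dv f i k) = (if k = d then 5 choose i else 0)"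
      using kcycles_above[OF 7] by (simp add: dim_kchains dims)
    then show ?thesis using 7 Suc d_ge unfolding cycle_count_def by auto
  qed
qed

lemma choose_values:
  "(3 choose 0) = (1 :: nat)" "(3 choose 1) = (3 :: nat)" "(3 choose 2) = (3 :: nat)" "(3 choose 3) = (1 :: nat)" "(3 choose 4) = (0 :: nat)" "(3 choose 5) = (0 :: nat)" "(3 choose 6) = (0 :: nat)" "(4 choose 0) = (1 :: nat)" "(4 choose 1) = (4 :: nat)" "(4 choose 2) = (6 :: nat)" "(4 choose 3) = (4 :: nat)" "(4 choose 4) = (1 :: nat)" "(4 choose 5) = (0 :: nat)" "(4 choose 6) = (0 :: nat)" "(5 choose 0) = (1 :: nat)" "(5 choose 1) = (5 :: nat)" "(5 choose 2) = (10 :: nat)" "(5 choose 3) = (10 :: nat)" "(5 choose 4) = (5 :: nat)" "(5 choose 5) = (1 :: nat)" "(5 choose 6) = (0 :: nat)"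
  by code_simp+

lemma betti_table:
  assumes "5 \<le> d"
  shows "cycle_count d i k - (if k = 0 then 0 else (5 choose Suc i) * minimal_hilb d (k - 1) - cycle_count d (Suc i) (k - 1))
    = perazzo_betti d i (i + k)"
proof -
  obtain e where d: "d = e + 5" using assms le_Suc_ex[of 5 d] by (auto simp: add.commute)
  show ?thesis
  proof (cases "i \<le> 5")
    case False
    then have z: "(5 choose i) = 0" "(4 choose i) = 0" "(3 choose i) = 0" "(3 choose (i - 1)) = 0"
      by (simp_all add: binomial_eq_0)
    have "cycle_count d i k = 0" unfolding cycle_count_def z using False by simp
    moreover have "perazzo_betti d i (i + k) = 0" using False unfolding perazzo_betti_def by simp
    ultimately show ?thesis by simp
  next
    case True
    then have i: "i \<in> {0, 1, 2, 3, 4, 5}" by auto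
    note simps = cycle_count_def perazzo_betti_def minimal_hilb_def choose_values
    \<comment> \<open>The formula involves degrees k and k - 1, so a separate row is needed one step
      past each change of the count; only between 3 and d - 3 do both fall in the uniform
      range.\<close>
    consider "k = 0" | "k = 1" | "k = 2" | "3 \<le> k" "k \<le> e + 2" | "k = e + 3" | "k = e + 4" | "k = e + 5" | "k = e + 6" | "e + 7 \<le> k"
      by linarith
    then show ?thesis
    proof cases
      case 1 then show ?thesis using i unfolding d by (elim insertE emptyE; simp add: simps del: One_nat_def)
    next
      case 2 then show ?thesis using i unfolding d by (elim insertE emptyE; simp add: simps del: One_nat_def)
    next
      case 3 then show ?thesis using i unfolding d by (elim insertE emptyE; simp add: simps del: One_nat_def)
    next
      case 4
      then obtain l where l: "k = l + 3" using le_Suc_ex[of 3 k] by (auto simp: add.commute)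
      then obtain m where m: "e = l + 1 + m" using 4 le_Suc_ex[of "l + 1" e] by auto
      show ?thesis using i unfolding d l m by (elim insertE emptyE; simp add: simps del: One_nat_def)
    next
      case 5 then show ?thesis using i unfolding d by (elim insertE emptyE; simp add: simps del: One_nat_def)
    next
      case 6 then show ?thesis using i unfolding d by (elim insertE emptyE; simp add: simps del: One_nat_def)
    next
      case 7 then show ?thesis using i unfolding d by (elim insertE emptyE; simp add: simps del: One_nat_def)
    next
      case 8 then show ?thesis using i unfolding d by (elim insertE emptyE; simp add: simps del: One_nat_def)
    next
      case 9
      then obtain m where m: "k = e + 7 + m" using le_Suc_ex by blast
      show ?thesis using i unfolding d m by (elim insertE emptyE; simp add: simps del: One_nat_def)
    qed
  qed
qed

section \<open>From Perazzo forms to the Betti table\<close>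

lemma homog_mulvar_pred:
  assumes "homog (d - 1) p" "0 < d"
  shows "homog d (mulvar w p)"
  using homog_mulvar[OF assms(1), of w] assms(2) by simp

lemma perazzo_form_support:
  assumes "perazzo_form d F" "0 < d"
  shows "homog d F" "F m \<noteq> 0 \<Longrightarrow> m X + m Y + m Z \<le> 1"
proof -
  obtain p0 p1 p2 G where p: "in_KUV (d - 1) p0" "in_KUV (d - 1) p1" "in_KUV (d - 1) p2" "in_KUV d G"
    and F: "F = (\<lambda>m. mulvar X p0 m + mulvar Y p1 m + mulvar Z p2 m + G m)"
    using assms(1) unfolding perazzo_form_def by blast
  have nz: "mulvar X p0 m \<noteq> 0 \<or> mulvar Y p1 m \<noteq> 0 \<or> mulvar Z p2 m \<noteq> 0 \<or> G m \<noteq> 0" if "F m \<noteq> 0" for m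
    using that unfolding F by auto
  have "homog d (mulvar X p0)" "homog d (mulvar Y p1)" "homog d (mulvar Z p2)" "homog d G"
    using p assms(2) unfolding in_KUV_def by (simp_all add: homog_mulvar_pred)
  then show "homog d F" using nz unfolding homog_def by blast
  assume "F m \<noteq> 0"
  from nz[OF this] show "m X + m Y + m Z \<le> 1"
    using p unfolding in_KUV_def by (elim disjE) (auto simp: mulvar_def split: if_splits)
qed

text \<open>Every monomial of a Perazzo form has degree at most one in X, Y, Z, whereas two
  derivatives by x, y, z read coefficients of degree at least two there.\<close>

lemma min_perazzo_hat:
  assumes "5 \<le> d" "perazzo_form d F" "\<And>k. hilb F k = minimal_hilb d k"
  shows "min_perazzo (hat F) d"
proof
  have d: "0 < d" using assms(1) by simp
  show "homog d (hat F)" using perazzo_form_support(1)[OF assms(2) d] by (auto simp: homog_def hat_def)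
  show "5 \<le> d" by (rule assms(1))
  show "pol.dim (derivs (hat F) k) = minimal_hilb d k" for k by (simp only: dim_derivs_hat assms(3))
  have "dv b (dv a (hat F)) = 0" if "a \<in> {X, Y, Z}" "b \<in> {X, Y, Z}" for a b
  proof
    fix m
    have "2 \<le> (m + monom_var b + monom_var a) X + (m + monom_var b + monom_var a) Y + (m + monom_var b + monom_var a) Z"
      using that by (auto simp: monom_var_def)
    then have "F (m + monom_var b + monom_var a) = 0"
      using perazzo_form_support(2)[OF assms(2) d, of "m + monom_var b + monom_var a"] by linarith
    then show "dv b (dv a (hat F)) m = 0 m" by (simp add: dv_def shift_def hat_def)
  qed
  then show "bin (dv a (hat F))" if "a \<in> {X, Y, Z}" for a
    using that unfolding bin_def by blast
qed

theorem theorem5p4: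
  fixes F :: "'k::field_char_0 pol" and d :: nat
  assumes alg_closed: "\<forall>p :: 'k poly. 0 < degree p \<longrightarrow> (\<exists>x. poly p x = 0)"
    and deg: "5 \<le> d"
    and perazzo: "perazzo_form d F"
    and hilb_min: "\<forall>k. hilb F k = minimal_hilb d k"
  shows "\<forall>i j. betti F i j = perazzo_betti d i j"
proof (intro allI)
  fix i j
  interpret min_perazzo "hat F" d using min_perazzo_hat[OF deg perazzo] hilb_min by blast
  show "betti F i j = perazzo_betti d i j"
  proof (cases "j < i")
    case True
    then have "perazzo_betti d i j = 0" using deg unfolding perazzo_betti_def by auto
    then show ?thesis using betti_eq_0[OF True] by simp
  next
    case False
    then obtain k where j: "j = i + k" using le_Suc_ex[of i j] by auto
    show ?thesis unfolding j betti_eq dim_kcycles dim_kchains dims by (rule betti_table[OF deg])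
  qed
qed

end
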